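(* The map which associates to $\omega\in\overline{\mathfrak{T}}$, with data $I,L,L',J,M,M',\sigma$, the 5-tuple $$\mathrm{gRS}(\omega)=(T_1,T_2;\lambda',\mu';\nu)$$ given by $$T_1=[L]*\mathrm{RS}_1(\sigma)*[L'],\quad T_2=[M]*\mathrm{RS}_2(\sigma)*[M'],$$ $$\lambda'=\mathrm{shape}([L]*\mathrm{RS}_1(\sigma)),\quad \mu'=\mathrm{shape}([M]*\mathrm{RS}_2(\sigma)),\quad \nu=\mathrm{shape}(\mathrm{RS}_1(\sigma)),$$ is a (well-defined) bijection $$\mathrm{gRS}:\overline{\mathfrak{T}}\stackrel{\sim}{\longrightarrow}\mathcal{T}:=\bigsqcup_{(\lambda,\mu)\in\mathcal{P}(p)\times\mathcal{P}(q)}\mathcal{T}_{\lambda,\mu},$$ where $\mathcal{T}_{\lambda,\mu}$ is the set of 5-tuples $(T_1,T_2;\lambda',\mu';\nu)$ such that - $T_1$ and $T_2$ are standard Young tableaux of shapes $\lambda$ and $\mu$, respectively; - $\lambda',\mu',\nu$ are Young diagrams such that $\nu\subset\lambda'\subset\lambda$ and $\nu\subset\mu'\subset\mu$, where each of the skew diagrams $\lambda\setminus\lambda'$, $\lambda'\setminus\nu$, $\mu\setminus\mu'$, $\mu'\setminus\nu$ is a column strip, and $|\lambda'|+|\mu'|=|\nu|+r$.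
   Context: Let $p,q\ge 1$ and $0\le r\le p+q$ be integers. $\mathfrak{T}$ is the set of $(p+q)\times r$ matrices of rank $r$ of the form $\omega=\begin{pmatrix}\tau_1\\ \tau_2\end{pmatrix}$, where $\tau_1$ ($p\times r$) and $\tau_2$ ($q\times r$) have entries in $\{0,1\}$ with at most one $1$ in each row and each column; $\overline{\mathfrak{T}}=\mathfrak{T}/\mathfrak{S}_r$ is the quotient by column permutations. Data of $\omega\in\overline{\mathfrak T}$: each column of $\omega$ with exactly two $1$'s, in row $i$ of $\tau_1$ and row $j$ of $\tau_2$, puts $i\in I$, $j\in J$ and $\sigma(j)=i$; this defines $I\subset\{1,\dots,p\}$, $J\subset\{1,\dots,q\}$ and a bijection $\sigma:J\to I$. $L$ (resp. $M$) is the set of $i$ (resp. $j$) such that some column has exactly one $1$, located in row $i$ of $\tau_1$ (resp. row $j$ of $\tau_2$). $L'=\{1,\dots,p\}\setminus(I\cup L)$, $M'=\{1,\dots,q\}\setminus(J\cup M)$. $\mathcal{P}(n)$ is the set of partitions of $n$, viewed as Young diagrams; $|\lambda|$ is the size of $\lambda$. A skew diagram is a column strip if it contains at most one box in each row. Young tableaux here have distinct integer entries, increasing along rows and columns. For a bijection $w:S\to R$ between finite sets of integers, $S=\{s_1<\dots<s_n\}$, $(\mathrm{RS}_1(w),\mathrm{RS}_2(w))$ is the Robinson--Schensted pair: $\mathrm{RS}_1(w)$ (entries $R$) is the row-insertion tableau of the word $w(s_1)\cdots w(s_n)$, $\mathrm{RS}_2(w)$ (entries $S$) the recording tableau. For Young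 tableaux $T,S$ with disjoint sets of entries, $T*S$ is the rectification by jeu de taquin of the skew tableau obtained by placing $S$ at the top right corner of $T$ (i.e. $S$ lies above and strictly to the right of $T$); this operation is associative. For a finite set $A$ of integers, $[A]$ is the vertical (one-column) Young tableau with set of entries $A$. *)

theory Defs
  imports
    "Jordan_Normal_Form.DL_Rank"
    "HOL-Combinatorics.Permutations"
begin

definition partial_perm_mats :: "nat \<Rightarrow> nat \<Rightarrow> 'a::field mat set" where
  "partial_perm_mats a r =
     {\<tau> \<in> carrier_mat a r.
        (\<forall>i<a. \<forall>k<r. \<tau> $$ (i,k) \<in> {0,1}) \<and>
        (\<forall>i<a. \<forall>k<r. \<forall>k'<r. \<tau> $$ (i,k) = 1 \<and> \<tau> $$ (i,k') = 1 \<longrightarrow> k = k') \<and>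
        (\<forall>k<r. \<forall>i<a. \<forall>i'<a. \<tau> $$ (i,k) = 1 \<and> \<tau> $$ (i',k) = 1 \<longrightarrow> i = i')}"

text \<open>\<open>vec_space.rank n A\<close> is the dimension of the span of the columns of \<open>A\<close> in the space of
  vectors of length \<open>n\<close>, so \<open>n\<close> is the number of rows.\<close>

definition frakT :: "nat \<Rightarrow> nat \<Rightarrow> nat \<Rightarrow> 'a::field mat set" where
  "frakT p q r =
     {\<tau>\<^sub>1 @\<^sub>r \<tau>\<^sub>2 | \<tau>\<^sub>1 \<tau>\<^sub>2.
        \<tau>\<^sub>1 \<in> partial_perm_mats p r \<and> \<tau>\<^sub>2 \<in> partial_perm_mats q r \<and>
        vec_space.rank (p + q) (\<tau>\<^sub>1 @\<^sub>r \<tau>\<^sub>2) = r}"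

definition col_perm_rel :: "nat \<Rightarrow> nat \<Rightarrow> nat \<Rightarrow> ('a::field mat \<times> 'a mat) set" where
  "col_perm_rel p q r =
     {(A, B) \<in> frakT p q r \<times> frakT p q r.
        \<exists>\<pi>. \<pi> permutes {..<r} \<and> B = mat (p + q) r (\<lambda>(i,k). A $$ (i, \<pi> k))}"

lemma frakT_carrier: "A \<in> frakT p q r \<Longrightarrow> A \<in> carrier_mat (p + q) r"
  by (auto simp: frakT_def partial_perm_mats_def intro: carrier_append_rows)

lemma equiv_col_perm_rel: "equiv (frakT p q r :: 'a::field mat set) (col_perm_rel p q r)"
  (is "equiv ?T ?R")
proof (rule equivI)
  show "?R \<subseteq> ?T \<times> ?T"
    by (auto simp: col_perm_rel_def)
  show "refl_on ?T ?R"
  proof (rule refl_onI)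
    fix A :: "'a mat" assume A: "A \<in> frakT p q r"
    have "A = mat (p + q) r (\<lambda>(i,k). A $$ (i, id k))"
      using frakT_carrier[OF A] by (intro eq_matI) auto
    then show "(A, A) \<in> col_perm_rel p q r"
      using A permutes_id[of "{..<r}"] unfolding col_perm_rel_def by blast
  qed
  show "sym ?R"
  proof (rule symI)
    fix A B :: "'a mat" assume "(A, B) \<in> col_perm_rel p q r"
    then obtain \<pi> where *: "A \<in> frakT p q r" "B \<in> frakT p q r" "\<pi> permutes {..<r}"
      and B: "B = mat (p + q) r (\<lambda>(i,k). A $$ (i, \<pi> k))"
      by (auto simp: col_perm_rel_def)
    have inv: "inv_into UNIV \<pi> permutes {..<r}" by (rule permutes_inv[OF *(3)])
    have "inv_into UNIV \<pi> k < r" if "k < r" for k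
      using permutes_in_image[OF inv, of k] that by simp
    then have "A = mat (p + q) r (\<lambda>(i,k). B $$ (i, inv_into UNIV \<pi> k))"
      using frakT_carrier[OF *(1)] unfolding B
      by (intro eq_matI) (auto simp: permutes_inverses[OF *(3)])
    then show "(B, A) \<in> col_perm_rel p q r"
      using * inv unfolding col_perm_rel_def by blast
  qed
  show "trans ?R"
  proof (rule transI)
    fix A B C :: "'a mat"
    assume "(A, B) \<in> col_perm_rel p q r" "(B, C) \<in> col_perm_rel p q r"
    then obtain \<pi> \<rho> where *: "A \<in> frakT p q r" "C \<in> frakT p q r"
      "\<pi> permutes {..<r}" "\<rho> permutes {..<r}"
      and B: "B = mat (p + q) r (\<lambda>(i,k). A $$ (i, \<pi> k))"
      and C: "C = mat (p + q) r (\<lambda>(i,k). B $$ (i, \<rho> k))"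
      by (auto simp: col_perm_rel_def)
    have "\<rho> k < r" if "k < r" for k
      using permutes_in_image[OF *(4), of k] that by simp
    then have "C = mat (p + q) r (\<lambda>(i,k). A $$ (i, (\<pi> \<circ> \<rho>) k))"
      unfolding C B by (intro eq_matI) auto
    then show "(A, C) \<in> col_perm_rel p q r"
      using * permutes_compose[OF *(4,3)] unfolding col_perm_rel_def by blast
  qed
qed


text \<open>Library matrices are indexed from \<open>0\<close>; row labels below start at \<open>1\<close>, so that row \<open>i\<close> of
  \<open>\<tau>\<^sub>1\<close> has label \<open>i\<close> and row \<open>j\<close> of \<open>\<tau>\<^sub>2\<close> has label \<open>p + j\<close>.\<close>

definition ones_in_col :: "'a::field mat \<Rightarrow> nat \<Rightarrow> nat set" where
  "ones_in_col \<omega> k = {i \<in> {1..dim_row \<omega>}. \<omega> $$ (i - 1, k) = 1}"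

definition linked :: "nat \<Rightarrow> nat \<Rightarrow> 'a::field mat \<Rightarrow> nat \<Rightarrow> nat \<Rightarrow> bool" where
  "linked p q \<omega> i j \<longleftrightarrow>
     i \<in> {1..p} \<and> j \<in> {1..q} \<and> (\<exists>k<dim_col \<omega>. ones_in_col \<omega> k = {i, p + j})"

definition data_I :: "nat \<Rightarrow> nat \<Rightarrow> 'a::field mat \<Rightarrow> nat set" where
  "data_I p q \<omega> = {i. \<exists>j. linked p q \<omega> i j}"

definition data_J :: "nat \<Rightarrow> nat \<Rightarrow> 'a::field mat \<Rightarrow> nat set" where
  "data_J p q \<omega> = {j. \<exists>i. linked p q \<omega> i j}"

definition data_sigma :: "nat \<Rightarrow> nat \<Rightarrow> 'a::field mat \<Rightarrow> nat \<Rightarrow> nat" where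
  "data_sigma p q \<omega> j = (THE i. linked p q \<omega> i j)"

definition data_L :: "nat \<Rightarrow> nat \<Rightarrow> 'a::field mat \<Rightarrow> nat set" where
  "data_L p q \<omega> = {i \<in> {1..p}. \<exists>k<dim_col \<omega>. ones_in_col \<omega> k = {i}}"

definition data_M :: "nat \<Rightarrow> nat \<Rightarrow> 'a::field mat \<Rightarrow> nat set" where
  "data_M p q \<omega> = {j \<in> {1..q}. \<exists>k<dim_col \<omega>. ones_in_col \<omega> k = {p + j}}"

definition data_L' :: "nat \<Rightarrow> nat \<Rightarrow> 'a::field mat \<Rightarrow> nat set" where
  "data_L' p q \<omega> = {1..p} - (data_I p q \<omega> \<union> data_L p q \<omega>)"

definition data_M' :: "nat \<Rightarrow> nat \<Rightarrow> 'a::field mat \<Rightarrow> nat set" where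
  "data_M' p q \<omega> = {1..q} - (data_J p q \<omega> \<union> data_M p q \<omega>)"


text \<open>A box \<open>(i,j)\<close> lies in row \<open>i\<close> (counted downwards) and column \<open>j\<close> (counted from left to
  right), both starting at \<open>0\<close>. A diagram is a set of boxes; a filling is a partial map from boxes
  to entries, whose shape is its domain.\<close>

type_synonym box = "nat \<times> nat"
type_synonym 'b filling = "box \<Rightarrow> 'b option"

definition is_partition :: "nat list \<Rightarrow> bool" where
  "is_partition xs \<longleftrightarrow> sorted_wrt (\<ge>) xs \<and> 0 \<notin> set xs"

definition diagram_of :: "nat list \<Rightarrow> box set" where
  "diagram_of xs = {(i,j). i < length xs \<and> j < xs ! i}"

definition young_diagram :: "box set \<Rightarrow> bool" where
  "young_diagram D \<longleftrightarrow> (\<exists>xs. is_partition xs \<and> D = diagram_of xs)"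

definition young_diagrams :: "nat \<Rightarrow> box set set" where
  "young_diagrams n = {diagram_of xs | xs. is_partition xs \<and> sum_list xs = n}"

definition column_strip :: "box set \<Rightarrow> bool" where
  "column_strip D \<longleftrightarrow> (\<forall>i j j'. (i,j) \<in> D \<and> (i,j') \<in> D \<longrightarrow> j = j')"

abbreviation shape :: "'b filling \<Rightarrow> box set" where
  "shape T \<equiv> dom T"

definition young_tableau :: "'b::linorder filling \<Rightarrow> bool" where
  "young_tableau T \<longleftrightarrow>
     young_diagram (shape T) \<and> inj_on T (shape T) \<and>
     (\<forall>i j j' x y. j < j' \<and> T (i,j) = Some x \<and> T (i,j') = Some y \<longrightarrow> x < y) \<and>
     (\<forall>i i' j x y. i < i' \<and> T (i,j) = Some x \<and> T (i',j) = Some y \<longrightarrow> x < y)"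

definition standard_tableau :: "nat filling \<Rightarrow> bool" where
  "standard_tableau T \<longleftrightarrow> young_tableau T \<and> ran T = {1..card (shape T)}"

definition column_tableau :: "'b::linorder set \<Rightarrow> 'b filling" where
  "column_tableau A =
     (\<lambda>(i,j). if j = 0 \<and> i < card A then Some (sorted_list_of_set A ! i) else None)"


text \<open>\<open>insert_row x R\<close> replaces the leftmost entry of \<open>R\<close> larger than \<open>x\<close> by \<open>x\<close> and returns the
  replaced entry, or appends \<open>x\<close> if there is none.\<close>

fun insert_row :: "'b::linorder \<Rightarrow> 'b list \<Rightarrow> 'b option \<times> 'b list" where
  "insert_row x [] = (None, [x])"
| "insert_row x (y # ys) =
     (if x < y then (Some y, x # ys)
      else (let (b, zs) = insert_row x ys in (b, y # zs)))"

fun row_insert :: "'b::linorder \<Rightarrow> 'b list list \<Rightarrow> 'b list list" where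
  "row_insert x [] = [[x]]"
| "row_insert x (R # Rs) =
     (case insert_row x R of
        (None, R') \<Rightarrow> R' # Rs
      | (Some y, R') \<Rightarrow> R' # row_insert y Rs)"

definition filling_of_rows :: "'b list list \<Rightarrow> 'b filling" where
  "filling_of_rows P =
     (\<lambda>(i,j). if i < length P \<and> j < length (P ! i) then Some (P ! i ! j) else None)"

definition RS_step ::
  "('a \<Rightarrow> 'b::linorder) \<Rightarrow> 'a \<Rightarrow> 'b list list \<times> 'a filling \<Rightarrow> 'b list list \<times> 'a filling" where
  "RS_step w s = (\<lambda>(P, Q).
     let P' = row_insert (w s) P;
         new_box = the_elem (shape (filling_of_rows P') - shape (filling_of_rows P))
     in (P', Q(new_box \<mapsto> s)))"

text \<open>In \<open>RS\<^sub>1 S w\<close> and \<open>RS\<^sub>2 S w\<close>, the set \<open>S\<close> is the source of the bijection \<open>w\<close>.\<close>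

definition RS ::
  "'a::linorder set \<Rightarrow> ('a \<Rightarrow> 'b::linorder) \<Rightarrow> 'b list list \<times> 'a filling" where
  "RS S w = fold (RS_step w) (sorted_list_of_set S) ([], Map.empty)"

definition RS\<^sub>1 :: "'a::linorder set \<Rightarrow> ('a \<Rightarrow> 'b::linorder) \<Rightarrow> 'b filling" where
  "RS\<^sub>1 S w = filling_of_rows (fst (RS S w))"

definition RS\<^sub>2 :: "'a::linorder set \<Rightarrow> ('a \<Rightarrow> 'b::linorder) \<Rightarrow> 'a filling" where
  "RS\<^sub>2 S w = snd (RS S w)"


text \<open>\<open>slide h T U\<close>: starting from the hole \<open>h\<close>, the smaller of the entries to the right of and
  below the hole moves into it, until there is neither; the result is \<open>U\<close>.\<close>

inductive slide :: "box \<Rightarrow> 'b::linorder filling \<Rightarrow> 'b filling \<Rightarrow> bool" where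
  stop: "T (i, Suc j) = None \<Longrightarrow> T (Suc i, j) = None \<Longrightarrow> slide (i,j) T T"
| right: "T (i, Suc j) = Some x \<Longrightarrow> (\<forall>y. T (Suc i, j) = Some y \<longrightarrow> x < y) \<Longrightarrow>
     slide (i, Suc j) (T((i,j) \<mapsto> x, (i, Suc j) := None)) U \<Longrightarrow> slide (i,j) T U"
| down: "T (Suc i, j) = Some y \<Longrightarrow> (\<forall>x. T (i, Suc j) = Some x \<longrightarrow> y < x) \<Longrightarrow>
     slide (Suc i, j) (T((i,j) \<mapsto> y, (Suc i, j) := None)) U \<Longrightarrow> slide (i,j) T U"

text \<open>\<open>rectifies \<mu> T U\<close>: \<open>T\<close> is a skew tableau with inner diagram \<open>\<mu>\<close>, and \<open>U\<close> is obtained from it by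
  successive slides into inner corners, in some order, until the inner diagram is empty. The inner
  diagram is recorded because the set of boxes of a skew diagram does not determine it.\<close>

inductive rectifies :: "box set \<Rightarrow> 'b::linorder filling \<Rightarrow> 'b filling \<Rightarrow> bool" where
  base: "rectifies {} T T"
| step: "(i,j) \<in> \<mu> \<Longrightarrow> (i, Suc j) \<notin> \<mu> \<Longrightarrow> (Suc i, j) \<notin> \<mu> \<Longrightarrow>
     slide (i,j) T T' \<Longrightarrow> rectifies (\<mu> - {(i,j)}) T' U \<Longrightarrow> rectifies \<mu> T U"

text \<open>The rectification is the common result of all orders of slides.\<close>

definition rectification :: "box set \<Rightarrow> 'b::linorder filling \<Rightarrow> 'b filling" where
  "rectification \<mu> T = (THE U. rectifies \<mu> T U)"

definition num_rows :: "'b filling \<Rightarrow> nat" where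
  "num_rows T = card (fst ` shape T)"

definition num_cols :: "'b filling \<Rightarrow> nat" where
  "num_cols T = card (snd ` shape T)"

text \<open>\<open>place T S\<close> puts \<open>T\<close> below, and \<open>S\<close> to the right of, an empty rectangle with as many rows as
  \<open>S\<close> and as many columns as \<open>T\<close>.\<close>

definition place :: "'b filling \<Rightarrow> 'b filling \<Rightarrow> 'b filling" where
  "place T S = (\<lambda>(i,j).
     if i < num_rows S
     then (if j < num_cols T then None else S (i, j - num_cols T))
     else T (i - num_rows S, j))"

definition tableau_prod :: "'b::linorder filling \<Rightarrow> 'b filling \<Rightarrow> 'b filling"
  (infixl \<open>\<star>\<close> 70) where
  "T \<star> S = rectification ({..<num_rows S} \<times> {..<num_cols T}) (place T S)"


type_synonym gRS_tuple = "nat filling \<times> nat filling \<times> box set \<times> box set \<times> box set"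

definition gRS :: "nat \<Rightarrow> nat \<Rightarrow> 'a::field mat \<Rightarrow> gRS_tuple" where
  "gRS p q \<omega> =
     (let J = data_J p q \<omega>; \<sigma> = data_sigma p q \<omega>;
          L = data_L p q \<omega>; L' = data_L' p q \<omega>;
          M = data_M p q \<omega>; M' = data_M' p q \<omega>
      in (column_tableau L \<star> RS\<^sub>1 J \<sigma> \<star> column_tableau L',
          column_tableau M \<star> RS\<^sub>2 J \<sigma> \<star> column_tableau M',
          shape (column_tableau L \<star> RS\<^sub>1 J \<sigma>),
          shape (column_tableau M \<star> RS\<^sub>2 J \<sigma>),
          shape (RS\<^sub>1 J \<sigma>)))"

text \<open>The induced map on classes; \<open>the_elem\<close> is unspecified unless \<open>gRS\<close> is constant on the class.\<close>

definition gRS_quot :: "nat \<Rightarrow> nat \<Rightarrow> 'a::field mat set \<Rightarrow> gRS_tuple" where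
  "gRS_quot p q X = the_elem (gRS p q ` X)"

definition calT_part :: "nat \<Rightarrow> box set \<Rightarrow> box set \<Rightarrow> gRS_tuple set" where
  "calT_part r lam mu =
     {(T\<^sub>1, T\<^sub>2, lam', mu', nu).
        standard_tableau T\<^sub>1 \<and> shape T\<^sub>1 = lam \<and>
        standard_tableau T\<^sub>2 \<and> shape T\<^sub>2 = mu \<and>
        young_diagram lam' \<and> young_diagram mu' \<and> young_diagram nu \<and>
        nu \<subseteq> lam' \<and> lam' \<subseteq> lam \<and> nu \<subseteq> mu' \<and> mu' \<subseteq> mu \<and>
        column_strip (lam - lam') \<and> column_strip (lam' - nu) \<and>
        column_strip (mu - mu') \<and> column_strip (mu' - nu) \<and>
        card lam' + card mu' = card nu + r}"

text \<open>The union is disjoint, since \<open>lam\<close> and \<open>mu\<close> are the shapes of the first two components.\<close>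

definition calT :: "nat \<Rightarrow> nat \<Rightarrow> nat \<Rightarrow> gRS_tuple set" where
  "calT p q r = (\<Union>lam\<in>young_diagrams p. \<Union>mu\<in>young_diagrams q. calT_part r lam mu)"

end

theory Submission
  imports Defs
begin

text \<open>A slide does not change the Knuth class of the reading word, and row insertion recovers a tableau
  from any word of its class; hence \<open>T \<star> S\<close> is the insertion tableau of the word of \<open>T\<close> followed by
  the word of \<open>S\<close>. Right multiplication by a column \<open>[A]\<close> is therefore the row insertion of \<open>A\<close> in
  decreasing order. By the row bumping lemma the new boxes go down strictly, so that they form a column
  strip, and reverse bumping along a given column strip from bottom to top recovers \<open>A\<close>. Left
  multiplication is reduced to the insertion of an increasing word by transposition, since reversing a
  word transposes its insertion tableau. Peeling off \<open>[L']\<close> and \<open>[L]\<close> (and \<open>[M']\<close>, \<open>[M]\<close>) this way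
  leaves a pair of tableaux of the same shape \<open>\<nu>\<close>, to which the Robinson--Schensted bijection applies.
  On the matrix side, rank \<open>r\<close> means that no column vanishes, because distinct columns have disjoint
  supports; a class of matrices is thus the same as a set of column supports.\<close>

text \<open>Rectification is a definite description over all orders of slides, so two things are
  owed: some sequence of slides reaches an end, and any two sequences end alike. The second holds
  because insertion recovers a tableau from every word of its Knuth class, so a class contains the
  reading word of only one tableau. Slides act on partial maps and insertion acts on lists of rows;
  the reading word, taken inside a fixed rectangle and skipping empty boxes, links the two.

  A tableau may be a product with a column in several ways. What makes the factorisation unique is
  the shape of the other factor, and \<open>lam'\<close>, \<open>mu'\<close>, \<open>nu\<close> in
  the 5-tuple are exactly these shapes. A strip with at most one box in each row can be filled from
  top to bottom in one order only, so a shape fixes the whole sequence of new boxes. The two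
  tableaux of the tuple are treated separately and meet only in \<open>nu\<close>. The equation on
  sizes counts the columns of the matrix, since \<open>lam'\<close>, \<open>mu'\<close>,
  \<open>nu\<close> have |J| + |L|, |J| + |M| and |J| boxes.\<close>

section \<open>Insertion of letters and words into a single row\<close>

definition row_ins :: "'b::linorder \<Rightarrow> 'b list \<Rightarrow> 'b list" where
  "row_ins x R = snd (insert_row x R)"

text \<open>The bumped entry is kept as a word of length at most one, so that the results of
  successive insertions concatenate to a word again.\<close>

definition row_bump :: "'b::linorder \<Rightarrow> 'b list \<Rightarrow> 'b list" where
  "row_bump x R = (case fst (insert_row x R) of None \<Rightarrow> [] | Some y \<Rightarrow> [y])"

lemma row_ins_simps [simp]:
  "row_ins x [] = [x]"
  "row_ins x (r # R) = (if x < r then x # R else r # row_ins x R)"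
  by (auto simp: row_ins_def split: prod.split)

lemma row_bump_simps [simp]:
  "row_bump x [] = []"
  "row_bump x (r # R) = (if x < r then [r] else row_bump x R)"
  by (auto simp: row_bump_def split: prod.split)

lemma row_ins_not_Nil [simp]: "row_ins x R \<noteq> []"
  by (cases R) auto

fun word_ins :: "'b::linorder list \<Rightarrow> 'b list \<Rightarrow> 'b list" where
  "word_ins [] R = R"
| "word_ins (x # u) R = word_ins u (row_ins x R)"

fun word_bump :: "'b::linorder list \<Rightarrow> 'b list \<Rightarrow> 'b list" where
  "word_bump [] R = []"
| "word_bump (x # u) R = row_bump x R @ word_bump u (row_ins x R)"

abbreviation insert_word :: "'b::linorder list \<Rightarrow> 'b list list \<Rightarrow> 'b list list" where
  "insert_word u X \<equiv> fold row_insert u X"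

abbreviation P_rows :: "'b::linorder list \<Rightarrow> 'b list list" where
  "P_rows u \<equiv> insert_word u []"

lemma word_ins_append: "word_ins (u @ v) R = word_ins v (word_ins u R)"
  by (induction u arbitrary: R) auto

lemma word_bump_append: "word_bump (u @ v) R = word_bump u R @ word_bump v (word_ins u R)"
  by (induction u arbitrary: R) auto

lemma row_insert_Cons: "row_insert x (R # Rs) = row_ins x R # insert_word (row_bump x R) Rs"
  by (auto simp: row_ins_def row_bump_def split: prod.split option.split)

text \<open>The whole word may pass through the first row before anything happens below, since the
  lower rows see only the bumped letters, in the order in which they leave.\<close>

lemma insert_word_Cons: "insert_word u (R # Rs) = word_ins u R # insert_word (word_bump u R) Rs"
  by (induction u arbitrary: R Rs) (auto simp: row_insert_Cons simp del: row_insert.simps(2))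

text \<open>A first letter makes the same row out of no row and out of an empty one; the empty row
  lets \<open>insert_word_Cons\<close> apply to the empty tableau.\<close>

lemma insert_word_Nil: "u \<noteq> [] \<Longrightarrow> P_rows u = insert_word u [[]]"
  by (cases u) auto

lemma mset_row_ins: "mset (row_bump x R @ row_ins x R) = add_mset x (mset R)"
  by (induction R) auto

lemma set_row_ins: "set (row_ins x R) \<subseteq> insert x (set R)"
  by (induction R) auto

lemma sorted_row_ins: "sorted R \<Longrightarrow> sorted (row_ins x R)"
  by (induction R) (use set_row_ins in fastforce)+

lemma row_bump_cases:
  obtains "row_bump x R = []" | y where "row_bump x R = [y]" "y \<in> set R" "x < y"
proof -
  have "row_bump x R = [] \<or> (\<exists>y\<in>set R. row_bump x R = [y] \<and> x < y)"
    by (induction R) auto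
  then show thesis using that by blast
qed

lemma row_bump_NilD: "row_bump x R = [] \<Longrightarrow> row_ins x R = R @ [x] \<and> (\<forall>r\<in>set R. r \<le> x)"
  by (induction R) (auto split: if_splits)

lemma row_ins_snoc: "\<forall>r\<in>set R. r \<le> x \<Longrightarrow> row_ins x R = R @ [x] \<and> row_bump x R = []"
  by (induction R) auto

lemma length_row_ins: "length (row_ins x R) = (if row_bump x R = [] then Suc (length R) else length R)"
  by (induction R) auto

lemma mset_row_insert: "mset (concat (row_insert x X)) = add_mset x (mset (concat X))"
proof (induction X arbitrary: x)
  case (Cons R X)
  show ?case
  proof (cases rule: row_bump_cases[of x R])
    case 1
    then show ?thesis using mset_row_ins[of x R] by (simp add: row_insert_Cons del: row_insert.simps(2))
  next
    case (2 y)
    then show ?thesis using mset_row_ins[of x R] Cons[of y]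
      by (simp add: row_insert_Cons add_mset_commute del: row_insert.simps(2))
  qed
qed auto

lemma mset_insert_word: "mset (concat (insert_word u X)) = mset u + mset (concat X)"
  by (induction u arbitrary: X) (auto simp: mset_row_insert)

lemma row_insert_sorted: "\<forall>R\<in>set X. sorted R \<Longrightarrow> \<forall>R\<in>set (row_insert x X). sorted R"
proof (induction X arbitrary: x)
  case (Cons R X)
  show ?case
    by (cases rule: row_bump_cases[of x R])
      (use Cons in \<open>auto simp: row_insert_Cons sorted_row_ins simp del: row_insert.simps(2)\<close>)
qed auto

lemma insert_word_sorted: "\<forall>R\<in>set X. sorted R \<Longrightarrow> \<forall>R\<in>set (insert_word u X). sorted R"
  by (induction u arbitrary: X) (auto dest: row_insert_sorted)

declare row_insert.simps(2) [simp del]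

subsection \<open>Knuth equivalence\<close>

inductive knuth_move :: "'b::linorder list \<Rightarrow> 'b list \<Rightarrow> bool" where
  "x \<le> y \<Longrightarrow> y < z \<Longrightarrow> knuth_move [x,z,y] [z,x,y]"
| "x < y \<Longrightarrow> y \<le> z \<Longrightarrow> knuth_move [y,x,z] [y,z,x]"

inductive knuth :: "'b::linorder list \<Rightarrow> 'b list \<Rightarrow> bool" where
  knuth_refl: "knuth u u"
| knuth_step: "knuth_move u v \<Longrightarrow> knuth (s @ u @ t) (s @ v @ t)"
| knuth_sym: "knuth u v \<Longrightarrow> knuth v u"
| knuth_trans: "knuth u v \<Longrightarrow> knuth v w \<Longrightarrow> knuth u w"

lemma knuth_context: "knuth u v \<Longrightarrow> knuth (s @ u @ t) (s @ v @ t)"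
proof (induction rule: knuth.induct)
  case (knuth_step u v s' t')
  then show ?case using knuth.knuth_step[of u v "s @ s'" "t' @ t"] by simp
qed (auto intro: knuth.intros)

lemma knuth_Cons: "knuth u v \<Longrightarrow> knuth (x # u) (x # v)"
  using knuth_context[of u v "[x]" "[]"] by simp

lemma knuth_append1: "knuth u v \<Longrightarrow> knuth (s @ u) (s @ v)"
  using knuth_context[of u v s "[]"] by simp

lemma knuth_append2: "knuth u v \<Longrightarrow> knuth (u @ t) (v @ t)"
  using knuth_context[of u v "[]" t] by simp

lemma knuth_mset: "knuth u v \<Longrightarrow> mset u = mset v"
  by (induction rule: knuth.induct) (auto elim!: knuth_move.cases)

text \<open>Reversal exchanges the two Knuth relations. Their weak inequalities sit at different
  places, which is harmless only for distinct letters.\<close>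

lemma knuth_rev: "knuth u v \<Longrightarrow> distinct u \<Longrightarrow> knuth (rev u) (rev v)"
proof (induction rule: knuth.induct)
  case (knuth_step u v s t)
  have "knuth_move (rev v) (rev u) \<or> knuth_move (rev u) (rev v)"
    using knuth_step by (auto elim!: knuth_move.cases intro!: knuth_move.intros simp: less_imp_le)
  then have "knuth (rev t @ rev u @ rev s) (rev t @ rev v @ rev s)"
    by (auto intro: knuth.intros)
  then show ?case by simp
next
  case (knuth_sym u v)
  then have "distinct u" by (metis knuth_mset mset_eq_imp_distinct_iff)
  then show ?case using knuth_sym.IH by (blast intro: knuth.knuth_sym)
next
  case (knuth_trans u v w)
  then have "distinct v" by (metis knuth_mset mset_eq_imp_distinct_iff)
  then show ?case using knuth_trans.IH knuth_trans.prems by (blast intro: knuth.knuth_trans)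
qed (auto intro: knuth.intros)

lemma row_bump_None_iff: "row_bump x R = [] \<longleftrightarrow> (\<forall>r\<in>set R. r \<le> x)"
  using row_bump_NilD row_ins_snoc by blast

text \<open>Knuth-related words have equal effect on a sorted row and bump out words that are again
  equal or Knuth-related, so invariance of the insertion tableau follows row by row.\<close>

lemma knuth_move_row:
  assumes "knuth_move u v" "sorted R"
  shows "word_ins u R = word_ins v R \<and> (word_bump u R = word_bump v R \<or>
     knuth_move (word_bump u R) (word_bump v R) \<or> knuth_move (word_bump v R) (word_bump u R))"
  (is "?P u v R")
  using assms
proof cases
  case (1 x y z)
  have "?P [x,z,y] [z,x,y] R"
    using 1(3,4) assms(2)
  proof (induction R)
    case (Cons r R)
    consider "r \<le> x" | "x < r" "z < r" | "x < r" "r \<le> z" by force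
    then show ?case
    proof cases
      case 1
      then have "\<not> x < r" "\<not> y < r" "\<not> z < r" using Cons.prems by auto
      then show ?thesis using Cons.IH Cons.prems by simp
    next
      case 2
      then show ?thesis using Cons.prems
        by (cases R) (auto intro!: knuth_move.intros)
    next
      case 3
      \<comment> \<open>Here \<open>x\<close> bumps \<open>r\<close>, while \<open>z\<close> and
        then \<open>y\<close> act on \<open>R\<close>. The bumped words differ by swapping
        \<open>r\<close> with what \<open>z\<close> bumps; the letter \<open>b\<close> bumped by
        \<open>y\<close> follows both and makes this a Knuth move, as
        \<open>r \<le> b \<le> z\<close>.\<close>
      have yr: "row_bump y (row_ins z R) \<noteq> []"
        using Cons.prems by (induction R) auto
      then obtain b where b: "row_bump y (row_ins z R) = [b]" "b \<in> set (row_ins z R)" "b \<le> z"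
      proof -
        have "row_bump y (row_ins z R) \<noteq> [] \<and> (\<forall>b\<in>set (row_bump y (row_ins z R)). b \<le> z)"
          using Cons.prems by (induction R) auto
        then show thesis using that by (cases rule: row_bump_cases[of y "row_ins z R"]) auto
      qed
      have rb: "r \<le> b" using b(2) set_row_ins[of z R] 3 Cons.prems by auto
      show ?thesis
        using 3 Cons.prems b rb
        by (cases rule: row_bump_cases[of z R]) (auto intro!: knuth_move.intros)
    qed
  qed (auto)
  then show ?thesis using 1 by simp
next
  case (2 x y z)
  have "?P [y,x,z] [y,z,x] R"
    using 2(3,4) assms(2)
  proof (induction R)
    case (Cons r R)
    consider "r \<le> x" | "x < r" "r \<le> y" | "x < r" "y < r" by force
    then show ?case
    proof cases
      case 1
      then have "\<not> x < r" "\<not> y < r" "\<not> z < r" using Cons.prems by auto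
      then show ?thesis using Cons.IH Cons.prems by simp
    next
      case 2
      \<comment> \<open>Here \<open>x\<close> bumps \<open>r\<close>, while \<open>y\<close> and
        \<open>z\<close> act on \<open>R\<close>. The bumped words differ by swapping
        \<open>r\<close> with the letter \<open>c\<close> bumped by \<open>z\<close>; the letter
        \<open>d\<close> bumped earlier by \<open>y\<close> makes this a Knuth move, as
        \<open>r < d \<le> c\<close>.\<close>
      consider (a) "row_bump z (row_ins y R) = []" | (b) c d where "row_bump z (row_ins y R) = [c]" "row_bump y R = [d]" "d \<le> c" "r < d"
      proof -
        have "(row_bump z (row_ins y R) = []) \<or> (\<exists>c d. row_bump z (row_ins y R) = [c] \<and> row_bump y R = [d] \<and> d \<le> c \<and> r < d)"
          using Cons.prems 2
        proof (induction R)
          case (Cons s R)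
          then show ?case
            by (cases rule: row_bump_cases[of z R]) (auto)
        qed auto
        then show thesis using that by blast
      qed
      then show ?thesis
        using 2 Cons.prems
        by cases (auto intro!: knuth_move.intros)
    next
      case 3
      then show ?thesis
        using Cons.prems
        by (cases rule: row_bump_cases[of z R]) (auto intro!: knuth_move.intros)
    qed
  qed (auto)
  then show ?thesis using 2 by simp
qed

lemma knuth_move_insert_word:
  assumes "knuth_move u v" "\<forall>R\<in>set X. sorted R"
  shows "insert_word u X = insert_word v X"
  using assms
proof (induction X arbitrary: u v)
  case Nil
  then have "u \<noteq> []" "v \<noteq> []" by (auto elim: knuth_move.cases)
  moreover have "insert_word u [[]] = insert_word v [[]]"
    using Nil by cases (auto simp: insert_word_Cons row_insert_Cons)
  ultimately show ?case by (simp add: insert_word_Nil)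
next
  case (Cons R X)
  then show ?case
    using knuth_move_row[of u v R] by (auto simp: insert_word_Cons)
qed

lemma knuth_insert_word:
  assumes "knuth u v" "\<forall>R\<in>set X. sorted R"
  shows "insert_word u X = insert_word v X"
  using assms
proof (induction arbitrary: X)
  case (knuth_step u v s t)
  then show ?case
    using knuth_move_insert_word[of u v "insert_word s X"] by (simp add: insert_word_sorted)
qed simp_all

corollary knuth_P_rows: "knuth u v \<Longrightarrow> P_rows u = P_rows v"
  by (simp add: knuth_insert_word)

section \<open>Row insertion stays within the Knuth class\<close>

text \<open>The small letter \<open>x\<close> moves left past one letter at a time by the second
  Knuth relation, whose extra letter is the one just before the letter passed. This is why
  \<open>y\<close> has to stand in front.\<close>

lemma knuth_small_left:
  assumes "sorted R" "\<forall>r\<in>set R. y \<le> r" "x < y"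
  shows "knuth (y # R @ [x]) (y # x # R)"
  using assms
proof (induction R rule: rev_induct)
  case (snoc z R)
  define h s where "h = last (y # R)" and "s = butlast (y # R)"
  have hs: "y # R = s @ [h]" by (simp add: h_def s_def)
  have "h \<in> set (y # R)" unfolding hs by simp
  then have "x < h" "h \<le> z" using snoc.prems by (auto simp: sorted_append)
  then have "knuth (s @ [h,z,x] @ []) (s @ [h,x,z] @ [])"
    by (intro knuth_sym[OF knuth_step] knuth_move.intros)
  then have "knuth (y # R @ [z,x]) (y # R @ [x] @ [z])"
    using hs by (metis append.assoc append_Cons append_Nil append_Nil2)
  moreover have "knuth (y # R @ [x] @ [z]) (y # x # R @ [z])"
    using knuth_append2[OF snoc.IH, of "[z]"] snoc.prems by (simp add: sorted_append)
  ultimately show ?case by (simp add: knuth_trans)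
qed (auto intro: knuth_refl)

lemma knuth_row_insert1: "sorted R \<Longrightarrow> knuth (R @ [x]) (row_bump x R @ row_ins x R)"
proof (induction R)
  case (Cons r R)
  show ?case
  proof (cases "x < r")
    case True
    then show ?thesis using knuth_small_left[of R r x] Cons by simp
  next
    case False
    have IH: "knuth (r # R @ [x]) (r # row_bump x R @ row_ins x R)"
      using Cons by (auto intro: knuth_Cons)
    \<comment> \<open>The bumped letter \<open>y\<close> still has to cross \<open>r\<close>. The
      first letter \<open>h\<close> of the new tail allows it by the first Knuth relation, since
      \<open>r \<le> h \<le> x < y\<close>.\<close>
    have "knuth (r # row_bump x R @ row_ins x R) (row_bump x R @ r # row_ins x R)"
    proof (cases rule: row_bump_cases[of x R])
      case (2 y)
      obtain h H where H: "row_ins x R = h # H"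
        by (metis list.exhaust row_ins_not_Nil)
      have "h \<le> x" "r \<le> h"
        using H False Cons.prems by (cases R; auto split: if_splits)+
      then have "knuth ([] @ [r,y,h] @ H) ([] @ [y,r,h] @ H)"
        using 2 by (intro knuth_step knuth_move.intros) auto
      then show ?thesis using 2 H by simp
    qed (auto intro: knuth_refl)
    then show ?thesis using IH False by (auto intro: knuth_trans)
  qed
qed (auto intro: knuth_refl)

lemma knuth_row: "sorted R \<Longrightarrow> knuth (R @ u) (word_bump u R @ word_ins u R)"
proof (induction u arbitrary: R)
  case (Cons x u)
  have "knuth ((R @ [x]) @ u) ((row_bump x R @ row_ins x R) @ u)"
    using Cons.prems by (intro knuth_append2 knuth_row_insert1)
  moreover have "knuth (row_bump x R @ row_ins x R @ u)
      (row_bump x R @ word_bump u (row_ins x R) @ word_ins u (row_ins x R))"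
    using Cons sorted_row_ins by (intro knuth_append1) auto
  ultimately show ?case by (auto intro: knuth_trans)
qed (auto intro: knuth_refl)

abbreviation rows_word :: "'b list list \<Rightarrow> 'b list" where
  "rows_word X \<equiv> concat (rev X)"

lemma knuth_row_insert:
  "\<forall>R\<in>set X. sorted R \<Longrightarrow> knuth (rows_word X @ [x]) (rows_word (row_insert x X))"
proof (induction X arbitrary: x)
  case (Cons R X)
  have "knuth (rows_word X @ R @ [x]) (rows_word X @ row_bump x R @ row_ins x R)"
    using Cons.prems by (intro knuth_append1 knuth_row_insert1) auto
  moreover have "knuth ((rows_word X @ row_bump x R) @ row_ins x R)
      (rows_word (insert_word (row_bump x R) X) @ row_ins x R)"
    by (intro knuth_append2, cases rule: row_bump_cases[of x R])
      (use Cons in \<open>auto intro: knuth_refl\<close>)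
  ultimately show ?case by (auto simp: row_insert_Cons intro: knuth_trans)
qed (auto intro: knuth_refl)

lemma knuth_insert_rows_word:
  "\<forall>R\<in>set X. sorted R \<Longrightarrow> knuth (rows_word X @ u) (rows_word (insert_word u X))"
proof (induction u arbitrary: X)
  case (Cons x u)
  have "knuth ((rows_word X @ [x]) @ u) (rows_word (row_insert x X) @ u)"
    using Cons.prems by (intro knuth_append2 knuth_row_insert)
  moreover have "knuth (rows_word (row_insert x X) @ u) (rows_word (insert_word u (row_insert x X)))"
    using Cons row_insert_sorted by blast
  ultimately show ?case by (auto intro: knuth_trans)
qed (auto intro: knuth_refl)

corollary knuth_rows_word_P_rows: "knuth u (rows_word (P_rows u))"
  using knuth_insert_rows_word[of "[]" u] by simp

subsection \<open>Semistandard tableaux as lists of rows\<close>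

fun row_above :: "'b::linorder list \<Rightarrow> 'b list \<Rightarrow> bool" where
  "row_above R [] \<longleftrightarrow> True"
| "row_above [] (s # S) \<longleftrightarrow> False"
| "row_above (r # R) (s # S) \<longleftrightarrow> r < s \<and> row_above R S"

text \<open>Only the last row is required to be non-empty, as \<open>row_above\<close> passes this
  on to the rows above it. Rows may repeat entries, in keeping with the weak inequalities of the
  Knuth relations; distinctness is a separate hypothesis where needed.\<close>

fun tab_rows :: "'b::linorder list list \<Rightarrow> bool" where
  "tab_rows [] \<longleftrightarrow> True"
| "tab_rows [R] \<longleftrightarrow> R \<noteq> [] \<and> sorted R"
| "tab_rows (R # S # X) \<longleftrightarrow> sorted R \<and> row_above R S \<and> tab_rows (S # X)"

lemma row_above_iff:
  "row_above R S \<longleftrightarrow> length S \<le> length R \<and> (\<forall>j<length S. R ! j < S ! j)"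
  by (induction R S rule: row_above.induct) (auto simp: less_Suc_eq_0_disj)

lemma row_above_Nil [simp]: "row_above [] S \<longleftrightarrow> S = []"
  by (cases S) auto

lemma tab_rows_ConsD: "tab_rows (R # X) \<Longrightarrow> R \<noteq> [] \<and> sorted R \<and> tab_rows X"
  by (induction "R # X" arbitrary: R X rule: tab_rows.induct) auto

lemma tab_rows_sorted: "tab_rows X \<Longrightarrow> \<forall>R\<in>set X. sorted R"
  by (induction X) (auto dest: tab_rows_ConsD)

lemma tab_rows_not_Nil: "tab_rows X \<Longrightarrow> [] \<notin> set X"
  by (induction X) (auto dest: tab_rows_ConsD)

lemma tab_rows_Cons: "tab_rows (R # X) \<longleftrightarrow> R \<noteq> [] \<and> sorted R \<and> tab_rows X \<and> (X \<noteq> [] \<longrightarrow> row_above R (hd X))"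
  by (cases X) (auto dest: tab_rows_ConsD)

section \<open>Putting a row on top of a tableau by insertion\<close>

lemma row_replace1:
  assumes "\<forall>w\<in>set W. w \<le> c" "c < x"
  shows "row_ins c (W @ x # Z) = W @ c # Z" "row_bump c (W @ x # Z) = [x]"
  using assms by (induction W) auto

text \<open>Each letter of \<open>C\<close> passes everything written so far, by sortedness, and
  stops at its own letter of \<open>X\<close>, which is larger.\<close>

lemma word_replace:
  assumes "list_all2 (<) C X" "sorted (W @ C)"
  shows "word_ins C (W @ X @ Z) = W @ C @ Z \<and> word_bump C (W @ X @ Z) = X"
  using assms
proof (induction arbitrary: W rule: list_all2_induct)
  case (Cons c C x X)
  have "sorted ((W @ [c]) @ C)" "\<forall>w\<in>set W. w \<le> c" using Cons.prems by (auto simp: sorted_append)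
  then show ?case
    using Cons.IH[of "W @ [c]"] Cons.hyps(1) row_replace1[of W c x "X @ Z"] by simp
qed simp

lemma word_append:
  "sorted (R @ D) \<Longrightarrow> word_ins D R = R @ D \<and> word_bump D R = []"
proof (induction D arbitrary: R)
  case (Cons d D)
  then show ?case using row_ins_snoc[of R d] Cons.IH[of "R @ [d]"] by (auto simp: sorted_append)
qed simp

text \<open>The part of \<open>R\<close> above \<open>S\<close> displaces \<open>S\<close> letter by
  letter, and the overhanging part of \<open>R\<close> is then appended.\<close>

lemma word_replace_row:
  assumes "row_above R S" "sorted R"
  shows "word_ins R S = R \<and> word_bump R S = S"
proof -
  define C D where "C = take (length S) R" and "D = drop (length S) R"
  have R: "R = C @ D" by (simp add: C_def D_def)
  have "list_all2 (<) C S"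
    using assms(1) by (auto simp: list_all2_conv_all_nth row_above_iff C_def)
  then have "word_ins C S = C \<and> word_bump C S = S"
    using word_replace[of C S "[]" "[]"] assms(2) by (simp add: R sorted_append)
  then show ?thesis
    using word_append[of C D] assms(2) by (simp add: R word_ins_append word_bump_append)
qed

text \<open>The new top row pushes the old one out as a word, which in turn pushes out the next row,
  down to the bottom.\<close>

lemma insert_word_top_row: "tab_rows (R # X) \<Longrightarrow> insert_word R X = R # X"
proof (induction X arbitrary: R)
  case Nil
  then show ?case using word_append[of "[]" R] by (simp add: insert_word_Nil insert_word_Cons)
next
  case (Cons S X)
  then show ?case
    using word_replace_row[of R S] by (simp add: insert_word_Cons)
qed

lemma P_rows_rows_word: "tab_rows X \<Longrightarrow> P_rows (rows_word X) = X"
proof (induction X)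
  case (Cons R X)
  then show ?case using tab_rows_ConsD[of R X] by (simp add: insert_word_top_row)
qed simp

subsection \<open>Row insertion and new boxes\<close>

text \<open>The end of the bumping route, computed along the route. \<open>shape_row_insert\<close>
  identifies it with the box that \<open>RS_step\<close> finds as a difference of shapes.\<close>

fun newbox :: "'b::linorder \<Rightarrow> 'b list list \<Rightarrow> box" where
  "newbox x [] = (0,0)"
| "newbox x (R # X) = (case row_bump x R of [] \<Rightarrow> (0, length R)
     | y # _ \<Rightarrow> (Suc (fst (newbox y X)), snd (newbox y X)))"

lemma shape_rows: "shape (filling_of_rows X) = {(i,j). i < length X \<and> j < length (X ! i)}"
  by (auto simp: filling_of_rows_def split: if_splits)

lemma shape_rows_Cons:
  "shape (filling_of_rows (R # X)) = {0} \<times> {..<length R} \<union> map_prod Suc id ` shape (filling_of_rows X)"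
  (is "?A = ?B")
proof -
  have "c \<in> ?A \<longleftrightarrow> c \<in> ?B" for c
    by (cases c; cases "fst c") (auto simp: shape_rows image_iff)
  then show ?thesis by blast
qed

lemma shape_row_insert:
  "newbox x X \<notin> shape (filling_of_rows X) \<and>
   shape (filling_of_rows (row_insert x X)) = insert (newbox x X) (shape (filling_of_rows X))"
proof (induction X arbitrary: x)
  case Nil
  then show ?case by (auto simp: shape_rows)
next
  case (Cons R X)
  show ?case
  proof (cases rule: row_bump_cases[of x R])
    case 1
    then show ?thesis
      by (auto simp: row_insert_Cons shape_rows_Cons length_row_ins)
  next
    case (2 y)
    then show ?thesis
      using Cons[of y]
      by (auto simp: row_insert_Cons shape_rows_Cons length_row_ins image_iff prod_eq_iff)
  qed
qed

lemma row_bump_less: "row_bump x R = [y] \<Longrightarrow> x < y"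
  by (cases rule: row_bump_cases[of x R]) auto

text \<open>Bumping only lowers entries of \<open>R\<close>. The bumped \<open>y\<close> was smaller
  than the entry below it, if there was one, so it lands in \<open>S\<close> no further right than
  the column it left, under a smaller entry.\<close>

lemma row_above_bump:
  assumes "row_above R S" "row_bump x R = [y]" "sorted R"
  shows "row_above (row_ins x R) S" "row_above (row_ins x R) (row_ins y S)"
proof -
  show "row_above (row_ins x R) S"
    using assms by (induction R S rule: row_above.induct) (auto split: if_splits)
  show "row_above (row_ins x R) (row_ins y S)"
    using assms
  proof (induction R S rule: row_above.induct)
    case (1 R)
    then show ?case by (cases R) (auto split: if_splits dest: row_bump_less)
  next
    case (3 r R s S)
    have "row_above (row_ins x R) S" if "row_above R S" "row_bump x R = [y]" for R S
      using that by (induction R S rule: row_above.induct) (auto split: if_splits)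
    then show ?case using 3 by (auto split: if_splits dest: row_bump_less)
  qed auto
qed

lemma row_above_snoc: "row_above R S \<Longrightarrow> row_above (R @ D) S"
  by (auto simp: row_above_iff nth_append)

lemma tab_row_insert: "tab_rows X \<Longrightarrow> tab_rows (row_insert x X)"
proof (induction X arbitrary: x)
  case (Cons R X)
  have *: "R \<noteq> []" "sorted R" "tab_rows X" "X \<noteq> [] \<longrightarrow> row_above R (hd X)" "sorted (row_ins x R)"
    using Cons.prems by (auto simp: tab_rows_Cons sorted_row_ins)
  show ?case
  proof (cases rule: row_bump_cases[of x R])
    case 1
    then show ?thesis
      using * row_bump_NilD[OF 1] by (auto simp: row_insert_Cons tab_rows_Cons row_above_snoc)
  next
    case (2 y)
    have "tab_rows (row_insert y X)" using Cons * by blast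
    moreover have "row_insert y X \<noteq> []" "hd (row_insert y X) = (if X = [] then [y] else row_ins y (hd X))"
      by (cases X; simp add: row_insert_Cons)+
    moreover have "row_above (row_ins x R) [y]"
      using row_above_bump(2)[of R "[]" x y] 2 * by simp
    ultimately show ?thesis
      using * 2 row_above_bump(2)[of R "hd X" x y] by (auto simp: row_insert_Cons tab_rows_Cons)
  qed
qed auto

lemma tab_insert_word: "tab_rows X \<Longrightarrow> tab_rows (insert_word u X)"
  by (induction u arbitrary: X) (auto simp: tab_row_insert)

section \<open>Reverse bumping\<close>

lemma row_ins_in_set: "x \<in> set (row_ins x R)"
  by (induction R) auto

text \<open>One step of reverse bumping: what a row has become, together with what it has bumped,
  determines the row and the inserted letter.\<close>

lemma row_ins_inj:
  assumes "row_ins x R = row_ins x' R'" "row_bump x R = row_bump x' R'" "sorted R" "sorted R'"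
  shows "x = x' \<and> R = R'"
  using assms
proof (induction R arbitrary: R')
  case Nil
  then show ?case by (metis length_row_ins list.size(3) nat.inject row_bump_NilD length_0_conv row_bump_simps(1) row_ins_simps(1) append_Nil list.inject)
next
  case (Cons r R)
  have R': "length R' = Suc (length R)"
    using Cons.prems(1,2) by (metis length_row_ins length_Cons nat.inject)
  then obtain s S where S: "R' = s # S" by (cases R') auto
  \<comment> \<open>Excludes that one insertion stops at the first letter while the other goes on:
    the letter \<open>y\<close> bumped by the latter exceeds \<open>z\<close>, yet would be at most
    every letter of the new tail, \<open>z\<close> included.\<close>
  have no: "False" if "row_bump z Z = [y]" "sorted (y # row_ins z Z)" for y z and Z :: "'a list"
    using that row_ins_in_set[of z Z] by (cases rule: row_bump_cases[of z Z]) auto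
  show ?case
    using Cons.prems S Cons.IH[of S] no[of x' S r] no[of x R s] by (auto split: if_splits)
qed


text \<open>Equal row lengths before the insertion force both routes to end in the same row; from
  there the rows are undone upwards by \<open>row_ins_inj\<close>.\<close>

lemma row_insert_inj:
  assumes "row_insert x X = row_insert x' X'" "map length X = map length X'"
    and "\<forall>R\<in>set X. sorted R" "\<forall>R\<in>set X'. sorted R"
  shows "x = x' \<and> X = X'"
  using assms
proof (induction X arbitrary: x x' X')
  case (Cons R X)
  then obtain R' X0 where X': "X' = R' # X0" by (cases X') auto
  note prems = Cons.prems[unfolded X' row_insert_Cons, simplified]
  have len: "length R = length R'" using prems by simp
  then have bump: "row_bump x R = [] \<longleftrightarrow> row_bump x' R' = []"
    using prems(1) length_row_ins[of x R] length_row_ins[of x' R'] by (auto split: if_splits)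
  have "row_bump x R = row_bump x' R' \<and> X = X0"
    using bump prems Cons.IH[of _ _ X0]
    by (cases rule: row_bump_cases[of x R]; cases rule: row_bump_cases[of x' R']) auto
  then show ?case using row_ins_inj[of x R x' R'] prems X' by simp
qed auto

text \<open>Reverse bumping writes \<open>y\<close> over the last letter of \<open>R'\<close>
  smaller than \<open>y\<close>. If all of \<open>S\<close> exceeds \<open>y\<close>, the rows stay
  compatible wherever this happens.\<close>

lemma unbump_head:
  assumes "sorted R'" "R' \<noteq> []" "hd R' < y" "\<forall>s\<in>set S. y < s" "row_above R' S"
  shows "\<exists>x R. row_bump x R = [y] \<and> row_ins x R = R' \<and> sorted R \<and> row_above R S"
  using assms
proof (induction R' arbitrary: S)
  case (Cons r R')
  show ?case
  proof (cases "R' \<noteq> [] \<and> hd R' < y")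
    case True
    have "row_above R' (tl S)" using Cons.prems by (cases S) auto
    then obtain x R where *: "row_bump x R = [y]" "row_ins x R = R'" "sorted R" "row_above R (tl S)"
      using Cons.IH[of "tl S"] Cons.prems True by (cases S) auto
    have m: "add_mset y (mset R') = add_mset x (mset R)" using mset_row_ins[of x R] * by simp
    have "x \<in> set R'" using row_ins_in_set[of x R] * by simp
    moreover have "set R \<subseteq> insert y (set R')" using arg_cong[OF m, of set_mset] by auto
    ultimately show ?thesis
      using * Cons.prems by (intro exI[of _ x] exI[of _ "r # R"], cases S) auto
  next
    case False
    have "\<forall>r\<in>set R'. y \<le> r" using False Cons.prems(1) by (cases R') auto
    then show ?thesis
      using Cons.prems by (intro exI[of _ r] exI[of _ "y # R'"], cases S) auto
  qed
qed simp

text \<open>The letter of \<open>R'\<close> above \<open>y\<close> in \<open>row_ins y S\<close> is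
  smaller than \<open>y\<close>, so the last such letter stands in that column or further right,
  where \<open>S\<close> has only letters larger than \<open>y\<close>. The induction skips the
  earlier columns and ends in \<open>unbump_head\<close>.\<close>

lemma unbump:
  assumes "sorted R'" "sorted S" "row_above R' (row_ins y S)"
  shows "\<exists>x R. row_bump x R = [y] \<and> row_ins x R = R' \<and> sorted R \<and> row_above R S"
  using assms
proof (induction S arbitrary: R')
  case Nil
  then show ?case using unbump_head[of R' y "[]"] by (cases R') auto
next
  case (Cons s S)
  then obtain r R0 where R': "R' = r # R0" by (cases R') (auto split: if_splits)
  show ?case
  proof (cases "y < s")
    case True
    then show ?thesis using Cons.prems R' row_above_iff
      by (intro unbump_head) (auto simp: less_Suc_eq_0_disj)
  next
    case False
    then obtain x R where *: "row_bump x R = [y]" "row_ins x R = R0" "sorted R" "row_above R S"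
      using Cons.IH[of R0] Cons.prems R' by auto
    have m: "add_mset y (mset R0) = add_mset x (mset R)" using mset_row_ins[of x R] * by simp
    have "x \<in> set R0" using row_ins_in_set[of x R] * by simp
    moreover have "set R \<subseteq> insert y (set R0)" using arg_cong[OF m, of set_mset] by auto
    ultimately show ?thesis
      using * Cons.prems R' False by (intro exI[of _ x] exI[of _ "r # R"]) auto
  qed
qed

lemma row_insert_exists:
  assumes "tab_rows X'" "i < length X'" "Suc j = length (X' ! i)"
    and "Suc i < length X' \<Longrightarrow> length (X' ! Suc i) \<le> j"
  shows "\<exists>x X. tab_rows X \<and> row_insert x X = X' \<and> newbox x X = (i, j)"
  using assms
proof (induction X' arbitrary: i)
  case (Cons R' X')
  note tab = Cons.prems(1)[unfolded tab_rows_Cons]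
  show ?case
  proof (cases i)
    case 0
    define R x where "R = butlast R'" and "x = last R'"
    have R': "R' = R @ [x]" using tab by (simp add: R_def x_def)
    have lt: "\<forall>r\<in>set R. r \<le> x" and srt: "sorted R" using tab by (auto simp: R' sorted_append)
    have j: "j = length R" using Cons.prems(3) 0 by (simp add: R')
    show ?thesis
    proof (cases "R = []")
      case True
      have "X' = []"
      proof (rule ccontr)
        assume "X' \<noteq> []"
        then have "hd X' = []" using Cons.prems(4) 0 j True by (cases X') auto
        moreover have "hd X' \<noteq> []" using \<open>X' \<noteq> []\<close> tab_rows_not_Nil[of X'] tab
          by (metis list.set_sel(1))
        ultimately show False by simp
      qed
      then show ?thesis using True R' j 0 by (intro exI[of _ x] exI[of _ "[]"]) auto
    next
      case False
      have "row_above R (hd X')" if "X' \<noteq> []"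
        using that tab Cons.prems(4) 0 j by (cases X') (auto simp: row_above_iff R' nth_append split: if_splits)
      then have "tab_rows (R # X')" using False srt tab by (simp add: tab_rows_Cons)
      then show ?thesis
        using row_ins_snoc[OF lt] R' j 0
        by (intro exI[of _ x] exI[of _ "R # X'"]) (auto simp: row_insert_Cons)
    qed
  next
    case (Suc k)
    obtain y X where y: "tab_rows X" "row_insert y X = X'" "newbox y X = (k, j)"
      using Cons.IH[of k] Cons.prems tab Suc by auto
    \<comment> \<open>If the row below was created by \<open>y\<close> itself, it was empty
      before.\<close>
    define S where "S = (if X = [] then [] else hd X)"
    have hd: "X' \<noteq> []" "hd X' = row_ins y S"
      using y(2) by (cases X; auto simp: S_def row_insert_Cons)+
    have "sorted S" using y(1) by (cases X) (auto simp: S_def dest: tab_rows_ConsD)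
    then obtain x R where x: "row_bump x R = [y]" "row_ins x R = R'" "sorted R" "row_above R S"
      using unbump[of R' S y] tab hd by auto
    have "R \<noteq> []" using x(1) by auto
    then have "tab_rows (R # X)" using x y by (auto simp: tab_rows_Cons S_def)
    then show ?thesis
      using x y Suc by (intro exI[of _ x] exI[of _ "R # X"]) (auto simp: row_insert_Cons)
  qed
qed simp

section \<open>The row bumping lemma\<close>

lemma tab_shape_col: "tab_rows (R # X) \<Longrightarrow> (i, j) \<in> shape (filling_of_rows X) \<Longrightarrow> j < length R"
proof (induction X arbitrary: R i)
  case (Cons S X)
  have "length S \<le> length R" "tab_rows (S # X)"
    using Cons.prems(1) by (auto simp: row_above_iff)
  moreover have "j < length S"
    using Cons.IH[of S "i - 1"] Cons.prems(2) calculation(2) by (cases i) (auto simp: shape_rows)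
  ultimately show ?case by simp
qed (simp add: shape_rows)

text \<open>Seen in the tableau after the insertion: lower rows are no longer than the first one,
  whose length a bump does not change.\<close>

lemma newbox_col_less:
  assumes "tab_rows (R # X)" "row_bump x R = [y]"
  shows "snd (newbox y X) < length R"
proof -
  have "tab_rows (row_ins x R # row_insert y X)"
    using tab_row_insert[OF assms(1), of x] assms(2) by (simp add: row_insert_Cons)
  then have "snd (newbox y X) < length (row_ins x R)"
    using tab_shape_col shape_row_insert[of y X] by (metis insertI1 prod.collapse)
  then show ?thesis using assms(2) by (simp add: length_row_ins)
qed

lemma row_bump_mono:
  "sorted R \<Longrightarrow> x \<le> x' \<Longrightarrow> row_bump x R = [y] \<Longrightarrow> row_bump x' (row_ins x R) = [y'] \<Longrightarrow> y \<le> y'"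
proof (induction R)
  case (Cons r R)
  then show ?case by (cases rule: row_bump_cases[of x' R]) (auto split: if_splits)
qed simp

text \<open>The letter \<open>x\<close> now stands in the row, so a smaller \<open>x'\<close> bumps
  a letter not larger than \<open>x\<close>.\<close>

lemma row_bump_anti:
  "sorted R \<Longrightarrow> x' < x \<Longrightarrow> \<exists>y'\<le>x. row_bump x' (row_ins x R) = [y']"
  by (induction R) auto

text \<open>Each comparison reproduces itself for the bumped letters in the next row:
  \<open>y \<le> y'\<close> by \<open>row_bump_mono\<close> in the first case, and
  \<open>y' \<le> x < y\<close> in the second. When only one route ends in the row,
  \<open>newbox_col_less\<close> compares its box with the box of the other.\<close>

lemma row_bumping:
  assumes "tab_rows X"
  shows "x \<le> x' \<Longrightarrow> snd (newbox x X) < snd (newbox x' (row_insert x X)) \<and>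
           fst (newbox x' (row_insert x X)) \<le> fst (newbox x X)" (is "_ \<Longrightarrow> ?A X x x'")
    and "x' < x \<Longrightarrow> fst (newbox x X) < fst (newbox x' (row_insert x X)) \<and>
           snd (newbox x' (row_insert x X)) \<le> snd (newbox x X)" (is "_ \<Longrightarrow> ?B X x x'")
proof -
  have "(x \<le> x' \<longrightarrow> ?A X x x') \<and> (x' < x \<longrightarrow> ?B X x x')"
    using assms
  proof (induction X arbitrary: x x')
    case (Cons R X)
    have tab: "sorted R" "tab_rows X" using tab_rows_ConsD[OF Cons.prems] by auto
    have tab': "tab_rows (row_ins x R # insert_word (row_bump x R) X)"
      using tab_row_insert[OF Cons.prems, of x] by (simp add: row_insert_Cons)
    show ?case
    proof (cases "x \<le> x'")
      case True
      show ?thesis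
      proof (cases rule: row_bump_cases[of x R])
        case 1
        then have "row_bump x' (row_ins x R) = []"
          using row_bump_NilD[OF 1] True by (auto simp: row_bump_None_iff)
        then show ?thesis using 1 True by (simp add: row_insert_Cons length_row_ins)
      next
        case (2 y)
        show ?thesis
        proof (cases rule: row_bump_cases[of x' "row_ins x R"])
          case 1
          then show ?thesis
            using 2 True newbox_col_less[OF Cons.prems 2(1)] by (simp add: row_insert_Cons length_row_ins)
        next
          case (2 y')
          then show ?thesis
            using \<open>row_bump x R = [y]\<close> True row_bump_mono[OF tab(1) True, of y y'] Cons.IH[OF tab(2), of y y']
            by (simp add: row_insert_Cons)
        qed
      qed
    next
      case False
      obtain y' where y': "y' \<le> x" "row_bump x' (row_ins x R) = [y']"
        using row_bump_anti[OF tab(1)] False by (meson not_le)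
      show ?thesis
      proof (cases rule: row_bump_cases[of x R])
        case 1
        then show ?thesis
          using False y' newbox_col_less[OF tab' y'(2)] by (simp add: row_insert_Cons length_row_ins)
      next
        case (2 y)
        then show ?thesis
          using False y' Cons.IH[OF tab(2), of y y'] by (simp add: row_insert_Cons)
      qed
    qed
  qed auto
  then show "x \<le> x' \<Longrightarrow> ?A X x x'" and "x' < x \<Longrightarrow> ?B X x x'" by auto
qed

subsection \<open>Young diagrams and Young tableaux\<close>

lemma down_closed_nat:
  fixes A :: "nat set"
  assumes "finite A" "\<And>a b. a \<in> A \<Longrightarrow> b \<le> a \<Longrightarrow> b \<in> A"
  shows "a \<in> A \<longleftrightarrow> a < card A"
proof
  assume "a \<in> A"
  then have "{..a} \<subseteq> A" using assms(2) by auto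
  then have "card {..a} \<le> card A" using assms(1) card_mono by blast
  then show "a < card A" by simp
next
  assume "a < card A"
  show "a \<in> A"
  proof (rule ccontr)
    assume "a \<notin> A"
    then have "A \<subseteq> {..<a}" using assms(2) by (meson lessThan_iff not_less subsetI)
    then have "card A \<le> card {..<a}" using card_mono by blast
    then show False using \<open>a < card A\<close> by simp
  qed
qed

lemma diagram_of_Sigma: "diagram_of xs = (SIGMA i:{..<length xs}. {..<xs ! i})"
  by (auto simp: diagram_of_def)

lemma finite_diagram_of: "finite (diagram_of xs)"
  by (simp add: diagram_of_Sigma)

lemma card_diagram_of: "card (diagram_of xs) = sum_list xs"
  by (simp add: diagram_of_Sigma sum_list_sum_nth atLeast0LessThan)

lemma diagram_of_row_lengths:
  assumes "is_partition xs"
  obtains l where "antimono l" "diagram_of xs = {(i, j). j < l i}"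
proof -
  define l where "l i = (if i < length xs then xs ! i else 0)" for i
  have "xs ! i \<le> xs ! i'" if "i' \<le> i" "i < length xs" for i i'
    using that assms by (cases "i' = i") (auto simp: is_partition_def sorted_wrt_iff_nth_less)
  then have "antimono l" by (auto simp: antimono_def l_def)
  moreover have "diagram_of xs = {(i, j). j < l i}"
    by (auto simp: diagram_of_def l_def split: if_splits)
  ultimately show thesis using that by blast
qed

lemma young_diagram_row_lengths:
  assumes "young_diagram D"
  obtains l where "antimono l" "D = {(i, j). j < l i}"
  using assms diagram_of_row_lengths unfolding young_diagram_def by metis

text \<open>Young diagrams as finite order ideals of boxes; in this form transposing and removing a
  corner are easy.\<close>

lemma young_diagram_iff:
  "young_diagram D \<longleftrightarrow> finite D \<and> (\<forall>i j i' j'. (i, j) \<in> D \<longrightarrow> i' \<le> i \<longrightarrow> j' \<le> j \<longrightarrow> (i', j') \<in> D)"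
  (is "_ \<longleftrightarrow> ?R")
proof
  assume D: "young_diagram D"
  then obtain l where l: "antimono l" "D = {(i, j). j < l i}" by (rule young_diagram_row_lengths)
  have "(i', j') \<in> D" if "(i, j) \<in> D" "i' \<le> i" "j' \<le> j" for i j i' j'
    using antimonoD[OF l(1) that(2)] that(1,3) l(2) by auto
  moreover have "finite D"
    using D finite_diagram_of by (auto simp: young_diagram_def)
  ultimately show ?R by simp
next
  assume R: ?R
  then have cl: "\<And>i j i' j'. (i, j) \<in> D \<Longrightarrow> i' \<le> i \<Longrightarrow> j' \<le> j \<Longrightarrow> (i', j') \<in> D" by simp
  define l where "l i = card {j. (i, j) \<in> D}" for i
  \<comment> \<open>The number of non-empty rows; cutting \<open>l\<close> off there keeps zeros out
    of the partition.\<close>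
  define n where "n = card {i. (i, 0) \<in> D}"
  have "{j. (i, j) \<in> D} \<subseteq> snd ` D" "{i. (i, j) \<in> D} \<subseteq> fst ` D" for i j
    by (auto simp: rev_image_eqI)
  then have fin: "finite {j. (i, j) \<in> D}" "finite {i. (i, j) \<in> D}" for i j
    using R by (meson finite_imageI finite_subset)+
  have "j \<in> {j. (i, j) \<in> D} \<longleftrightarrow> j < l i" for i j
    unfolding l_def by (rule down_closed_nat[OF fin(1)], drule CollectD, rule CollectI, erule cl) simp_all
  then have l: "(i, j) \<in> D \<longleftrightarrow> j < l i" for i j by simp
  have "i \<in> {i. (i, 0) \<in> D} \<longleftrightarrow> i < n" for i
    unfolding n_def by (rule down_closed_nat[OF fin(2)], drule CollectD, rule CollectI, erule cl) simp_all
  then have n: "(i, 0) \<in> D \<longleftrightarrow> i < n" for i by simp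
  define xs where "xs = map l [0..<n]"
  have "l i' \<le> l i" if "i \<le> i'" for i i'
    using cl[of i' "l i" i "l i"] that by (auto simp: l intro: leI)
  moreover have "l i \<noteq> 0" if "i < n" for i
    using that n[of i] l[of i 0] by simp
  ultimately have "is_partition xs"
    by (auto simp: is_partition_def xs_def sorted_wrt_iff_nth_less) (metis less_irrefl)
  moreover have "i < n" if "j < l i" for i j
    using cl[of i j i 0] that by (simp add: l flip: n)
  then have "D = diagram_of xs"
    using l by (auto simp: diagram_of_def xs_def)
  ultimately show "young_diagram D" by (auto simp: young_diagram_def)
qed

lemma young_diagramD: "young_diagram D \<Longrightarrow> (i, j) \<in> D \<Longrightarrow> i' \<le> i \<Longrightarrow> j' \<le> j \<Longrightarrow> (i', j') \<in> D"
  by (simp add: young_diagram_iff)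

lemma young_diagramI:
  "finite D \<Longrightarrow> (\<And>i j i' j'. (i, j) \<in> D \<Longrightarrow> i' \<le> i \<Longrightarrow> j' \<le> j \<Longrightarrow> (i', j') \<in> D) \<Longrightarrow> young_diagram D"
  by (simp add: young_diagram_iff)

lemma young_diagram_finite: "young_diagram D \<Longrightarrow> finite D"
  by (simp add: young_diagram_iff)

lemma young_diagrams_iff: "D \<in> young_diagrams n \<longleftrightarrow> young_diagram D \<and> card D = n"
  by (auto simp: young_diagrams_def young_diagram_def card_diagram_of)

section \<open>Tableaux as partial maps and as lists of rows\<close>

lemma filling_of_rows_Cons [simp]:
  "filling_of_rows (R # X) (0, j) = (if j < length R then Some (R ! j) else None)"
  "filling_of_rows (R # X) (Suc i, j) = filling_of_rows X (i, j)"
  by (auto simp: filling_of_rows_def)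

lemma filling_of_rows_Nil [simp]: "filling_of_rows [] = Map.empty"
  by (auto simp: filling_of_rows_def)

lemma filling_of_rows_eq_Some:
  "filling_of_rows X (i, j) = Some x \<longleftrightarrow> i < length X \<and> j < length (X ! i) \<and> X ! i ! j = x"
  by (auto simp: filling_of_rows_def)

lemma ran_rows: "ran (filling_of_rows X) = set (concat X)"
  by (fastforce simp: ran_def filling_of_rows_eq_Some in_set_conv_nth)

lemma young_diagram_rows: "tab_rows X \<Longrightarrow> young_diagram (shape (filling_of_rows X))"
proof (induction X)
  case Nil
  then show ?case by (simp add: young_diagram_iff)
next
  case (Cons R X)
  have IH: "young_diagram (shape (filling_of_rows X))"
    using Cons tab_rows_ConsD by blast
  have "finite (shape (filling_of_rows (R # X)))"
    using young_diagram_finite[OF IH] by (simp add: shape_rows_Cons)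
  moreover have "(i', j') \<in> shape (filling_of_rows (R # X))"
    if *: "(i, j) \<in> shape (filling_of_rows (R # X))" "i' \<le> i" "j' \<le> j" for i j i' j'
  proof -
    have mem: "(Suc a, b) \<in> shape (filling_of_rows (R # X)) \<longleftrightarrow> (a, b) \<in> shape (filling_of_rows X)"
      "(0, b) \<in> shape (filling_of_rows (R # X)) \<longleftrightarrow> b < length R" for a b
      by (auto simp: shape_rows)
    show ?thesis
    proof (cases i')
      case 0
      have "j < length R"
        using *(1) tab_shape_col[OF Cons.prems, of _ j] by (cases i) (simp_all only: mem)
      then show ?thesis using 0 mem * by simp
    next
      case (Suc k)
      then obtain m where "i = Suc m" "k \<le> m" using *(2) by (cases i) auto
      then show ?thesis using *(1,3) Suc young_diagramD[OF IH, of m j k j'] by (simp only: mem)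
    qed
  qed
  ultimately show ?case by (rule young_diagramI)
qed

lemma tab_rows_iff:
  "tab_rows X \<longleftrightarrow> [] \<notin> set X \<and> (\<forall>R\<in>set X. sorted R) \<and>
     (\<forall>i. Suc i < length X \<longrightarrow> row_above (X ! i) (X ! Suc i))"
proof (induction X)
  case (Cons R X)
  then show ?case
    by (cases X) (auto simp: tab_rows_Cons nth_Cons split: nat.splits)
qed simp

lemma tab_rows_col_less:
  assumes "tab_rows X" "i < i'" "i' < length X" "j < length (X ! i')"
  shows "j < length (X ! i) \<and> X ! i ! j < X ! i' ! j"
  using assms(2-)
proof (induction i')
  case (Suc k)
  have "row_above (X ! k) (X ! Suc k)" using assms(1) Suc.prems by (simp add: tab_rows_iff)
  then have *: "j < length (X ! k)" "X ! k ! j < X ! Suc k ! j" using Suc.prems by (auto simp: row_above_iff)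
  then show ?case using Suc by (cases "i = k") auto
qed simp

lemma inj_on_rows: "distinct (concat X) \<Longrightarrow> inj_on (filling_of_rows X) (shape (filling_of_rows X))"
proof (induction X)
  case (Cons R X)
  have disj: "filling_of_rows X (i, k) \<noteq> Some (R ! j)" if "j < length R" for i j k
  proof -
    have "R ! j \<notin> ran (filling_of_rows X)" using that Cons.prems nth_mem[of j R] by (auto simp: ran_rows disjoint_iff)
    then show ?thesis by (metis ranI)
  qed
  show ?case
  proof (rule inj_onI, clarify)
    fix a b a' b' x y
    assume *: "filling_of_rows (R # X) (a, b) = filling_of_rows (R # X) (a', b')"
      "filling_of_rows (R # X) (a, b) = Some x" "filling_of_rows (R # X) (a', b') = Some y"
    have inj: "i = i' \<and> j = j'" if "filling_of_rows X (i, j) = Some z" "filling_of_rows X (i', j') = Some z" for i j i' j' z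
      using Cons that by (auto dest!: inj_onD[where x = "(i,j)" and y = "(i',j')"])
    show "a = a' \<and> b = b'"
      using * disj[of b] disj[of b'] inj[of _ b y _ b'] Cons.prems
      by (cases a; cases a') (auto split: if_splits simp: nth_eq_iff_index_eq)
  qed
qed simp

lemma young_tableau_rows:
  assumes "tab_rows X" "distinct (concat X)"
  shows "young_tableau (filling_of_rows X)"
proof -
  have "sorted_wrt (<) (X ! i)" if "i < length X" for i
    using assms nth_mem[OF that] by (auto simp: distinct_concat_iff strict_sorted_iff tab_rows_sorted)
  then show ?thesis
    using assms tab_rows_col_less[OF assms(1)]
    unfolding young_tableau_def
    by (auto simp: young_diagram_rows inj_on_rows filling_of_rows_eq_Some sorted_wrt_iff_nth_less)
qed

text \<open>A filling does not show empty rows, so they are excluded on both sides.\<close>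

lemma map_length_eq_of_shape:
  assumes "shape (filling_of_rows X) = shape (filling_of_rows Y)" "[] \<notin> set X" "[] \<notin> set Y"
  shows "map length X = map length Y"
proof -
  have *: "i < length X \<and> j < length (X ! i) \<longleftrightarrow> i < length Y \<and> j < length (Y ! i)" for i j
    using assms(1) unfolding shape_rows set_eq_iff by auto
  have "i < length X \<longleftrightarrow> i < length Y" for i
    using *[of i 0] assms(2,3) nth_mem by (metis length_greater_0_conv)
  then have len: "length X = length Y" by (metis linorder_neqE_nat nat_less_le order_refl)
  have "length (X ! i) = length (Y ! i)" if "i < length X" for i
    using *[of i] that len by (metis linorder_neqE_nat nat_less_le order_refl)
  then show ?thesis using len by (simp add: list_eq_iff_nth_eq)
qed

lemma filling_of_rows_inj:
  assumes "filling_of_rows X = filling_of_rows Y" "tab_rows X" "tab_rows Y"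
  shows "X = Y"
proof -
  have *: "map length X = map length Y"
    using map_length_eq_of_shape assms by (metis tab_rows_not_Nil)
  then have len: "length X = length Y" using map_eq_imp_length_eq by blast
  have "X ! i = Y ! i" if "i < length X" for i
  proof (rule nth_equalityI)
    show l: "length (X ! i) = length (Y ! i)" using * that len by (metis nth_map)
    show "X ! i ! j = Y ! i ! j" if "j < length (X ! i)" for j
      using fun_cong[OF assms(1), of "(i, j)"] that \<open>i < length X\<close> len l by (simp add: filling_of_rows_def)
  qed
  then show ?thesis using len by (simp add: nth_equalityI)
qed

lemma distinct_concat_of_inj:
  "inj_on (filling_of_rows X) (shape (filling_of_rows X)) \<Longrightarrow> distinct (concat X)"
proof (induction X)
  case (Cons R X)
  have inj: "c = c'" if "filling_of_rows (R # X) c = Some x" "filling_of_rows (R # X) c' = Some x" for c c' x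
    using Cons.prems that by (metis domI inj_onD)
  have "inj_on (filling_of_rows X) (shape (filling_of_rows X))"
  proof (rule inj_onI, clarify)
    fix a b a' b' x y
    assume *: "filling_of_rows X (a, b) = filling_of_rows X (a', b')" "filling_of_rows X (a, b) = Some x"
    then show "a = a' \<and> b = b'" using inj[of "(Suc a, b)" x "(Suc a', b')"] by auto
  qed
  then have "distinct (concat X)" using Cons.IH by blast
  moreover have "distinct R"
    unfolding distinct_conv_nth using inj[of "(0, _)" _ "(0, _)"] by auto
  moreover have "set R \<inter> set (concat X) = {}"
  proof (rule ccontr)
    assume "set R \<inter> set (concat X) \<noteq> {}"
    then obtain x where x: "x \<in> set R" "x \<in> ran (filling_of_rows X)" by (auto simp: ran_rows)
    then obtain j i k where "j < length R" "R ! j = x" "filling_of_rows X (i, k) = Some x"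
      by (auto simp: in_set_conv_nth ran_def)
    then show False using inj[of "(0, j)" x "(Suc i, k)"] by auto
  qed
  ultimately show ?case by auto
qed simp

text \<open>The passage from tableaux as partial maps, in which the theorem is stated, to lists of
  rows, on which insertion acts.\<close>

lemma young_tableau_obtain_rows:
  assumes "young_tableau T"
  obtains X where "tab_rows X" "distinct (concat X)" "T = filling_of_rows X"
proof -
  obtain xs where xs: "is_partition xs" "shape T = diagram_of xs"
    using assms by (auto simp: young_tableau_def young_diagram_def)
  define X where "X = map (\<lambda>i. map (\<lambda>j. the (T (i, j))) [0..<xs ! i]) [0..<length xs]"
  have dom: "(\<exists>x. T (i, j) = Some x) \<longleftrightarrow> i < length xs \<and> j < xs ! i" for i j
    using xs(2) by (auto simp: diagram_of_def set_eq_iff dom_def)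
  have T: "T = filling_of_rows X"
  proof
    fix c :: box obtain i j where "c = (i, j)" by (cases c)
    then show "T c = filling_of_rows X c"
      using dom[of i j] by (cases "T c") (auto simp: X_def filling_of_rows_def)
  qed
  have len: "length X = length xs" "i < length X \<Longrightarrow> length (X ! i) = xs ! i" for i
    by (auto simp: X_def)
  have row: "sorted (X ! i)" if "i < length X" for i
    unfolding sorted_iff_nth_mono_less
    using assms that unfolding T young_tableau_def filling_of_rows_eq_Some by (simp add: less_imp_le)
  have "xs ! Suc i \<le> xs ! i" if "Suc i < length xs" for i
    using xs(1) that by (simp add: is_partition_def sorted_wrt_iff_nth_less)
  then have "row_above (X ! i) (X ! Suc i)" if "Suc i < length X" for i
    using assms that unfolding T young_tableau_def filling_of_rows_eq_Some row_above_iff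
    by (auto simp: len) (metis Suc_lessD dual_order.strict_trans1 len lessI)
  moreover have "[] \<notin> set X"
    using xs(1) by (auto simp: X_def is_partition_def) (metis nth_mem)
  moreover have "distinct (concat X)"
    using assms by (intro distinct_concat_of_inj) (simp add: T young_tableau_def)
  moreover have "\<forall>R\<in>set X. sorted R" using row by (auto simp: in_set_conv_nth)
  ultimately show thesis using that[of X] T by (simp add: tab_rows_iff)
qed

subsection \<open>Insertion of a word and the sequence of new boxes\<close>

fun newboxes :: "'b::linorder list \<Rightarrow> 'b list list \<Rightarrow> box list" where
  "newboxes [] X = []"
| "newboxes (x # u) X = newbox x X # newboxes u (row_insert x X)"

text \<open>A chain of Young diagrams from \<open>D\<close> to \<open>E\<close>, one box at a time.
  It grows at its end because insertions are undone starting with the last.\<close>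

inductive growth :: "box set \<Rightarrow> box list \<Rightarrow> box set \<Rightarrow> bool" where
  Nil: "young_diagram D \<Longrightarrow> growth D [] D"
| snoc: "growth D cs E \<Longrightarrow> c \<notin> E \<Longrightarrow> young_diagram (insert c E) \<Longrightarrow> growth D (cs @ [c]) (insert c E)"

lemma length_newboxes [simp]: "length (newboxes u X) = length u"
  by (induction u arbitrary: X) auto

lemma newboxes_snoc: "newboxes (u @ [x]) X = newboxes u X @ [newbox x (insert_word u X)]"
  by (induction u arbitrary: X) auto

lemma growth_newboxes:
  "tab_rows X \<Longrightarrow> growth (shape (filling_of_rows X)) (newboxes u X) (shape (filling_of_rows (insert_word u X)))"
proof (induction u rule: rev_induct)
  case (snoc x u)
  let ?Y = "insert_word u X"
  have "tab_rows (row_insert x ?Y)" using snoc.prems by (simp add: tab_row_insert tab_insert_word)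
  then have "young_diagram (insert (newbox x ?Y) (shape (filling_of_rows ?Y)))"
    using young_diagram_rows shape_row_insert[of x ?Y] by metis
  then show ?case
    using growth.snoc[OF snoc.IH[OF snoc.prems], of "newbox x ?Y"] shape_row_insert[of x ?Y]
    by (simp add: newboxes_snoc)
qed (simp add: growth.Nil young_diagram_rows)

lemma growth_props:
  "growth D cs E \<Longrightarrow> young_diagram D \<and> young_diagram E \<and> distinct cs \<and> D \<inter> set cs = {} \<and> E = D \<union> set cs"
  by (induction rule: growth.induct) auto

text \<open>Reverse insertion along a prescribed chain: the last box is a corner, because the
  diagram without it is again a Young diagram, so \<open>row_insert_exists\<close> undoes one
  insertion there.\<close>

lemma insert_word_exists:
  assumes "growth D cs E" "tab_rows Y" "shape (filling_of_rows Y) = E"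
  shows "\<exists>X u. tab_rows X \<and> shape (filling_of_rows X) = D \<and> insert_word u X = Y \<and> newboxes u X = cs"
  using assms
proof (induction arbitrary: Y rule: growth.induct)
  case (Nil D)
  then show ?case by (intro exI[of _ Y] exI[of _ "[]"]) auto
next
  case (snoc D cs E c)
  obtain i j where c: "c = (i, j)" by (cases c)
  have E: "young_diagram E" using snoc.hyps growth_props by blast
  have "(i, j) \<in> shape (filling_of_rows Y)" using snoc.prems c by auto
  then have ij: "i < length Y" "j < length (Y ! i)" by (auto simp: shape_rows)
  have "(i, Suc j) \<notin> shape (filling_of_rows Y)" "(Suc i, j) \<notin> shape (filling_of_rows Y)"
    using snoc.prems snoc.hyps c young_diagramD[OF E, of i "Suc j" i j] young_diagramD[OF E, of "Suc i" j i j]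
    by auto
  then have "Suc j = length (Y ! i)" "Suc i < length Y \<Longrightarrow> length (Y ! Suc i) \<le> j"
    using ij by (auto simp: shape_rows)
  then obtain x Z where Z: "tab_rows Z" "row_insert x Z = Y" "newbox x Z = c"
    using row_insert_exists[of Y i j] snoc.prems ij c by auto
  then have "shape (filling_of_rows Z) = E"
    using shape_row_insert[of x Z] snoc.prems(2) snoc.hyps(2) by (metis insert_ident)
  then obtain X u where "tab_rows X" "shape (filling_of_rows X) = D" "insert_word u X = Z" "newboxes u X = cs"
    using snoc.IH Z(1) by blast
  then show ?case using Z by (intro exI[of _ X] exI[of _ "u @ [x]"]) (auto simp: newboxes_snoc)
qed

lemma insert_word_unique:
  assumes "tab_rows X" "tab_rows Y" "insert_word u X = insert_word v Y" "newboxes u X = newboxes v Y"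
  shows "X = Y \<and> u = v"
proof -
  have "length u = length v" using assms(4) by (metis length_newboxes)
  then show ?thesis using assms(3,4)
  proof (induction u v rule: rev_induct2)
    case (4 x u y v)
    let ?X = "insert_word u X" and ?Y = "insert_word v Y"
    have eq: "row_insert x ?X = row_insert y ?Y" "newbox x ?X = newbox y ?Y" "newboxes u X = newboxes v Y"
      using 4 by (auto simp: newboxes_snoc)
    have tab: "tab_rows ?X" "tab_rows ?Y" using assms tab_insert_word by auto
    \<comment> \<open>The same box is taken away from the same shape, so the predecessors agree in
      shape, as \<open>row_insert_inj\<close> requires.\<close>
    have "shape (filling_of_rows ?X) = shape (filling_of_rows ?Y)"
      using eq shape_row_insert[of x ?X] shape_row_insert[of y ?Y] by (metis insert_ident)
    then have "x = y \<and> ?X = ?Y"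
      using row_insert_inj[OF eq(1)] map_length_eq_of_shape tab by (metis tab_rows_not_Nil tab_rows_sorted)
    then show ?case using 4 eq by auto
  qed auto
qed

subsection \<open>Jeu de taquin\<close>

definition increasing :: "'b::linorder filling \<Rightarrow> bool" where
  "increasing T \<longleftrightarrow>
     (\<forall>i j j' x y. j < j' \<and> T (i,j) = Some x \<and> T (i,j') = Some y \<longrightarrow> x < y) \<and>
     (\<forall>i i' j x y. i < i' \<and> T (i,j) = Some x \<and> T (i',j) = Some y \<longrightarrow> x < y)"

lemma increasing_row: "increasing T \<Longrightarrow> j < j' \<Longrightarrow> T (i,j) = Some x \<Longrightarrow> T (i,j') = Some y \<Longrightarrow> x < y"
  and increasing_col: "increasing T \<Longrightarrow> i < i' \<Longrightarrow> T (i,j) = Some x \<Longrightarrow> T (i',j) = Some y \<Longrightarrow> x < y"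
  unfolding increasing_def by blast+

lemma young_tableau_increasing:
  "young_tableau T \<longleftrightarrow> young_diagram (shape T) \<and> inj_on T (shape T) \<and> increasing T"
  by (simp add: young_tableau_def increasing_def)

definition skew_tab :: "box set \<Rightarrow> box set \<Rightarrow> 'b::linorder filling \<Rightarrow> bool" where
  "skew_tab lam mu T \<longleftrightarrow> young_diagram lam \<and> young_diagram mu \<and> mu \<subseteq> lam \<and>
     dom T = lam - mu \<and> inj_on T (dom T) \<and> increasing T"

text \<open>The state in the middle of a slide: the hole has already left the inner diagram and has
  not yet left the outer one.\<close>

definition holed_tab :: "box set \<Rightarrow> box set \<Rightarrow> box \<Rightarrow> 'b::linorder filling \<Rightarrow> bool" where
  "holed_tab lam mu h T \<longleftrightarrow> young_diagram lam \<and> young_diagram mu \<and> mu \<subseteq> lam \<and> h \<in> lam - mu \<and>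
     dom T = lam - mu - {h} \<and> inj_on T (dom T) \<and> increasing T"

lemma young_diagram_remove_corner:
  assumes "young_diagram D" "(i, Suc j) \<notin> D" "(Suc i, j) \<notin> D"
  shows "young_diagram (D - {(i, j)})"
proof (rule young_diagramI)
  show "finite (D - {(i, j)})" using assms young_diagram_finite by blast
  fix a b a' b' assume *: "(a, b) \<in> D - {(i, j)}" "a' \<le> a" "b' \<le> b"
  have "(a', b') \<in> D" using * young_diagramD[OF assms(1)] by blast
  moreover have "(a', b') \<noteq> (i, j)"
  proof
    assume "(a', b') = (i, j)"
    then have "Suc i \<le> a \<and> j \<le> b \<or> i \<le> a \<and> Suc j \<le> b" using * by auto
    then show False using * assms young_diagramD[OF assms(1), of a b] by blast
  qed
  ultimately show "(a', b') \<in> D - {(i, j)}" by simp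
qed

lemma move_into_hole:
  assumes T: "holed_tab lam mu h T" and c: "T c = Some x" and T': "T' = T(h \<mapsto> x, c := None)"
    and inc: "increasing T'"
  shows "holed_tab lam mu c T'"
proof -
  have *: "h \<in> lam - mu" "dom T = lam - mu - {h}" "inj_on T (dom T)"
    using T by (auto simp: holed_tab_def)
  have "c \<in> dom T" using c by auto
  then have "c \<in> lam - mu" "c \<noteq> h" unfolding *(2) by auto
  moreover have "dom T' = lam - mu - {c}"
    using * \<open>c \<noteq> h\<close> \<open>c \<in> lam - mu\<close> by (auto simp: T')
  moreover have "inj_on T' (dom T')"
  proof (rule inj_onI)
    fix a b assume ab: "a \<in> dom T'" "b \<in> dom T'" "T' a = T' b"
    \<comment> \<open>\<open>f\<close> sends a box to the one from which its present entry
      came.\<close>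
    define f where "f a = (if a = h then c else a)" for a
    have "T' a = T (f a)" if "a \<in> dom T'" for a
      using that c by (auto simp: T' f_def split: if_splits)
    moreover have "f a \<in> dom T" if "a \<in> dom T'" for a
      using that c \<open>c \<noteq> h\<close> by (auto simp: T' f_def split: if_splits)
    ultimately have "f a = f b" using ab * by (metis inj_onD)
    then show "a = b" using ab by (auto simp: f_def T' split: if_splits)
  qed
  ultimately show ?thesis using T inc by (auto simp: holed_tab_def)
qed

lemma holed_tab_right:
  assumes T: "holed_tab lam mu (i,j) T" and x: "T (i, Suc j) = Some x"
    and less: "\<forall>y. T (Suc i, j) = Some y \<longrightarrow> x < y"
  shows "holed_tab lam mu (i, Suc j) (T((i,j) \<mapsto> x, (i, Suc j) := None))"
proof (rule move_into_hole[OF T x refl])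
  let ?T = "T((i,j) \<mapsto> x, (i, Suc j) := None)"
  have inc: "increasing T" and dom: "dom T = lam - mu - {(i,j)}" and y: "young_diagram lam" "young_diagram mu"
    and h: "(i,j) \<in> lam - mu"
    using T by (auto simp: holed_tab_def)
  have D: "(\<exists>v. T c = Some v) \<longleftrightarrow> c \<in> lam \<and> c \<notin> mu \<and> c \<noteq> (i,j)" for c
  proof -
    have "(\<exists>v. T c = Some v) \<longleftrightarrow> c \<in> dom T" by auto
    then show ?thesis unfolding dom by auto
  qed
  have l: "v < x" if "k < j" "T (i,k) = Some v" for k v
    using increasing_row[OF inc _ that(2) x] that(1) by simp
  have r: "x < v" if "k > Suc j" "T (i,k) = Some v" for k v
    using increasing_row[OF inc that(1) x that(2)] by simp
  have r': "x < v" if "k > j" "k \<noteq> Suc j" "T (i,k) = Some v" for k v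
    using r[of k v] that by simp
  \<comment> \<open>An entry higher up in column \<open>j\<close> is compared with \<open>x\<close>
    through its right neighbour, which is filled because both diagrams are order ideals.\<close>
  have u: "v < x" if "k < i" "T (k,j) = Some v" for k v
  proof -
    have "(k, Suc j) \<in> lam" using x that D[of "(i, Suc j)"] young_diagramD[OF y(1), of i "Suc j" k "Suc j"] by auto
    moreover have "(k, Suc j) \<notin> mu" using that(2) D[of "(k,j)"] young_diagramD[OF y(2), of k "Suc j" k j] by auto
    ultimately obtain w where w: "T (k, Suc j) = Some w" using D[of "(k, Suc j)"] that by auto
    show ?thesis
      using increasing_row[OF inc _ that(2) w] increasing_col[OF inc that(1) w x] by simp
  qed
  \<comment> \<open>An entry further down in column \<open>j\<close> is compared with
    \<open>x\<close> through the entry just below the hole, which the slide rule makes larger than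
    \<open>x\<close>.\<close>
  have d: "x < v" if "i < k" "T (k,j) = Some v" for k v
  proof (cases "k = Suc i")
    case False
    have "(Suc i, j) \<in> lam" using that D[of "(k,j)"] young_diagramD[OF y(1), of k j "Suc i" j] by auto
    moreover have "(Suc i, j) \<notin> mu" using h young_diagramD[OF y(2), of "Suc i" j i j] by auto
    ultimately obtain w where w: "T (Suc i, j) = Some w" using D[of "(Suc i, j)"] by auto
    show ?thesis
      using less w increasing_col[OF inc _ w that(2)] that(1) False by fastforce
  qed (use that less in auto)
  show "increasing ?T"
    unfolding increasing_def
    using increasing_row[OF inc] increasing_col[OF inc] l r' u d
    by (auto simp: fun_upd_apply)
qed

text \<open>The argument of \<open>holed_tab_right\<close> with rows and columns exchanged.\<close>

lemma holed_tab_down: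
  assumes T: "holed_tab lam mu (i,j) T" and x: "T (Suc i, j) = Some x"
    and less: "\<forall>y. T (i, Suc j) = Some y \<longrightarrow> x < y"
  shows "holed_tab lam mu (Suc i, j) (T((i,j) \<mapsto> x, (Suc i, j) := None))"
proof (rule move_into_hole[OF T x refl])
  let ?T = "T((i,j) \<mapsto> x, (Suc i, j) := None)"
  have inc: "increasing T" and dom: "dom T = lam - mu - {(i,j)}" and y: "young_diagram lam" "young_diagram mu"
    and h: "(i,j) \<in> lam - mu"
    using T by (auto simp: holed_tab_def)
  have D: "(\<exists>v. T c = Some v) \<longleftrightarrow> c \<in> lam \<and> c \<notin> mu \<and> c \<noteq> (i,j)" for c
  proof -
    have "(\<exists>v. T c = Some v) \<longleftrightarrow> c \<in> dom T" by auto
    then show ?thesis unfolding dom by auto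
  qed
  have l: "v < x" if "k < i" "T (k,j) = Some v" for k v
    using increasing_col[OF inc _ that(2) x] that(1) by simp
  have r: "x < v" if "k > i" "k \<noteq> Suc i" "T (k,j) = Some v" for k v
    using increasing_col[OF inc _ x that(3)] that by simp
  have u: "v < x" if "k < j" "T (i,k) = Some v" for k v
  proof -
    have "(Suc i, k) \<in> lam" using x that D[of "(Suc i, j)"] young_diagramD[OF y(1), of "Suc i" j "Suc i" k] by auto
    moreover have "(Suc i, k) \<notin> mu" using that(2) D[of "(i,k)"] young_diagramD[OF y(2), of "Suc i" k i k] by auto
    ultimately obtain w where w: "T (Suc i, k) = Some w" using D[of "(Suc i, k)"] that by auto
    show ?thesis
      using increasing_col[OF inc _ that(2) w] increasing_row[OF inc that(1) w x] by simp
  qed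
  have d: "x < v" if "j < k" "T (i,k) = Some v" for k v
  proof (cases "k = Suc j")
    case False
    have "(i, Suc j) \<in> lam" using that D[of "(i,k)"] young_diagramD[OF y(1), of i k i "Suc j"] by auto
    moreover have "(i, Suc j) \<notin> mu" using h young_diagramD[OF y(2), of i "Suc j" i j] by auto
    ultimately obtain w where w: "T (i, Suc j) = Some w" using D[of "(i, Suc j)"] by auto
    show ?thesis
      using less w increasing_row[OF inc _ w that(2)] that(1) False by fastforce
  qed (use that less in auto)
  show "increasing ?T"
    unfolding increasing_def
    using increasing_row[OF inc] increasing_col[OF inc] l r u d
    by (auto simp: fun_upd_apply)
qed

text \<open>An empty neighbour to the right or below is not in \<open>mu\<close>, since otherwise
  the hole would be too; hence it is outside \<open>lam\<close>, and the hole is an outer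
  corner.\<close>

lemma holed_tab_stop:
  assumes T: "holed_tab lam mu (i,j) T" and "T (i, Suc j) = None" "T (Suc i, j) = None"
  shows "skew_tab (lam - {(i,j)}) mu T"
proof -
  have dom: "dom T = lam - mu - {(i,j)}" and y: "young_diagram lam" "young_diagram mu" and h: "(i,j) \<in> lam - mu"
    using T by (auto simp: holed_tab_def)
  have D: "T c = None \<longleftrightarrow> \<not> (c \<in> lam \<and> c \<notin> mu \<and> c \<noteq> (i,j))" for c
  proof -
    have "T c = None \<longleftrightarrow> c \<notin> dom T" by auto
    then show ?thesis unfolding dom by auto
  qed
  have "(i, Suc j) \<notin> mu" "(Suc i, j) \<notin> mu"
    using h young_diagramD[OF y(2), of i "Suc j" i j] young_diagramD[OF y(2), of "Suc i" j i j] by auto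
  then have "(i, Suc j) \<notin> lam" "(Suc i, j) \<notin> lam"
    using assms(2,3) by (auto simp: D)
  then show ?thesis
    using young_diagram_remove_corner[OF y(1)] T h by (auto simp: holed_tab_def skew_tab_def)
qed

lemma slide_exists: "holed_tab lam mu h T \<Longrightarrow> \<exists>U. slide h T U"
proof -
  assume T: "holed_tab lam mu h T"
  then have "finite lam" by (simp add: holed_tab_def young_diagram_finite)
  then have "finite ((\<lambda>(i,j). i + j) ` lam)" by simp
  \<comment> \<open>Each step of the slide raises \<open>i + j\<close> for the hole by one, and
    \<open>B\<close> bounds this sum on \<open>lam\<close>.\<close>
  then obtain B where "\<forall>s\<in>(\<lambda>(i,j). i + j) ` lam. s < B" by (meson finite_nat_set_iff_bounded)
  then have B: "(i, j) \<in> lam \<Longrightarrow> i + j < B" for i j by fastforce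
  show ?thesis using T
  proof (induction "B - (fst h + snd h)" arbitrary: h T rule: less_induct)
    case less
    obtain i j where h: "h = (i, j)" by (cases h)
    have "(i, j) \<in> lam" using less.prems h by (simp add: holed_tab_def)
    then have lt: "B - (i + Suc j) < B - (i + j)" "B - (Suc i + j) < B - (i + j)" using B by fastforce+
    have inj: "inj_on T (dom T)" using less.prems unfolding holed_tab_def by blast
    \<comment> \<open>Distinct entries exclude a tie between the two neighbours, so one of the three
      slide rules applies.\<close>
    consider "T (i, Suc j) = None" "T (Suc i, j) = None"
      | x where "T (i, Suc j) = Some x" "\<forall>y. T (Suc i, j) = Some y \<longrightarrow> x < y"
      | y where "T (Suc i, j) = Some y" "\<forall>x. T (i, Suc j) = Some x \<longrightarrow> y < x"
    proof -
      have "x \<noteq> y" if "T (i, Suc j) = Some x" "T (Suc i, j) = Some y" for x y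
        using inj_onD[OF inj, of "(i, Suc j)" "(Suc i, j)"] that by auto
      then show thesis using that
        by (cases "T (i, Suc j)"; cases "T (Suc i, j)") (simp, simp, simp, metis linorder_neqE option.inject)
    qed
    then show ?case
    proof cases
      case 1
      then show ?thesis using slide.stop h by blast
    next
      case (2 x)
      have "holed_tab lam mu (i, Suc j) (T((i,j) \<mapsto> x, (i, Suc j) := None))"
        using less.prems 2 unfolding h by (rule holed_tab_right)
      then obtain U where "slide (i, Suc j) (T((i,j) \<mapsto> x, (i, Suc j) := None)) U"
        using less.hyps[of "(i, Suc j)"] lt(1) h by auto
      then show ?thesis using slide.right[OF 2] h by blast
    next
      case (3 y)
      have "holed_tab lam mu (Suc i, j) (T((i,j) \<mapsto> y, (Suc i, j) := None))"
        using less.prems 3 unfolding h by (rule holed_tab_down)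
      then obtain U where "slide (Suc i, j) (T((i,j) \<mapsto> y, (Suc i, j) := None)) U"
        using less.hyps[of "(Suc i, j)"] lt(2) h by auto
      then show ?thesis using slide.down[OF 3] h by blast
    qed
  qed
qed

section \<open>Reading words under slides\<close>

definition row_seg :: "'b filling \<Rightarrow> nat \<Rightarrow> nat \<Rightarrow> nat \<Rightarrow> 'b list" where
  "row_seg T i a b = List.map_filter (\<lambda>j. T (i, j)) [a..<b]"

text \<open>Rows are read from bottom to top inside a rectangle, and empty boxes are skipped. Skew,
  holed and straight fillings thus share one definition throughout a rectification.\<close>

definition fill_word :: "nat \<Rightarrow> nat \<Rightarrow> 'b filling \<Rightarrow> 'b list" where
  "fill_word N M T = concat (map (\<lambda>i. row_seg T i 0 M) (rev [0..<N]))"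

lemma row_seg_append: "a \<le> b \<Longrightarrow> b \<le> c \<Longrightarrow> row_seg T i a c = row_seg T i a b @ row_seg T i b c"
  using upt_add_eq_append[of a b "c - b"] by (simp add: row_seg_def List.map_filter_def)

lemma row_seg_Suc: "row_seg T i a (Suc a) = (case T (i, a) of None \<Rightarrow> [] | Some x \<Rightarrow> [x])"
  by (simp add: row_seg_def split: option.split)

lemma row_seg_cong: "(\<And>j. a \<le> j \<Longrightarrow> j < b \<Longrightarrow> T (i, j) = T' (i, j)) \<Longrightarrow> row_seg T i a b = row_seg T' i a b"
  unfolding row_seg_def List.map_filter_def by (auto intro!: map_cong filter_cong)

lemma row_seg_None: "(\<And>j. a \<le> j \<Longrightarrow> j < b \<Longrightarrow> T (i, j) = None) \<Longrightarrow> row_seg T i a b = []"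
  unfolding row_seg_def List.map_filter_def by (auto simp: filter_empty_conv)

lemma row_seg_Some:
  "(\<And>j. a \<le> j \<Longrightarrow> j < b \<Longrightarrow> T (i, j) \<noteq> None) \<Longrightarrow> row_seg T i a b = map (\<lambda>j. the (T (i, j))) [a..<b]"
  unfolding row_seg_def List.map_filter_def by (auto intro!: filter_True)

lemma sorted_row_seg: "increasing T \<Longrightarrow> sorted (row_seg T i a b)"
proof (induction b)
  case (Suc b)
  show ?case
  proof (cases "a \<le> b")
    case True
    have "x < y" if "x \<in> set (row_seg T i a b)" "T (i, b) = Some y" for x y
      using that increasing_row[OF Suc.prems, of _ b] by (auto simp: row_seg_def List.map_filter_def)
    then show ?thesis
      using Suc True row_seg_append[of a b "Suc b" T i]
      by (fastforce simp: row_seg_Suc sorted_append split: option.splits)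
  qed (simp add: row_seg_def)
qed (simp add: row_seg_def)

lemma fill_word_split:
  assumes "i < N"
  shows "fill_word N M T = concat (map (\<lambda>a. row_seg T a 0 M) (rev [Suc i..<N])) @ row_seg T i 0 M @ fill_word i M T"
proof -
  have "[0..<N] = [0..<i] @ i # [Suc i..<N]"
    using assms upt_add_eq_append[of 0 i "N - i"] by (simp add: upt_conv_Cons)
  then show ?thesis by (simp add: fill_word_def)
qed

lemma fill_word_cong:
  "(\<And>i j. i < N \<Longrightarrow> j < M \<Longrightarrow> T (i,j) = T' (i,j)) \<Longrightarrow> fill_word N M T = fill_word N M T'"
  unfolding fill_word_def by (intro arg_cong[of _ _ concat] map_cong row_seg_cong) auto

text \<open>An entry only trades places with the empty box beside it, and empty boxes are not
  read.\<close>

lemma fill_word_slide_right: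
  assumes "T (i,j) = None" "T (i, Suc j) = Some x" "Suc j < M" "i < N"
  shows "fill_word N M (T((i,j) \<mapsto> x, (i, Suc j) := None)) = fill_word N M T"
proof -
  let ?T = "T((i,j) \<mapsto> x, (i, Suc j) := None)"
  have seg: "row_seg S i 0 M = row_seg S i 0 j @ row_seg S i j (Suc j) @ row_seg S i (Suc j) (Suc (Suc j)) @ row_seg S i (Suc (Suc j)) M" for S :: "'a filling"
    using assms(3) row_seg_append[of 0 j M S i] row_seg_append[of j "Suc j" M S i]
      row_seg_append[of "Suc j" "Suc (Suc j)" M S i] by simp
  have "row_seg ?T i 0 M = row_seg T i 0 M"
    unfolding seg using assms row_seg_cong[of 0 j ?T i T] row_seg_cong[of "Suc (Suc j)" M ?T i T]
    by (simp add: row_seg_Suc)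
  moreover have "map (\<lambda>a. row_seg ?T a 0 M) (rev [Suc i..<N]) = map (\<lambda>a. row_seg T a 0 M) (rev [Suc i..<N])"
    by (intro map_cong refl row_seg_cong) auto
  moreover have "fill_word i M ?T = fill_word i M T"
    by (intro fill_word_cong) auto
  ultimately show ?thesis unfolding fill_word_split[OF assms(4)] by (simp only:)
qed

text \<open>The two words are the rows before and after an entry \<open>y\<close> moves up from the row \<open>A @ y # B\<close> into
  the hole between \<open>C\<close> and \<open>D\<close>: inserting \<open>C @ D\<close> into the lower row bumps exactly \<open>A @ B\<close>.\<close>

lemma knuth_two_rows:
  assumes "list_all2 (<) C A" "list_all2 (<) D B" "sorted (A @ y # B)" "sorted (C @ y # D)"
  shows "knuth (A @ y # B @ C @ D) (A @ B @ C @ y # D)"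
proof -
  have "word_ins C ([] @ A @ (y # B)) = [] @ C @ (y # B) \<and> word_bump C ([] @ A @ (y # B)) = A"
    using assms by (intro word_replace) (auto simp: sorted_append)
  moreover have "word_ins D ((C @ [y]) @ B @ []) = (C @ [y]) @ D @ [] \<and> word_bump D ((C @ [y]) @ B @ []) = B"
    using assms by (intro word_replace) (auto simp: sorted_append)
  ultimately show ?thesis
    using knuth_row[OF assms(3), of "C @ D"] by (simp add: word_ins_append word_bump_append)
qed

text \<open>Between the columns \<open>m i\<close> and \<open>l (Suc i)\<close> both rows are full
  except for the hole, and \<open>knuth_two_rows\<close> applies to these parts. What the lower row
  has to the left (\<open>A0\<close>) and the upper row to the right (\<open>D0\<close>) stands at
  the two ends of the joint word, hence is mere context.\<close>

lemma knuth_slide_down: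
  assumes T: "holed_tab lam mu (i,j) T" and y: "T (Suc i, j) = Some y"
    and less: "\<forall>x. T (i, Suc j) = Some x \<longrightarrow> y < x"
    and bound: "lam \<subseteq> {..<N} \<times> {..<M}"
  shows "knuth (fill_word N M T) (fill_word N M (T((i,j) \<mapsto> y, (Suc i, j) := None)))"
proof -
  let ?T = "T((i,j) \<mapsto> y, (Suc i, j) := None)"
  have "holed_tab lam mu (Suc i, j) ?T" using T y less by (rule holed_tab_down)
  then have inc': "increasing ?T" by (simp add: holed_tab_def)
  have inc: "increasing T" and dom: "dom T = lam - mu - {(i,j)}" and h: "(i,j) \<in> lam - mu"
    and yd: "young_diagram lam" "young_diagram mu"
    using T by (auto simp: holed_tab_def)
  obtain l where l: "antimono l" "lam = {(i, j). j < l i}" using young_diagram_row_lengths[OF yd(1)] by blast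
  obtain m where m: "antimono m" "mu = {(i, j). j < m i}" using young_diagram_row_lengths[OF yd(2)] by blast
  have D: "T (a,b) \<noteq> None \<longleftrightarrow> b < l a \<and> m a \<le> b \<and> (a,b) \<noteq> (i,j)" for a b
  proof -
    have "T (a,b) \<noteq> None \<longleftrightarrow> (a,b) \<in> dom T" by auto
    then show ?thesis unfolding dom unfolding l m by auto
  qed
  have ll: "l (Suc i) \<le> l i" and mm: "m (Suc i) \<le> m i" using l m by (auto simp: antimono_def)
  have j: "j < l (Suc i)" "m i \<le> j" using D[of "Suc i" j] y h m by auto
  have "Suc i < N" "l (Suc i) \<le> M"
    using bound j l by (auto simp: subset_iff) (metis less_or_eq_imp_le nat_neq_iff not_less)
  define A0 where "A0 = row_seg T (Suc i) 0 (m i)"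
  define A where "A = row_seg T (Suc i) (m i) j"
  define B where "B = row_seg T (Suc i) (Suc j) (l (Suc i))"
  define C where "C = row_seg T i (m i) j"
  define D1 where "D1 = row_seg T i (Suc j) (l (Suc i))"
  define D0 where "D0 = row_seg T i (l (Suc i)) M"
  have seg: "row_seg S a 0 M = row_seg S a 0 (m i) @ row_seg S a (m i) j @ row_seg S a j (Suc j) @
      row_seg S a (Suc j) (l (Suc i)) @ row_seg S a (l (Suc i)) M"
    "row_seg S a (m i) (l (Suc i)) = row_seg S a (m i) j @ row_seg S a j (Suc j) @ row_seg S a (Suc j) (l (Suc i))"
    for S :: "'a filling" and a
    using j \<open>l (Suc i) \<le> M\<close> row_seg_append[of 0 "m i" M S a] row_seg_append[of "m i" j M S a]
      row_seg_append[of j "Suc j" M S a] row_seg_append[of "Suc j" "l (Suc i)" M S a]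
      row_seg_append[of "m i" j "l (Suc i)" S a] row_seg_append[of j "Suc j" "l (Suc i)" S a] by simp_all
  have Tij: "T (i,j) = None" using D[of i j] by simp
  have none: "row_seg T (Suc i) (l (Suc i)) M = []" "row_seg T i 0 (m i) = []"
  proof -
    have "T (a,b) = None" if "l a \<le> b \<or> b < m a" for a b using that D[of a b] by auto
    then show "row_seg T (Suc i) (l (Suc i)) M = []" "row_seg T i 0 (m i) = []"
      by (simp_all add: row_seg_None)
  qed
  have cong: "row_seg ?T (Suc i) 0 (m i) = A0" "row_seg ?T (Suc i) (m i) j = A"
    "row_seg ?T (Suc i) (Suc j) (l (Suc i)) = B" "row_seg ?T (Suc i) (l (Suc i)) M = row_seg T (Suc i) (l (Suc i)) M"
    "row_seg ?T i 0 (m i) = row_seg T i 0 (m i)" "row_seg ?T i (m i) j = C"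
    "row_seg ?T i (Suc j) (l (Suc i)) = D1" "row_seg ?T i (l (Suc i)) M = D0"
    unfolding A0_def A_def B_def C_def D1_def D0_def using j by (auto intro!: row_seg_cong)
  have lower: "row_seg T (Suc i) 0 M = A0 @ A @ y # B" "row_seg ?T (Suc i) 0 M = A0 @ A @ B"
    unfolding seg cong none by (simp_all add: row_seg_Suc y A0_def A_def B_def)
  have upper: "row_seg T i 0 M = C @ D1 @ D0" "row_seg ?T i 0 M = C @ y # D1 @ D0"
    unfolding seg cong none by (simp_all add: row_seg_Suc Tij C_def D1_def D0_def)
  have "sorted (A @ y # B)"
    using sorted_row_seg[OF inc, of "Suc i" "m i" "l (Suc i)"]
    unfolding seg by (simp add: row_seg_Suc y A_def B_def)
  \<comment> \<open>Read off from the filling after the move, which is increasing by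
    \<open>holed_tab_down\<close>.\<close>
  moreover have "sorted (C @ y # D1)"
    using sorted_row_seg[OF inc', of i "m i" "l (Suc i)"]
    unfolding seg cong by (simp add: row_seg_Suc)
  moreover have "the (T (i,k)) < the (T (Suc i, k))" if "T (i,k) \<noteq> None" "T (Suc i, k) \<noteq> None" for k
    using that increasing_col[OF inc, of i "Suc i" k] by auto
  then have "list_all2 (<) C A" "list_all2 (<) D1 B"
    unfolding C_def A_def D1_def B_def using D ll mm j
    by (simp_all add: row_seg_Some list.rel_map list_all2_same)
  ultimately have "knuth (A @ y # B @ C @ D1) (A @ B @ C @ y # D1)"
    by (intro knuth_two_rows)
  from knuth_context[OF this, of A0 D0]
  have rows: "knuth (row_seg T (Suc i) 0 M @ row_seg T i 0 M) (row_seg ?T (Suc i) 0 M @ row_seg ?T i 0 M)"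
    by (simp add: lower upper)
  have split: "fill_word (Suc i) M S = row_seg S i 0 M @ fill_word i M S" for S :: "'a filling"
    using fill_word_split[of i "Suc i" M S] by simp
  have "map (\<lambda>a. row_seg ?T a 0 M) (rev [Suc (Suc i)..<N]) = map (\<lambda>a. row_seg T a 0 M) (rev [Suc (Suc i)..<N])"
    by (intro map_cong refl row_seg_cong) auto
  moreover have "fill_word i M ?T = fill_word i M T"
    by (intro fill_word_cong) auto
  ultimately show ?thesis
    using knuth_context[OF rows, of "concat (map (\<lambda>a. row_seg T a 0 M) (rev [Suc (Suc i)..<N]))" "fill_word i M T"]
    unfolding fill_word_split[OF \<open>Suc i < N\<close>] split by (simp only: append_assoc)
qed

lemma knuth_slide:
  assumes "slide h T U" "holed_tab lam mu h T" "lam \<subseteq> {..<N} \<times> {..<M}"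
  shows "knuth (fill_word N M T) (fill_word N M U) \<and> (\<exists>lam'\<subseteq>lam. skew_tab lam' mu U)"
  using assms
proof (induction rule: slide.induct)
  case (stop T i j)
  then show ?case using holed_tab_stop[of lam mu i j T] by (blast intro: knuth_refl)
next
  case (right T i j x U)
  let ?T = "T((i,j) \<mapsto> x, (i, Suc j) := None)"
  have T': "holed_tab lam mu (i, Suc j) ?T"
    by (rule holed_tab_right[OF right.prems(1) right.hyps(1,2)])
  then have "(i, Suc j) \<in> {..<N} \<times> {..<M}" using right.prems(2) unfolding holed_tab_def by blast
  moreover have "T (i,j) = None"
  proof -
    have "(i,j) \<notin> dom T" using right.prems(1) unfolding holed_tab_def by auto
    then show ?thesis by auto
  qed
  ultimately have "fill_word N M ?T = fill_word N M T"
    using right.hyps(1) by (intro fill_word_slide_right) auto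
  then show ?case using right.IH T' right.prems(2) by (simp only:)
next
  case (down T i j y U)
  have "holed_tab lam mu (Suc i, j) (T((i,j) \<mapsto> y, (Suc i, j) := None))"
    by (rule holed_tab_down[OF down.prems(1) down.hyps(1,2)])
  then have "knuth (fill_word N M (T((i,j) \<mapsto> y, (Suc i, j) := None))) (fill_word N M U)"
    "\<exists>lam'\<subseteq>lam. skew_tab lam' mu U"
    using down.IH[OF _ down.prems(2)] by (simp_all only:)
  moreover have "knuth (fill_word N M T) (fill_word N M (T((i,j) \<mapsto> y, (Suc i, j) := None)))"
    by (rule knuth_slide_down[OF down.prems(1) down.hyps(1,2) down.prems(2)])
  ultimately show ?case using knuth_trans by blast
qed

section \<open>Rectification by successive slides\<close>

lemma skew_tab_hole:
  assumes "skew_tab lam mu T" "(i,j) \<in> mu" "(i, Suc j) \<notin> mu" "(Suc i, j) \<notin> mu"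
  shows "holed_tab lam (mu - {(i,j)}) (i,j) T"
  using assms young_diagram_remove_corner[of mu i j] unfolding skew_tab_def holed_tab_def by auto

text \<open>The outer diagram only shrinks, so one rectangle serves for the reading words of all
  intermediate fillings.\<close>

lemma knuth_rectifies:
  assumes "rectifies mu T U" "skew_tab lam mu T" "lam \<subseteq> {..<N} \<times> {..<M}"
  shows "knuth (fill_word N M T) (fill_word N M U) \<and> (\<exists>lam'\<subseteq>lam. skew_tab lam' {} U)"
  using assms
proof (induction arbitrary: lam rule: rectifies.induct)
  case (base T)
  then show ?case by (blast intro: knuth_refl)
next
  case (step i j mu T T' U)
  have hole: "holed_tab lam (mu - {(i,j)}) (i,j) T"
    by (rule skew_tab_hole[OF step.prems(1) step.hyps(1-3)])
  obtain lam' where *: "knuth (fill_word N M T) (fill_word N M T')" "lam' \<subseteq> lam" "skew_tab lam' (mu - {(i,j)}) T'"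
    using knuth_slide[OF step.hyps(4) hole step.prems(2)] by metis
  have "lam' \<subseteq> {..<N} \<times> {..<M}" using * step.prems by (meson subset_trans)
  then obtain lam'' where **: "knuth (fill_word N M T') (fill_word N M U)" "lam'' \<subseteq> lam'" "skew_tab lam'' {} U"
    using step.IH[OF *(3)] by metis
  show ?case
    using knuth_trans[OF *(1) **(1)] **(3) subset_trans[OF **(2) *(2)] by metis
qed

lemma rectifies_exists: "skew_tab lam mu T \<Longrightarrow> \<exists>U. rectifies mu T U"
proof (induction "card mu" arbitrary: mu lam T)
  case 0
  then have "mu = {}" by (simp add: skew_tab_def young_diagram_finite)
  then show ?case using rectifies.base by blast
next
  case (Suc n)
  have fin: "finite mu" using Suc.prems by (simp add: skew_tab_def young_diagram_finite)
  moreover have "mu \<noteq> {}" using Suc.hyps(2) by auto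
  \<comment> \<open>A box of \<open>mu\<close> with the largest \<open>i + j\<close> is an inner
    corner.\<close>
  moreover define f where "f = (\<lambda>c :: box. fst c + snd c)"
  ultimately have "Max (f ` mu) \<in> f ` mu" by simp
  then obtain i j where ij: "(i,j) \<in> mu" "f (i,j) = Max (f ` mu)" by (auto simp: image_iff)
  then have "f d \<le> f (i,j)" if "d \<in> mu" for d using fin that by simp
  then have corner: "(i,j) \<in> mu" "(i, Suc j) \<notin> mu" "(Suc i, j) \<notin> mu" using ij(1) unfolding f_def by fastforce+
  have hole: "holed_tab lam (mu - {(i,j)}) (i,j) T" using skew_tab_hole[OF Suc.prems corner] .
  then obtain T' where T': "slide (i,j) T T'" using slide_exists by blast
  have "finite lam" using Suc.prems by (simp add: skew_tab_def young_diagram_finite)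
  then have "finite (fst ` lam)" "finite (snd ` lam)" by simp_all
  then obtain N M where "fst ` lam \<subseteq> {..<N}" "snd ` lam \<subseteq> {..<M}"
    by (meson finite_nat_iff_bounded)
  then have "lam \<subseteq> {..<N} \<times> {..<M}" by force
  then obtain lam' where "skew_tab lam' (mu - {(i,j)}) T'" using knuth_slide[OF T' hole] by blast
  moreover have "n = card (mu - {(i,j)})" using Suc.hyps(2) corner fin by simp
  ultimately obtain U where "rectifies (mu - {(i,j)}) T' U" using Suc.hyps(1) by blast
  then show ?case using rectifies.step[OF corner T'] by blast
qed

lemma row_seg_eq_row:
  assumes "\<And>j. j < M \<Longrightarrow> T (i, j) = (if c \<le> j \<and> j < c + length R then Some (R ! (j - c)) else None)"
    and "c + length R \<le> M"
  shows "row_seg T i 0 M = R"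
proof -
  have "row_seg T i 0 M = row_seg T i 0 c @ row_seg T i c (c + length R) @ row_seg T i (c + length R) M"
    using assms(2) row_seg_append[of 0 c M T i] row_seg_append[of c "c + length R" M T i] by simp
  moreover have "row_seg T i 0 c = []" "row_seg T i (c + length R) M = []"
    using assms by (auto intro!: row_seg_None)
  moreover have "row_seg T i c (c + length R) = map (\<lambda>j. the (T (i, j))) [c..<c + length R]"
    using assms by (intro row_seg_Some) auto
  moreover have "\<dots> = R"
    using assms by (intro nth_equalityI) auto
  ultimately show ?thesis by simp
qed

lemma fill_word_eq_rows_word:
  assumes "\<And>i. i < length Z \<Longrightarrow> row_seg T i 0 M = Z ! i"
    and "\<And>i. length Z \<le> i \<Longrightarrow> i < N \<Longrightarrow> row_seg T i 0 M = []" "length Z \<le> N"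
  shows "fill_word N M T = rows_word Z"
proof -
  have "map (\<lambda>i. row_seg T i 0 M) [0..<N] = Z @ replicate (N - length Z) []"
    using assms by (intro nth_equalityI) (auto simp: nth_append)
  then have "fill_word N M T = concat (rev (Z @ replicate (N - length Z) []))"
    unfolding fill_word_def rev_map[symmetric] by simp
  then show ?thesis by simp
qed

lemma fill_word_rows:
  assumes "shape (filling_of_rows X) \<subseteq> {..<N} \<times> {..<M}" "[] \<notin> set X"
  shows "fill_word N M (filling_of_rows X) = rows_word X"
proof (rule fill_word_eq_rows_word)
  have *: "i < N \<and> length (X ! i) \<le> M" if "i < length X" for i
  proof -
    have "X ! i \<noteq> []" using that assms(2) nth_mem by metis
    then have "(i, length (X ! i) - 1) \<in> shape (filling_of_rows X)"
      using that by (simp add: shape_rows)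
    then show ?thesis using assms(1) by auto
  qed
  show "row_seg (filling_of_rows X) i 0 M = X ! i" if "i < length X" for i
    using that * by (intro row_seg_eq_row[of M _ _ 0]) (auto simp: filling_of_rows_def)
  show "row_seg (filling_of_rows X) i 0 M = []" if "length X \<le> i" for i
    using that by (intro row_seg_None) (auto simp: filling_of_rows_def)
  show "length X \<le> N"
    using *[of "length X - 1"] by (cases X) auto
qed

text \<open>Every result of slides is a tableau whose reading word lies in the Knuth class of the
  word of \<open>T\<close>, so insertion names it without reference to the order of slides. With
  \<open>rectifies_exists\<close> this gives the uniqueness that the definite description asks
  for.\<close>

lemma rectification_eq:
  assumes T: "skew_tab lam mu T" and bound: "lam \<subseteq> {..<N} \<times> {..<M}"
  shows "rectification mu T = filling_of_rows (P_rows (fill_word N M T))"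
proof -
  have "U = filling_of_rows (P_rows (fill_word N M T))" if U: "rectifies mu T U" for U
  proof -
    obtain lam' where *: "knuth (fill_word N M T) (fill_word N M U)" "lam' \<subseteq> lam" "skew_tab lam' {} U"
      using knuth_rectifies[OF U T bound] by blast
    then have "young_tableau U" "dom U \<subseteq> {..<N} \<times> {..<M}"
      using bound unfolding skew_tab_def young_tableau_increasing by auto
    then obtain X where X: "tab_rows X" "U = filling_of_rows X" using young_tableau_obtain_rows by blast
    then have "fill_word N M U = rows_word X"
      using \<open>dom U \<subseteq> _\<close> tab_rows_not_Nil by (auto intro: fill_word_rows)
    then show ?thesis
      using knuth_P_rows[OF *(1)] P_rows_rows_word[OF X(1)] X(2) by simp
  qed
  then show ?thesis
    unfolding rectification_def using rectifies_exists[OF T] by (metis (no_types, lifting) the_equality)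
qed

section \<open>Products as insertion tableaux\<close>

lemma num_rows_young:
  assumes "tab_rows X"
  shows "num_rows (filling_of_rows X) = length X"
    and "num_cols (filling_of_rows X) = (if X = [] then 0 else length (hd X))"
proof -
  let ?D = "shape (filling_of_rows X)"
  have D: "young_diagram ?D" using assms by (rule young_diagram_rows)
  have "X ! i \<noteq> []" if "i < length X" for i
    using that assms tab_rows_not_Nil nth_mem by metis
  then have "fst ` ?D = {..<length X}"
    by (force simp: shape_rows image_iff)
  then show "num_rows (filling_of_rows X) = length X" by (simp add: num_rows_def)
  have "snd ` ?D = {j. (0, j) \<in> ?D}"
    using young_diagramD[OF D, of _ _ 0] by (force simp: image_iff)
  also have "\<dots> = {..<if X = [] then 0 else length (hd X)}"
    by (cases X) (auto simp: shape_rows)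
  finally show "num_cols (filling_of_rows X) = (if X = [] then 0 else length (hd X))"
    by (simp add: num_cols_def)
qed

text \<open>\<open>place\<close> puts the first factor below the second and reading goes from the
  bottom row up, so the word of the first factor comes first.\<close>

lemma tableau_prod_rows:
  assumes X: "tab_rows X" and Y: "tab_rows Y" and dist: "distinct (concat X @ concat Y)"
  shows "filling_of_rows X \<star> filling_of_rows Y = filling_of_rows (P_rows (rows_word X @ rows_word Y))"
proof -
  let ?T = "filling_of_rows X" and ?S = "filling_of_rows Y"
  define n where "n = num_rows ?S"
  define c where "c = num_cols ?T"
  have n: "n = length Y" and c: "c = (if X = [] then 0 else length (hd X))"
    using num_rows_young[OF X] num_rows_young[OF Y] by (auto simp: n_def c_def)
  have yT: "young_tableau ?T" and yS: "young_tableau ?S"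
    using X Y dist by (auto intro: young_tableau_rows)
  have dT: "young_diagram (shape ?T)" and dS: "young_diagram (shape ?S)"
    and iT: "increasing ?T" and iS: "increasing ?S"
    and jT: "inj_on ?T (shape ?T)" and jS: "inj_on ?S (shape ?S)"
    using yT yS by (auto simp: young_tableau_increasing)
  have Tc: "j < c" if "(i, j) \<in> shape ?T" for i j
  proof -
    have "(0, j) \<in> shape ?T" using that young_diagramD[OF dT, of i j 0 j] by simp
    then show ?thesis by (cases X) (auto simp: shape_rows c)
  qed
  have Sn: "i < n" if "(i, j) \<in> shape ?S" for i j
    using that by (auto simp: shape_rows n)
  define P where "P = place ?T ?S"
  have P: "P (i,j) = (if i < n then (if j < c then None else ?S (i, j - c)) else ?T (i - n, j))" for i j
    by (simp add: P_def place_def n_def c_def)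
  define mu where "mu = {..<n} \<times> {..<c}"
  \<comment> \<open>The outer diagram includes the empty rectangle \<open>mu\<close>.\<close>
  define lam where "lam = {(i,j). if i < n then j < c \<or> (i, j - c) \<in> shape ?S else (i - n, j) \<in> shape ?T}"
  have "lam \<subseteq> mu \<union> (\<lambda>(i,j). (i, j + c)) ` shape ?S \<union> (\<lambda>(i,j). (i + n, j)) ` shape ?T"
  proof
    fix b assume b: "b \<in> lam"
    obtain i j where ij: "b = (i,j)" by (cases b)
    consider "i < n" "j < c" | "i < n" "c \<le> j" "(i, j - c) \<in> shape ?S" | "n \<le> i" "(i - n, j) \<in> shape ?T"
    proof -
      have "if i < n then j < c \<or> (i, j - c) \<in> shape ?S else (i - n, j) \<in> shape ?T"
        using b unfolding ij lam_def by blast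
      then show thesis using that by (metis not_less)
    qed
    then show "b \<in> mu \<union> (\<lambda>(i,j). (i, j + c)) ` shape ?S \<union> (\<lambda>(i,j). (i + n, j)) ` shape ?T"
    proof cases
      case 2
      then show ?thesis using ij by (intro UnI1 UnI2 image_eqI[of _ _ "(i, j - c)"]) auto
    next
      case 3
      then show ?thesis using ij by (intro UnI2 image_eqI[of _ _ "(i - n, j)"]) auto
    qed (auto simp: ij mu_def)
  qed
  then have "finite lam"
    using young_diagram_finite[OF dT] young_diagram_finite[OF dS] by (auto simp: mu_def intro: finite_subset)
  have lam: "young_diagram lam"
  proof (rule young_diagramI[OF \<open>finite lam\<close>])
    fix i j i' j' assume *: "(i,j) \<in> lam" "i' \<le> i" "j' \<le> j"
    consider "i < n" | "i' < n" "n \<le> i" | "n \<le> i'" using *(2) by linarith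
    then show "(i',j') \<in> lam"
    proof cases
      case 1
      then have "j < c \<or> (i, j - c) \<in> shape ?S" using *(1) unfolding lam_def by simp
      then have "j' < c \<or> (i', j' - c) \<in> shape ?S"
        using young_diagramD[OF dS, of i "j - c" i' "j' - c"] *(2,3) by (metis diff_le_mono le_less_trans)
      moreover have "i' < n" using 1 *(2) by simp
      ultimately show ?thesis unfolding lam_def by simp
    next
      case 2
      then have "j < c" using * Tc[of "i - n" j] by (simp add: lam_def)
      then show ?thesis using 2 * by (simp add: lam_def)
    next
      case 3
      then show ?thesis
        using * young_diagramD[OF dT, of "i - n" j "i' - n" j'] by (simp add: lam_def)
    qed
  qed
  have mu: "young_diagram mu" by (rule young_diagramI) (auto simp: mu_def)
  have "dom P = lam - mu"
  proof -
    have "b \<in> dom P \<longleftrightarrow> b \<in> lam - mu" for b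
      by (cases b) (auto simp: P lam_def mu_def dom_def split: if_splits)
    then show ?thesis by blast
  qed
  moreover have "mu \<subseteq> lam" by (auto simp: mu_def lam_def)
  moreover have "increasing P"
    unfolding increasing_def
  proof (intro conjI allI impI; elim conjE)
    fix i j j' x y assume "j < j'" "P (i,j) = Some x" "P (i,j') = Some y"
    then show "x < y"
      using increasing_row[OF iS, of "j - c" "j' - c" i x y] increasing_row[OF iT, of j j' "i - n" x y]
      by (auto simp: P split: if_splits)
  next
    fix i i' j x y assume *: "i < i'" "P (i,j) = Some x" "P (i',j) = Some y"
    consider "i' < n" | "i < n" "n \<le> i'" | "n \<le> i" using *(1) by linarith
    then show "x < y"
    proof cases
      case 1
      then show ?thesis
        using * increasing_col[OF iS *(1), of "j - c" x y] by (auto simp: P split: if_splits)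
    next
      case 2
      then show ?thesis using * Tc[of "i' - n" j] by (auto simp: P split: if_splits)
    next
      case 3
      then show ?thesis
        using * increasing_col[OF iT, of "i - n" "i' - n" j x y] by (auto simp: P split: if_splits)
    qed
  qed
  moreover have "inj_on P (dom P)"
  proof (rule inj_onI)
    fix a b assume *: "a \<in> dom P" "b \<in> dom P" "P a = P b"
    obtain i j i' j' where ab: "a = (i,j)" "b = (i',j')" by (cases a, cases b)
    obtain x where x: "P (i,j) = Some x" "P (i',j') = Some x" using * ab by auto
    have no: "False" if "?T (k,l) = Some x" "?S (k',l') = Some x" for k l k' l'
    proof -
      have "x \<in> ran ?T" "x \<in> ran ?S" using that by (auto intro: ranI)
      then show False using dist by (auto simp: ran_rows disjoint_iff)
    qed
    have uS: "k = k' \<and> l = l'" if "?S (k,l) = Some x" "?S (k',l') = Some x" for k l k' l'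
      using inj_onD[OF jS, of "(k,l)" "(k',l')"] that by (simp add: domIff)
    have uT: "k = k' \<and> l = l'" if "?T (k,l) = Some x" "?T (k',l') = Some x" for k l k' l'
      using inj_onD[OF jT, of "(k,l)" "(k',l')"] that by (simp add: domIff)
    have cS: "c \<le> l \<and> ?S (k, l - c) = Some x" if "P (k,l) = Some x" "k < n" for k l
      using that by (simp add: P split: if_splits)
    have cT: "?T (k - n, l) = Some x" if "P (k,l) = Some x" "n \<le> k" for k l
      using that by (simp add: P)
    show "a = b"
    proof (cases "i < n")
      case True
      then have S: "c \<le> j" "?S (i, j - c) = Some x" using cS x(1) by auto
      then have "i' < n" using no cT[OF x(2)] by (meson not_less)
      then show ?thesis using S uS[OF S(2)] cS[OF x(2)] unfolding ab by fastforce
    next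
      case False
      then have T: "?T (i - n, j) = Some x" using cT x(1) by simp
      then have "n \<le> i'" using no cS[OF x(2)] by (meson not_less)
      then show ?thesis using False T uT[OF T] cT[OF x(2)] unfolding ab by fastforce
    qed
  qed
  ultimately have skew: "skew_tab lam mu P" using lam mu by (simp add: skew_tab_def)
  define N where "N = length (Y @ X)"
  obtain M0 where M0: "snd ` lam \<subseteq> {..<M0}" using \<open>finite lam\<close> by (meson finite_imageI finite_nat_iff_bounded)
  \<comment> \<open>\<open>M0\<close> bounds the columns of \<open>lam\<close>; the further summands
    make room for every row, even when shifted by \<open>c\<close>.\<close>
  define M where "M = M0 + c + (\<Sum>R\<leftarrow>X @ Y. length R)"
  have "snd ` lam \<subseteq> {..<M}" using M0 by (auto simp: M_def)
  moreover have "fst ` lam \<subseteq> {..<N}" by (auto simp: lam_def N_def n shape_rows split: if_splits)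
  ultimately have bound: "lam \<subseteq> {..<N} \<times> {..<M}" by force
  have len: "c + length R \<le> M" if "R \<in> set (X @ Y)" for R
    using member_le_sum_list[of "length R" "map length (X @ Y)"] that unfolding M_def by auto
  have "fill_word N M P = rows_word (Y @ X)"
  proof (rule fill_word_eq_rows_word)
    fix i assume i: "i < length (Y @ X)"
    show "row_seg P i 0 M = (Y @ X) ! i"
    proof (cases "i < n")
      case True
      then show ?thesis
        using len[of "Y ! i"] by (intro row_seg_eq_row[of M _ _ c]) (auto simp: n P nth_append filling_of_rows_def)
    next
      case False
      then show ?thesis
        using len[of "X ! (i - n)"] i
        by (intro row_seg_eq_row[of M _ _ 0]) (auto simp: n P nth_append filling_of_rows_def)
    qed
  qed (auto simp: N_def)
  then show ?thesis
    using rectification_eq[OF skew bound]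
    by (simp add: tableau_prod_def n_def[symmetric] c_def[symmetric] P_def[symmetric] mu_def[symmetric])
qed

subsection \<open>Transposition\<close>

definition row_tails :: "'b list list \<Rightarrow> 'b list list" where
  "row_tails X = filter (\<lambda>R. R \<noteq> []) (map tl X)"

lemma tab_rows_length_le: "tab_rows (R # X) \<Longrightarrow> S \<in> set X \<Longrightarrow> length S \<le> length R"
proof (induction X arbitrary: R)
  case (Cons S' X)
  then have "length S' \<le> length R" "tab_rows (S' # X)" by (auto simp: row_above_iff)
  then show ?case using Cons by fastforce
qed simp

lemma tab_rows_row_tails:
  assumes "tab_rows X"
  shows "tab_rows (row_tails X) \<and> (\<forall>i j. filling_of_rows (row_tails X) (i, j) = filling_of_rows X (i, Suc j))"
  using assms
proof (induction X)
  case (Cons R X)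
  have tab: "R \<noteq> []" "sorted R" "tab_rows X" using tab_rows_ConsD[OF Cons.prems] by auto
  have len: "length S \<le> length R" if "S \<in> set X" for S using tab_rows_length_le[OF Cons.prems that] .
  show ?case
  proof (cases "tl R = []")
    case True
    then have "length R = 1" using tab by (cases R) auto
    then have "tl S = []" if "S \<in> set X" for S using len[OF that] by (cases S) auto
    then have e: "row_tails (R # X) = []" using True by (auto simp: row_tails_def filter_empty_conv)
    have "filling_of_rows (R # X) (i, Suc j) = None" for i j
      using \<open>length R = 1\<close> len nth_mem[of "i - 1" X] by (cases i) (fastforce simp: filling_of_rows_def)+
    then show ?thesis unfolding e by simp
  next
    case False
    have e: "row_tails (R # X) = tl R # row_tails X" using False by (simp add: row_tails_def)
    have "row_above (tl R) (hd (row_tails X))" if ne: "row_tails X \<noteq> []"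
    proof -
      obtain S X' where X: "X = S # X'" using ne by (cases X) (auto simp: row_tails_def)
      have "row_above R S" using Cons.prems X by simp
      moreover have "tl S \<noteq> []"
      proof
        assume "tl S = []"
        then have "\<forall>S'\<in>set X. tl S' = []"
          using tab_rows_length_le[of S X'] tab(3) unfolding X by (fastforce simp: length_0_conv[symmetric] simp del: length_0_conv)
        then show False using ne by (auto simp: row_tails_def filter_empty_conv)
      qed
      ultimately show ?thesis using X tab by (cases R; cases S) (auto simp: row_tails_def)
    qed
    moreover have "sorted (tl R)" using tab by (cases R) auto
    moreover have "filling_of_rows (tl R # row_tails X) (i, j) = filling_of_rows (R # X) (i, Suc j)" for i j
      using Cons.IH tab by (cases i) (auto simp: nth_tl)
    ultimately show ?thesis unfolding e using Cons.IH tab False by (simp add: tab_rows_Cons)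
  qed
qed (simp add: row_tails_def)

text \<open>The letters of a row come in decreasing order, each bumping its predecessor from the
  place after \<open>H\<close>; only the least one stays.\<close>

lemma word_ins_rev_row:
  assumes "sorted_wrt (<) (r # R)" "\<forall>h\<in>set H. h \<le> r"
  shows "word_ins (rev (r # R)) H = H @ [r] \<and> word_bump (rev (r # R)) H = rev R"
  using assms
proof (induction R arbitrary: r)
  case Nil
  then show ?case using row_ins_snoc[of H r] by simp
next
  case (Cons s R)
  have "word_ins (rev (s # R)) H = H @ [s] \<and> word_bump (rev (s # R)) H = rev R"
    using Cons.prems by (intro Cons.IH) fastforce+
  moreover have "rev (r # s # R) = rev (s # R) @ [r]" by simp
  ultimately show ?case
    using row_replace1[of H r s "[]"] Cons.prems by (simp only: word_ins_append word_bump_append) simp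
qed

text \<open>Each row leaves its first letter behind and sends the rest down. So the first column
  becomes a row, and the bumped word has the same form for the tableau without that column.\<close>

lemma column_reading_first_row:
  assumes "\<forall>R\<in>set X. R \<noteq> [] \<and> sorted_wrt (<) R" "sorted (map hd X)"
  shows "word_ins (concat (map rev X)) [] = map hd X \<and>
         word_bump (concat (map rev X)) [] = concat (map rev (row_tails X))"
  using assms
proof (induction X rule: rev_induct)
  case (snoc R X)
  obtain r R' where R: "R = r # R'" using snoc.prems by (cases R) auto
  have "word_ins (rev (r # R')) (map hd X) = map hd X @ [r] \<and> word_bump (rev (r # R')) (map hd X) = rev R'"
    using snoc.prems R by (intro word_ins_rev_row) (auto simp: sorted_append)
  then show ?case
    using snoc R by (simp add: word_ins_append word_bump_append sorted_append row_tails_def)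
qed (simp add: row_tails_def)

lemma tab_rows_strict:
  "tab_rows X \<Longrightarrow> distinct (concat X) \<Longrightarrow> \<forall>R\<in>set X. R \<noteq> [] \<and> sorted_wrt (<) R"
  using tab_rows_sorted tab_rows_not_Nil by (fastforce simp: strict_sorted_iff distinct_concat_iff)

lemma tab_rows_hd: "tab_rows X \<Longrightarrow> sorted (map hd X)"
proof (induction X)
  case (Cons R X)
  show ?case
  proof (cases X)
    case (Cons S X')
    have "R \<noteq> []" "S \<noteq> []" using Cons.prems Cons tab_rows_ConsD by blast+
    then have "hd R < hd S" using Cons.prems Cons by (cases R; cases S) auto
    then show ?thesis using Cons.IH Cons.prems Cons by auto
  qed simp
qed simp

lemma row_tails_concat:
  "distinct (concat X) \<Longrightarrow> distinct (concat (row_tails X))"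
  "[] \<notin> set X \<Longrightarrow> length (concat (row_tails X)) + length X = length (concat X)"
proof -
  show "[] \<notin> set X \<Longrightarrow> length (concat (row_tails X)) + length X = length (concat X)"
  proof (induction X)
    case (Cons R X)
    then show ?case by (cases R) (auto simp: row_tails_def)
  qed (simp add: row_tails_def)
  show "distinct (concat X) \<Longrightarrow> distinct (concat (row_tails X))"
  proof (induction X)
    case (Cons R X)
    have "set (concat (row_tails X)) \<subseteq> set (concat X)"
      by (auto simp: row_tails_def) (metis list.sel(2) list.set_sel(2))
    moreover have "set (tl R) \<subseteq> set R" "distinct R \<Longrightarrow> distinct (tl R)" by (cases R; auto)+
    ultimately show ?case using Cons by (auto simp: row_tails_def)
  qed (simp add: row_tails_def)
qed

text \<open>The word inserted is the reversed reading word of \<open>X\<close>. Column after column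
  of \<open>X\<close> turns into a row by \<open>column_reading_first_row\<close>, the induction
  continuing with \<open>row_tails X\<close>.\<close>

lemma P_rows_rev_rows_word:
  assumes "tab_rows X" "distinct (concat X)"
  shows "filling_of_rows (P_rows (concat (map rev X))) = filling_of_rows X \<circ> prod.swap"
  using assms
proof (induction "length (concat X)" arbitrary: X rule: less_induct)
  case less
  show ?case
  proof (cases "X = []")
    case False
    let ?w = "concat (map rev X)"
    have ne: "[] \<notin> set X" using less.prems tab_rows_not_Nil by blast
    then have "?w \<noteq> []" using False by (cases X) auto
    then have P: "P_rows ?w = map hd X # P_rows (concat (map rev (row_tails X)))"
      using column_reading_first_row[OF tab_rows_strict[OF less.prems] tab_rows_hd[OF less.prems(1)]]
      by (simp add: insert_word_Nil insert_word_Cons)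
    have "length (concat (row_tails X)) < length (concat X)"
      using row_tails_concat(2)[OF ne] False by (cases X) auto
    then have IH: "filling_of_rows (P_rows (concat (map rev (row_tails X)))) = filling_of_rows (row_tails X) \<circ> prod.swap"
      using less.hyps tab_rows_row_tails row_tails_concat(1) less.prems by blast
    show ?thesis
    proof
      fix c :: box
      obtain i j where c: "c = (i, j)" by (cases c)
      show "filling_of_rows (P_rows ?w) c = (filling_of_rows X \<circ> prod.swap) c"
      proof (cases i)
        case 0
        have "X ! j \<noteq> []" if "j < length X" using that ne nth_mem by metis
        then show ?thesis unfolding c P 0 by (auto simp: filling_of_rows_def hd_conv_nth)
      next
        case (Suc k)
        then show ?thesis unfolding c P Suc using tab_rows_row_tails[OF less.prems(1)] by (simp add: IH)
      qed
    qed
  qed auto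
qed

lemma distinct_insert_word:
  "distinct (concat (insert_word u X)) \<longleftrightarrow> distinct (u @ concat X)"
  by (intro mset_eq_imp_distinct_iff) (simp add: mset_insert_word)

lemma set_insert_word: "set (concat (insert_word u X)) = set u \<union> set (concat X)"
  using arg_cong[OF mset_insert_word[of u X], of set_mset] by simp

text \<open>By \<open>knuth_rev\<close> the word may be replaced by the reading word of its own
  insertion tableau, for which the transposition is explicit.\<close>

lemma P_rows_rev:
  assumes "distinct u"
  shows "filling_of_rows (P_rows (rev u)) = filling_of_rows (P_rows u) \<circ> prod.swap"
proof -
  have "knuth (rev u) (rev (rows_word (P_rows u)))"
    using knuth_rev[OF knuth_rows_word_P_rows assms] .
  moreover have "rev (rows_word (P_rows u)) = concat (map rev (P_rows u))" by (simp add: rev_concat)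
  ultimately have "P_rows (rev u) = P_rows (concat (map rev (P_rows u)))"
    using knuth_P_rows by metis
  then show ?thesis
    using P_rows_rev_rows_word[of "P_rows u"] distinct_insert_word[of u "[]"] assms
    by (simp add: tab_insert_word)
qed

lemma young_diagram_swap: "young_diagram D \<Longrightarrow> young_diagram (prod.swap ` D)"
  by (rule young_diagramI) (auto simp: young_diagram_finite dest: young_diagramD)

lemma shape_swap_image: "shape (T \<circ> prod.swap) = prod.swap ` shape T"
proof (rule Set.set_eqI)
  fix c :: box
  obtain i j where "c = prod.swap (i, j)" by (metis swap_swap prod.collapse)
  then show "c \<in> shape (T \<circ> prod.swap) \<longleftrightarrow> c \<in> prod.swap ` shape T"
    by (simp add: domIff inj_image_mem_iff)
qed

lemma ran_swap: "ran (T \<circ> prod.swap) = ran T"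
  by (auto simp: ran_def)

lemma young_tableau_swap:
  assumes "young_tableau T"
  shows "young_tableau (T \<circ> prod.swap)"
proof -
  have "inj_on (T \<circ> prod.swap) (shape (T \<circ> prod.swap))"
    using assms unfolding shape_swap_image young_tableau_def
    by (auto simp: inj_on_def)
  then show ?thesis
    using assms young_diagram_swap[of "shape T"] unfolding young_tableau_increasing shape_swap_image increasing_def
    by auto
qed

subsection \<open>Strips\<close>

lemma column_strip_iff: "column_strip D \<longleftrightarrow> inj_on fst D"
  unfolding column_strip_def inj_on_def by (metis Pair_inject prod.collapse fst_conv)

text \<open>The row bumping lemma compares consecutive letters, and transitivity does the rest. Both
  directions matter: the one from boxes to letters shows that a word found by reverse insertion
  enumerates a set.\<close>

lemma newboxes_cols_iff:
  assumes "tab_rows X"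
  shows "sorted_wrt (<) (map snd (newboxes u X)) \<longleftrightarrow> sorted u"
proof -
  have "successively (<) (map snd (newboxes u X)) \<longleftrightarrow> successively (\<le>) u"
    using assms
  proof (induction u arbitrary: X)
    case (Cons x u)
    show ?case
    proof (cases u)
      case (Cons y v)
      have "snd (newbox x X) < snd (newbox y (row_insert x X)) \<longleftrightarrow> x \<le> y"
        using row_bumping[OF Cons.prems, where x = x and x' = y] by (metis not_less)
      then show ?thesis
        using Cons.IH[of "row_insert x X"] tab_row_insert[OF Cons.prems] Cons by simp
    qed simp
  qed simp
  then show ?thesis by (simp add: successively_conv_sorted_wrt transp_on_le)
qed

lemma newboxes_rows_iff:
  assumes "tab_rows X"
  shows "sorted_wrt (<) (map fst (newboxes u X)) \<longleftrightarrow> sorted_wrt (>) u"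
proof -
  have "successively (<) (map fst (newboxes u X)) \<longleftrightarrow> successively (>) u"
    using assms
  proof (induction u arbitrary: X)
    case (Cons x u)
    show ?case
    proof (cases u)
      case (Cons y v)
      have "fst (newbox x X) < fst (newbox y (row_insert x X)) \<longleftrightarrow> y < x"
        using row_bumping[OF Cons.prems, where x = x and x' = y] by (metis not_less)
      then show ?thesis
        using Cons.IH[of "row_insert x X"] tab_row_insert[OF Cons.prems] Cons by simp
    qed simp
  qed simp
  then show ?thesis by (simp add: successively_conv_sorted_wrt transp_on_def)
qed

text \<open>Removing the last box \<open>c\<close> leaves a diagram: a remaining box weakly below
  and to the right of \<open>c\<close> would have \<open>f\<close>-value at least that of
  \<open>c\<close>, so it would lie in \<open>D\<close>, and then \<open>c\<close> as well. The uses
  are \<open>f = fst\<close> and \<open>f = snd\<close>.\<close>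

lemma growth_of_sorted:
  assumes "young_diagram D" "young_diagram E" "sorted_wrt (<) (map f cs)" "D \<inter> set cs = {}" "D \<union> set cs = E"
    and mono: "\<And>a b. fst a \<le> fst b \<Longrightarrow> snd a \<le> snd b \<Longrightarrow> f a \<le> (f b :: nat)"
  shows "growth D cs E"
  using assms(2-5)
proof (induction cs arbitrary: E rule: rev_induct)
  case Nil
  then show ?case using assms(1) by (simp add: growth.Nil)
next
  case (snoc c cs)
  define E' where "E' = D \<union> set cs"
  have lt: "f d < f c" if "d \<in> set cs" for d
    using snoc.prems(2) that by (auto simp: sorted_wrt_append)
  have c: "c \<notin> E'" using lt[of c] snoc.prems(3) by (auto simp: E'_def)
  have E: "E = insert c E'" using snoc.prems(4) by (auto simp: E'_def)
  have "young_diagram E'"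
  proof (rule young_diagramI)
    show "finite E'" using assms(1) young_diagram_finite by (simp add: E'_def)
    fix i j i' j' assume *: "(i, j) \<in> E'" "i' \<le> i" "j' \<le> j"
    have "(i, j) \<in> E" using *(1) E by simp
    then have "(i', j') \<in> E" by (rule young_diagramD[OF snoc.prems(1) _ *(2,3)])
    moreover have "(i', j') \<noteq> c"
    proof
      assume "(i', j') = c"
      then have "f c \<le> f (i, j)" using *(2,3) mono[of c "(i, j)"] by (metis fst_conv snd_conv)
      then have "(i, j) \<notin> set cs" using lt[of "(i, j)"] by (meson not_less)
      then have "(i, j) \<in> D" using *(1) by (simp add: E'_def)
      then have "(i', j') \<in> D" by (rule young_diagramD[OF assms(1) _ *(2,3)])
      then have "c \<in> D" using \<open>(i', j') = c\<close> by simp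
      then show False using snoc.prems(3) by auto
    qed
    ultimately show "(i', j') \<in> E'" using E by simp
  qed
  moreover have "growth D cs E'"
    using snoc.prems \<open>young_diagram E'\<close> by (intro snoc.IH) (auto simp: sorted_wrt_append E'_def)
  ultimately show ?case using growth.snoc[of D cs E' c] c E snoc.prems(1) by simp
qed

lemma insert_word_strip_exists:
  assumes "tab_rows Y" "young_diagram D" "D \<subseteq> shape (filling_of_rows Y)" "inj_on f (shape (filling_of_rows Y) - D)"
    and mono: "\<And>a b. fst a \<le> fst b \<Longrightarrow> snd a \<le> snd b \<Longrightarrow> f a \<le> (f b :: nat)"
  obtains X u where "tab_rows X" "shape (filling_of_rows X) = D" "insert_word u X = Y"
    "sorted_wrt (<) (map f (newboxes u X))"
proof -
  let ?E = "shape (filling_of_rows Y)"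
  have E: "young_diagram ?E" using assms(1) by (rule young_diagram_rows)
  \<comment> \<open>The boxes of the strip listed by increasing value of \<open>f\<close>, which is
    injective there.\<close>
  define cs where "cs = map (inv_into (?E - D) f) (sorted_list_of_set (f ` (?E - D)))"
  have fin: "finite (f ` (?E - D))" using young_diagram_finite[OF E] by simp
  have "map f cs = sorted_list_of_set (f ` (?E - D))"
    using fin by (auto simp: cs_def f_inv_into_f intro!: map_idI)
  then have srt: "sorted_wrt (<) (map f cs)" by simp
  have "set cs = ?E - D"
    using fin assms(4) by (auto simp: cs_def inv_into_f_f image_iff inv_into_into)
  then have "growth D cs ?E"
    using assms srt E by (intro growth_of_sorted[where f = f]) auto
  then show thesis using insert_word_exists[OF _ assms(1) refl] srt that by metis
qed

lemma set_newboxes: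
  "tab_rows X \<Longrightarrow> set (newboxes u X) = shape (filling_of_rows (insert_word u X)) - shape (filling_of_rows X)"
  using growth_props[OF growth_newboxes, of X u] by (metis Int_commute Un_Diff_cancel2 Un_Diff Diff_triv Diff_cancel Un_empty_left)

text \<open>The shapes give the set of new boxes, and the increasing values of \<open>f\<close> give
  their order; this is the situation of \<open>insert_word_unique\<close>.\<close>

lemma insert_word_strip_unique:
  assumes "tab_rows X" "tab_rows X'" "insert_word u X = insert_word u' X'"
    and "shape (filling_of_rows X) = shape (filling_of_rows X')"
    and "sorted_wrt (<) (map f (newboxes u X))" "sorted_wrt (<) (map (f :: box \<Rightarrow> nat) (newboxes u' X'))"
  shows "X = X' \<and> u = u'"
proof -
  have "set (newboxes u X) = set (newboxes u' X')"
    by (simp only: set_newboxes[OF assms(1)] set_newboxes[OF assms(2)] assms(3,4))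
  moreover from this have "map f (newboxes u X) = map f (newboxes u' X')"
    using assms(5,6) by (intro sorted_distinct_set_unique) (auto simp: strict_sorted_iff)
  moreover have "inj_on f (set (newboxes u X))" using assms(5) by (simp add: strict_sorted_iff distinct_map)
  ultimately have "newboxes u X = newboxes u' X'" by (metis map_inj_on sup.idem)
  then show ?thesis using insert_word_unique assms by blast
qed

lemma strip_of_newboxes:
  assumes "tab_rows X" "sorted_wrt (<) (map (f :: box \<Rightarrow> nat) (newboxes u X))"
  shows "inj_on f (shape (filling_of_rows (insert_word u X)) - shape (filling_of_rows X))"
    and "shape (filling_of_rows X) \<subseteq> shape (filling_of_rows (insert_word u X))"
proof -
  have *: "shape (filling_of_rows (insert_word u X)) = shape (filling_of_rows X) \<union> set (newboxes u X)"
    using growth_props[OF growth_newboxes[OF assms(1), of u]] by blast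
  have "inj_on f (set (newboxes u X))" using assms(2) by (simp add: strict_sorted_iff distinct_map)
  then show "inj_on f (shape (filling_of_rows (insert_word u X)) - shape (filling_of_rows X))"
    unfolding * by (rule inj_on_subset) auto
  show "shape (filling_of_rows X) \<subseteq> shape (filling_of_rows (insert_word u X))" unfolding * by auto
qed

subsection \<open>Products with columns\<close>

lemma column_tableau_rows:
  "column_tableau A = filling_of_rows (map (\<lambda>a. [a]) (sorted_list_of_set A))"
proof
  fix c :: box
  show "column_tableau A c = filling_of_rows (map (\<lambda>a. [a]) (sorted_list_of_set A)) c"
    by (cases c) (auto simp: column_tableau_def filling_of_rows_def)
qed

lemma tab_rows_column: "tab_rows (map (\<lambda>a. [a]) (sorted_list_of_set A))"
proof -
  have "tab_rows (map (\<lambda>a. [a]) l)" if "sorted_wrt (<) l" for l :: "'a list"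
    using that
  proof (induction l)
    case (Cons a l)
    then show ?case by (cases l) auto
  qed simp
  then show ?thesis by simp
qed

lemma rows_word_column [simp]: "rows_word (map (\<lambda>a. [a]) l) = rev l"
  by (simp add: rev_map)

text \<open>Inserting the word of the first factor rebuilds \<open>X\<close>; the column is then
  read from its bottom, that is, as a decreasing word.\<close>

lemma prod_column_right:
  assumes "tab_rows X" "distinct (concat X)" "finite A" "set (concat X) \<inter> A = {}"
  shows "filling_of_rows X \<star> column_tableau A = filling_of_rows (insert_word (rev (sorted_list_of_set A)) X)"
  using assms tableau_prod_rows[OF assms(1) tab_rows_column[of A]]
  by (simp add: column_tableau_rows P_rows_rows_word)

text \<open>The column stands at the front of the reading word. Reversing the word transposes the tableau
  and turns the left factor into an increasing word inserted at the end.\<close>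

lemma prod_column_left:
  assumes "tab_rows X" "distinct (concat X)" "finite A" "set (concat X) \<inter> A = {}"
    and Y: "tab_rows Y" "filling_of_rows Y = filling_of_rows X \<circ> prod.swap"
  shows "column_tableau A \<star> filling_of_rows X =
    filling_of_rows (insert_word (sorted_list_of_set A) Y) \<circ> prod.swap"
proof -
  let ?w = "rev (rows_word X) @ sorted_list_of_set A"
  have "distinct ?w" using assms by auto
  have "distinct (concat (map (\<lambda>a. [a]) (sorted_list_of_set A)) @ concat X)"
    using assms by (auto simp: concat_map_singleton)
  then have "column_tableau A \<star> filling_of_rows X = filling_of_rows (P_rows (rev ?w))"
    using tableau_prod_rows[OF tab_rows_column[of A] assms(1)]
    by (simp add: column_tableau_rows)
  also have "\<dots> = filling_of_rows (P_rows ?w) \<circ> prod.swap"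
    using P_rows_rev \<open>distinct ?w\<close> by blast
  also have "P_rows (rev (rows_word X)) = Y"
  proof (rule filling_of_rows_inj)
    show "filling_of_rows (P_rows (rev (rows_word X))) = filling_of_rows Y"
      using P_rows_rev_rows_word[OF assms(1,2)] Y by (simp add: rev_concat)
  qed (simp_all add: tab_insert_word Y)
  then have "P_rows ?w = insert_word (sorted_list_of_set A) Y" by simp
  finally show ?thesis .
qed

lemma young_tableau_rows_swap:
  assumes "tab_rows X" "distinct (concat X)"
  obtains Y where "tab_rows Y" "distinct (concat Y)" "set (concat Y) = set (concat X)"
    "filling_of_rows Y = filling_of_rows X \<circ> prod.swap"
proof -
  obtain Y where Y: "tab_rows Y" "distinct (concat Y)" "filling_of_rows X \<circ> prod.swap = filling_of_rows Y"
    using young_tableau_obtain_rows[OF young_tableau_swap[OF young_tableau_rows[OF assms]]] by metis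
  have "set (concat Y) = set (concat X)"
    using arg_cong[OF Y(3), of ran] unfolding ran_swap ran_rows by (rule HOL.sym)
  then show thesis using that[of Y] Y by metis
qed

lemma swap_comp_eq_iff: "(T \<circ> prod.swap = U \<circ> prod.swap) \<longleftrightarrow> T = U"
  by (metis comp_assoc comp_id swap_comp_swap)

lemma inj_on_fst_swap:
  fixes D :: "('a \<times> 'b) set"
  shows "inj_on fst (prod.swap ` D) \<longleftrightarrow> inj_on snd D"
proof -
  have "fst \<circ> prod.swap = (snd :: 'a \<times> 'b \<Rightarrow> 'b)" by auto
  then show ?thesis using comp_inj_on_iff[of prod.swap D fst, OF inj_swap] by (simp only:)
qed

lemma young_tableau_insert_word:
  assumes "tab_rows X" "distinct (concat X)" "distinct u" "set (concat X) \<inter> set u = {}"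
  shows "young_tableau (filling_of_rows (insert_word u X))"
    and "ran (filling_of_rows (insert_word u X)) = set (concat X) \<union> set u"
proof -
  have "distinct (concat (insert_word u X))"
    using assms by (auto simp: distinct_insert_word)
  then show "young_tableau (filling_of_rows (insert_word u X))"
    using assms by (simp add: young_tableau_rows tab_insert_word)
  show "ran (filling_of_rows (insert_word u X)) = set (concat X) \<union> set u"
    unfolding ran_rows set_insert_word by blast
qed

lemma column_right:
  assumes U: "young_tableau U" and A: "finite A" "ran U \<inter> A = {}"
  shows "young_tableau (U \<star> column_tableau A)" "ran (U \<star> column_tableau A) = ran U \<union> A"
    "shape U \<subseteq> shape (U \<star> column_tableau A)" "column_strip (shape (U \<star> column_tableau A) - shape U)"
proof -
  obtain X where X: "tab_rows X" "distinct (concat X)" "U = filling_of_rows X"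
    using U by (rule young_tableau_obtain_rows)
  let ?u = "rev (sorted_list_of_set A)"
  have disj: "set (concat X) \<inter> A = {}" using A(2) unfolding X(3) ran_rows .
  then have e: "U \<star> column_tableau A = filling_of_rows (insert_word ?u X)"
    using prod_column_right X A(1) by blast
  have "sorted_wrt (<) (map fst (newboxes ?u X))"
    unfolding newboxes_rows_iff[OF X(1)] by (simp add: sorted_wrt_rev)
  from strip_of_newboxes[OF X(1) this]
  show "shape U \<subseteq> shape (U \<star> column_tableau A)" "column_strip (shape (U \<star> column_tableau A) - shape U)"
    unfolding column_strip_iff e unfolding X(3) by simp_all
  have "set (concat X) \<inter> set ?u = {}" using disj A(1) by simp
  from young_tableau_insert_word[OF X(1,2) _ this]
  show "young_tableau (U \<star> column_tableau A)" "ran (U \<star> column_tableau A) = ran U \<union> A"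
    unfolding e unfolding X(3) ran_rows using A(1) by (simp_all add: ran_rows)
qed

lemma column_left:
  assumes U: "young_tableau U" and A: "finite A" "ran U \<inter> A = {}"
  shows "young_tableau (column_tableau A \<star> U)" "ran (column_tableau A \<star> U) = ran U \<union> A"
    "shape U \<subseteq> shape (column_tableau A \<star> U)" "column_strip (shape (column_tableau A \<star> U) - shape U)"
proof -
  obtain X where X: "tab_rows X" "distinct (concat X)" "U = filling_of_rows X"
    using U by (rule young_tableau_obtain_rows)
  obtain Y where Y: "tab_rows Y" "distinct (concat Y)" "set (concat Y) = set (concat X)"
    "filling_of_rows Y = filling_of_rows X \<circ> prod.swap"
    using young_tableau_rows_swap[OF X(1,2)] by metis
  let ?u = "sorted_list_of_set A"
  have disj: "set (concat X) \<inter> A = {}" using A(2) unfolding X(3) ran_rows .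
  then have e: "column_tableau A \<star> U = filling_of_rows (insert_word ?u Y) \<circ> prod.swap"
    using prod_column_left[OF X(1,2) A(1) _ Y(1,4)] X(3) by blast
  have U': "shape U = prod.swap ` shape (filling_of_rows Y)"
    unfolding Y(4) X(3) shape_swap_image by (simp add: image_image)
  \<comment> \<open>The increasing word gives \<open>Y\<close> new boxes in distinct columns, which
    transposition turns into distinct rows.\<close>
  have "sorted_wrt (<) (map snd (newboxes ?u Y))"
    unfolding newboxes_cols_iff[OF Y(1)] by simp
  from strip_of_newboxes[OF Y(1) this]
  show "shape U \<subseteq> shape (column_tableau A \<star> U)" "column_strip (shape (column_tableau A \<star> U) - shape U)"
    unfolding column_strip_iff e shape_swap_image U' image_set_diff[OF inj_swap, symmetric] inj_on_fst_swap
    by (simp_all add: image_mono)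
  have "set (concat Y) \<inter> set ?u = {}" using disj A(1) Y(3) by simp
  from young_tableau_insert_word[OF Y(1,2) _ this]
  show "young_tableau (column_tableau A \<star> U)" "ran (column_tableau A \<star> U) = ran U \<union> A"
    unfolding e ran_swap unfolding X(3) ran_rows using A(1) Y(3) by (simp_all add: ran_rows young_tableau_swap)
qed

text \<open>Equal inner shapes give equal strips, and a strip is undone in only one way.\<close>

lemma column_right_unique:
  assumes U: "young_tableau U" and A: "finite A" "ran U \<inter> A = {}"
    and U': "young_tableau U'" and A': "finite A'" "ran U' \<inter> A' = {}"
    and eq: "U \<star> column_tableau A = U' \<star> column_tableau A'" "shape U = shape U'"
  shows "U = U' \<and> A = A'"
proof -
  obtain X where X: "tab_rows X" "distinct (concat X)" "U = filling_of_rows X"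
    using U by (rule young_tableau_obtain_rows)
  obtain X' where X': "tab_rows X'" "distinct (concat X')" "U' = filling_of_rows X'"
    using U' by (rule young_tableau_obtain_rows)
  let ?u = "\<lambda>A. rev (sorted_list_of_set A)"
  have "set (concat X) \<inter> A = {}" "set (concat X') \<inter> A' = {}"
    using A(2) A'(2) unfolding X(3) X'(3) ran_rows by auto
  then have "filling_of_rows (insert_word (?u A) X) = filling_of_rows (insert_word (?u A') X')"
    using eq(1) prod_column_right X X' A A' by metis
  then have "insert_word (?u A) X = insert_word (?u A') X'"
    using filling_of_rows_inj X X' tab_insert_word by blast
  then have "X = X' \<and> ?u A = ?u A'"
    using eq(2) X X' by (intro insert_word_strip_unique[where f = fst])
      (auto simp: newboxes_rows_iff sorted_wrt_rev)
  then show ?thesis using X X' A A' by (metis rev_is_rev_conv sorted_list_of_set_inject)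
qed

lemma column_left_unique:
  assumes U: "young_tableau U" and A: "finite A" "ran U \<inter> A = {}"
    and U': "young_tableau U'" and A': "finite A'" "ran U' \<inter> A' = {}"
    and eq: "column_tableau A \<star> U = column_tableau A' \<star> U'" "shape U = shape U'"
  shows "U = U' \<and> A = A'"
proof -
  obtain X where X: "tab_rows X" "distinct (concat X)" "U = filling_of_rows X"
    using U by (rule young_tableau_obtain_rows)
  obtain X' where X': "tab_rows X'" "distinct (concat X')" "U' = filling_of_rows X'"
    using U' by (rule young_tableau_obtain_rows)
  obtain Y where Y: "tab_rows Y" "distinct (concat Y)" "set (concat Y) = set (concat X)"
    "filling_of_rows Y = filling_of_rows X \<circ> prod.swap"
    using young_tableau_rows_swap[OF X(1,2)] by metis
  obtain Y' where Y': "tab_rows Y'" "distinct (concat Y')" "set (concat Y') = set (concat X')"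
    "filling_of_rows Y' = filling_of_rows X' \<circ> prod.swap"
    using young_tableau_rows_swap[OF X'(1,2)] by metis
  let ?u = "\<lambda>A. sorted_list_of_set A"
  have disj: "set (concat X) \<inter> A = {}" "set (concat X') \<inter> A' = {}"
    using A(2) A'(2) unfolding X(3) X'(3) ran_rows by auto
  have "filling_of_rows (insert_word (?u A) Y) \<circ> prod.swap = filling_of_rows (insert_word (?u A') Y') \<circ> prod.swap"
    using eq(1) prod_column_left[OF X(1,2) A(1) disj(1) Y(1,4)] prod_column_left[OF X'(1,2) A'(1) disj(2) Y'(1,4)]
    unfolding X(3) X'(3) by simp
  then have "insert_word (?u A) Y = insert_word (?u A') Y'"
    unfolding swap_comp_eq_iff using filling_of_rows_inj Y Y' tab_insert_word by blast
  moreover have "shape (filling_of_rows Y) = shape (filling_of_rows Y')"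
    unfolding Y(4) Y'(4) shape_swap_image using eq(2) X(3) X'(3) by simp
  ultimately have "Y = Y' \<and> ?u A = ?u A'"
    using Y Y' by (intro insert_word_strip_unique[where f = snd])
      (auto simp: newboxes_cols_iff)
  then have "U \<circ> prod.swap = U' \<circ> prod.swap" "A = A'"
    using X(3) X'(3) Y(4) Y'(4) A A' sorted_list_of_set_inject by (simp, blast)
  then show ?thesis unfolding swap_comp_eq_iff by blast
qed

text \<open>Reverse insertion along the strip yields some word \<open>u\<close>; since its boxes go
  down, it is decreasing, hence the reading word of a column.\<close>

lemma column_right_exists:
  assumes T: "young_tableau T" and D: "young_diagram D" "D \<subseteq> shape T" "column_strip (shape T - D)"
  obtains U A where "young_tableau U" "shape U = D" "finite A" "ran U \<inter> A = {}" "U \<star> column_tableau A = T"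
proof -
  obtain Y where Y: "tab_rows Y" "distinct (concat Y)" "T = filling_of_rows Y"
    using T by (rule young_tableau_obtain_rows)
  obtain X u where X: "tab_rows X" "shape (filling_of_rows X) = D" "insert_word u X = Y"
    "sorted_wrt (<) (map fst (newboxes u X))"
    using insert_word_strip_exists[OF Y(1) D(1), of fst] D(2,3) unfolding Y(3) column_strip_iff by metis
  have dist: "distinct u" "distinct (concat X)" "set u \<inter> set (concat X) = {}"
    using Y(2) unfolding X(3)[symmetric] distinct_insert_word by auto
  have "sorted_wrt (<) (rev u)" using X(4) unfolding newboxes_rows_iff[OF X(1)] sorted_wrt_rev .
  then have "sorted_list_of_set (set u) = rev u"
    by (metis set_rev sorted_list_of_set.idem_if_sorted_distinct strict_sorted_iff)
  then have "filling_of_rows X \<star> column_tableau (set u) = T"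
    using prod_column_right[OF X(1) dist(2), of "set u"] dist(3) Y(3) X(3) by (simp add: Int_commute)
  moreover have "ran (filling_of_rows X) \<inter> set u = {}" using dist(3) unfolding ran_rows by blast
  ultimately show thesis
    using that[of "filling_of_rows X" "set u"] young_tableau_rows[OF X(1) dist(2)] X(2) by simp
qed

lemma column_left_exists:
  assumes T: "young_tableau T" and D: "young_diagram D" "D \<subseteq> shape T" "column_strip (shape T - D)"
  obtains U A where "young_tableau U" "shape U = D" "finite A" "ran U \<inter> A = {}" "column_tableau A \<star> U = T"
proof -
  obtain Y where Y: "tab_rows Y" "distinct (concat Y)" "T \<circ> prod.swap = filling_of_rows Y"
    using young_tableau_swap[OF T] by (rule young_tableau_obtain_rows)
  have sh: "shape (filling_of_rows Y) = prod.swap ` shape T" unfolding Y(3)[symmetric] shape_swap_image ..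
  have "prod.swap ` D \<subseteq> shape (filling_of_rows Y)" "inj_on snd (shape (filling_of_rows Y) - prod.swap ` D)"
    using D(2,3) unfolding sh column_strip_iff
    by (auto simp: image_set_diff[symmetric] inj_on_fst_swap[symmetric] image_image)
  then obtain X u where X: "tab_rows X" "shape (filling_of_rows X) = prod.swap ` D" "insert_word u X = Y"
    "sorted_wrt (<) (map snd (newboxes u X))"
    using insert_word_strip_exists[OF Y(1) young_diagram_swap[OF D(1)], of snd] by metis
  have dist: "distinct u" "distinct (concat X)" "set u \<inter> set (concat X) = {}"
    using Y(2) unfolding X(3)[symmetric] distinct_insert_word by auto
  have "sorted u" using X(4) unfolding newboxes_cols_iff[OF X(1)] .
  then have u: "sorted_list_of_set (set u) = u"
    using dist(1) by (simp add: sorted_list_of_set.idem_if_sorted_distinct)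
  \<comment> \<open>Reverse insertion has produced the transpose of the wanted factor;
    \<open>Z\<close> is the factor itself.\<close>
  obtain Z where Z: "tab_rows Z" "distinct (concat Z)" "set (concat Z) = set (concat X)"
    "filling_of_rows Z = filling_of_rows X \<circ> prod.swap"
    using young_tableau_rows_swap[OF X(1) dist(2)] by metis
  have Z': "filling_of_rows X = filling_of_rows Z \<circ> prod.swap"
    unfolding Z(4) by (simp add: comp_assoc)
  have "set (concat Z) \<inter> set u = {}" using Z(3) dist(3) by blast
  from prod_column_left[OF Z(1,2) _ this X(1) Z']
  have "column_tableau (set u) \<star> filling_of_rows Z = filling_of_rows Y \<circ> prod.swap"
    by (simp add: u X(3))
  also have "\<dots> = T" unfolding Y(3)[symmetric] by (simp add: comp_assoc)
  finally have "column_tableau (set u) \<star> filling_of_rows Z = T" .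
  moreover have "shape (filling_of_rows Z) = D"
    unfolding Z(4) shape_swap_image X(2) by (simp add: image_image)
  moreover have "ran (filling_of_rows Z) \<inter> set u = {}" using dist(3) Z(3) unfolding ran_rows by blast
  ultimately show thesis
    using that[of "filling_of_rows Z" "set u"] young_tableau_rows[OF Z(1,2)] by simp
qed

subsection \<open>The Robinson--Schensted bijection\<close>

lemma fold_RS_step:
  "fold (RS_step w) ss (X, Q) = (insert_word (map w ss) X, Q(newboxes (map w ss) X [\<mapsto>] ss))"
proof (induction ss arbitrary: X Q)
  case (Cons s ss)
  have "shape (filling_of_rows (row_insert (w s) X)) - shape (filling_of_rows X) = {newbox (w s) X}"
    using shape_row_insert[of "w s" X] by blast
  then have "RS_step w s (X, Q) = (row_insert (w s) X, Q(newbox (w s) X \<mapsto> s))"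
    by (simp add: RS_step_def Let_def)
  then show ?case by (simp add: Cons.IH fun_upd_def)
qed simp

lemma RS\<^sub>1_eq: "RS\<^sub>1 S w = filling_of_rows (P_rows (map w (sorted_list_of_set S)))"
  and RS\<^sub>2_eq: "RS\<^sub>2 S w = Map.empty(newboxes (map w (sorted_list_of_set S)) [] [\<mapsto>] sorted_list_of_set S)"
  by (simp_all add: RS\<^sub>1_def RS\<^sub>2_def RS_def fold_RS_step)

lemma map_upds_snoc:
  "length cs = length ss \<Longrightarrow> m(cs @ [c] [\<mapsto>] ss @ [s]) = (m(cs [\<mapsto>] ss))(c \<mapsto> s)"
  by (induction cs ss arbitrary: m rule: list_induct2) auto

lemma map_upds_nth:
  "length cs = length ss \<Longrightarrow> distinct cs \<Longrightarrow> k < length cs \<Longrightarrow> (m(cs [\<mapsto>] ss)) (cs ! k) = Some (ss ! k)"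
  by (induction cs ss arbitrary: m k rule: list_induct2) (auto simp: nth_Cons split: nat.splits)

lemma young_tableau_add_max:
  assumes T: "young_tableau T" and c: "c \<notin> dom T" "young_diagram (insert c (dom T))"
    and max: "\<forall>x\<in>ran T. x < s"
  shows "young_tableau (T(c \<mapsto> s))"
proof -
  have inc: "increasing T" and yd: "young_diagram (dom T)" and inj: "inj_on T (dom T)"
    using T by (auto simp: young_tableau_increasing)
  have less: "x < s" if "T b = Some x" for b x using max that by (metis ranI)
  \<comment> \<open>No old box lies weakly below and to the right of \<open>c\<close>, since the old
    diagram would then contain \<open>c\<close>. So \<open>c\<close> is never the smaller box in a
    comparison.\<close>
  have nle: False if "T (i, j) = Some x" "c = (i', j')" "i' \<le> i" "j' \<le> j" for i j i' j' x
    using young_diagramD[OF yd, of i j i' j'] that c(1) by blast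
  have "increasing (T(c \<mapsto> s))"
    unfolding increasing_def
  proof (intro conjI allI impI; elim conjE)
    fix i j j' x y assume *: "j < j'" "(T(c \<mapsto> s)) (i,j) = Some x" "(T(c \<mapsto> s)) (i,j') = Some y"
    show "x < y"
    proof (cases "(i,j') = c")
      case True
      then have "T (i,j) = Some x" "y = s" using * by (auto split: if_splits)
      then show ?thesis using less by simp
    next
      case False
      then have "T (i,j') = Some y" using * by simp
      moreover from this have "(i,j) \<noteq> c" using nle[of i j' y i j] *(1) by auto
      ultimately show ?thesis using increasing_row[OF inc *(1)] * by simp
    qed
  next
    fix i i' j x y assume *: "i < i'" "(T(c \<mapsto> s)) (i,j) = Some x" "(T(c \<mapsto> s)) (i',j) = Some y"
    show "x < y"
    proof (cases "(i',j) = c")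
      case True
      then have "T (i,j) = Some x" "y = s" using * by (auto split: if_splits)
      then show ?thesis using less by simp
    next
      case False
      then have "T (i',j) = Some y" using * by simp
      moreover from this have "(i,j) \<noteq> c" using nle[of i' j y i j] *(1) by auto
      ultimately show ?thesis using increasing_col[OF inc *(1)] * by simp
    qed
  qed
  moreover have "inj_on (T(c \<mapsto> s)) (dom (T(c \<mapsto> s)))"
  proof -
    have "s \<notin> ran T" using max by blast
    then have "T b \<noteq> Some s" for b by (metis ranI)
    then show ?thesis using inj by (auto simp: inj_on_def)
  qed
  ultimately show ?thesis using c(2) by (simp add: young_tableau_increasing)
qed

lemma growth_young_tableau:
  assumes "growth D cs E" "D = {}" "length cs = length ss" "sorted_wrt (<) ss"
  shows "young_tableau (Map.empty(cs [\<mapsto>] ss)) \<and> dom (Map.empty(cs [\<mapsto>] ss)) = E \<and>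
    ran (Map.empty(cs [\<mapsto>] ss)) = set ss"
  using assms
proof (induction arbitrary: ss rule: growth.induct)
  case (Nil D)
  then show ?case by (simp add: young_tableau_def)
next
  case (snoc D cs E c)
  then obtain ss' s where ss: "ss = ss' @ [s]" by (cases ss rule: rev_exhaust) auto
  let ?T = "Map.empty(cs [\<mapsto>] ss')"
  have IH: "young_tableau ?T" "dom ?T = E" "ran ?T = set ss'"
    using snoc.IH[of ss'] snoc.prems ss by (auto simp: sorted_wrt_append)
  have "young_tableau (?T(c \<mapsto> s))"
    using young_tableau_add_max[OF IH(1), of c s] IH snoc.hyps snoc.prems(3) ss by (simp add: sorted_wrt_append)
  moreover have "c \<notin> dom ?T" unfolding IH(2) by (rule snoc.hyps(2))
  then have "?T c = None" unfolding domIff by simp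
  then have "ran (?T(c \<mapsto> s)) = set ss"
    by (subst ran_map_upd) (simp_all add: IH(3) ss)
  moreover have "dom (?T(c \<mapsto> s)) = insert c E" unfolding dom_fun_upd IH(2) by simp
  moreover have "Map.empty(cs @ [c] [\<mapsto>] ss) = ?T(c \<mapsto> s)"
    unfolding ss using snoc.prems(2) ss by (intro map_upds_snoc) simp
  ultimately show ?case by (simp only: simp_thms)
qed

text \<open>The largest entry sits in a corner, so removing entries from the largest down reads a
  chain of diagrams off the tableau.\<close>

lemma young_tableau_growth:
  assumes "young_tableau Q" "ran Q = set ss" "sorted_wrt (<) ss"
  shows "\<exists>cs. growth {} cs (dom Q) \<and> length cs = length ss \<and> Q = Map.empty(cs [\<mapsto>] ss)"
  using assms
proof (induction ss arbitrary: Q rule: rev_induct)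
  case Nil
  then have "Q b = None" for b by (metis empty_iff empty_set not_None_eq ranI)
  then have "Q = Map.empty" by blast
  then show ?case using growth.Nil[of "{}"] by (auto simp: young_diagram_iff)
next
  case (snoc s ss)
  have inc: "increasing Q" and yd: "young_diagram (dom Q)" and inj: "inj_on Q (dom Q)"
    using snoc.prems(1) by (auto simp: young_tableau_increasing)
  have "s \<in> ran Q" using snoc.prems(2) by simp
  then obtain i j where c: "Q (i,j) = Some s" by (auto simp: ran_def)
  have le: "x \<le> s" if "Q b = Some x" for b x
  proof -
    have "x \<in> set (ss @ [s])" using that snoc.prems(2) ranI by fastforce
    then show ?thesis using snoc.prems(3) by (auto simp: sorted_wrt_append less_imp_le)
  qed
  have corner: "(i, Suc j) \<notin> dom Q" "(Suc i, j) \<notin> dom Q"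
  proof -
    show "(i, Suc j) \<notin> dom Q"
    proof
      assume "(i, Suc j) \<in> dom Q"
      then obtain x where x: "Q (i, Suc j) = Some x" by blast
      show False using increasing_row[OF inc _ c x] le[OF x] by simp
    qed
    show "(Suc i, j) \<notin> dom Q"
    proof
      assume "(Suc i, j) \<in> dom Q"
      then obtain x where x: "Q (Suc i, j) = Some x" by blast
      show False using increasing_col[OF inc _ c x] le[OF x] by simp
    qed
  qed
  define Q' where "Q' = Q((i,j) := None)"
  have dom: "dom Q' = dom Q - {(i,j)}" by (simp add: Q'_def)
  have Q: "Q = Q'((i,j) \<mapsto> s)" using c by (auto simp: Q'_def)
  have s: "Q b \<noteq> Some s" if "b \<noteq> (i,j)" for b
    using that c inj_onD[OF inj, of b "(i,j)"] by auto
  have "young_tableau Q'"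
    unfolding young_tableau_increasing
  proof (intro conjI)
    show "young_diagram (dom Q')" unfolding dom by (rule young_diagram_remove_corner[OF yd corner])
    show "inj_on Q' (dom Q')"
      using inj unfolding dom by (auto simp: inj_on_def Q'_def)
    show "increasing Q'"
      unfolding increasing_def using increasing_row[OF inc] increasing_col[OF inc]
      by (auto simp: Q'_def split: if_splits)
  qed
  moreover have "ran Q' = set ss"
  proof -
    have "insert s (ran Q') = insert s (set ss)"
      using snoc.prems(2) unfolding Q by (subst (asm) ran_map_upd) (auto simp: Q'_def)
    moreover have "s \<notin> ran Q'" using s by (auto simp: ran_def Q'_def split: if_splits)
    moreover have "s \<notin> set ss" using snoc.prems(3) by (auto simp: sorted_wrt_append)
    ultimately show ?thesis by (metis insert_ident)
  qed
  moreover have "sorted_wrt (<) ss" using snoc.prems(3) by (simp add: sorted_wrt_append)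
  ultimately obtain cs where cs: "growth {} cs (dom Q')" "length cs = length ss" "Q' = Map.empty(cs [\<mapsto>] ss)"
    using snoc.IH[of Q'] by metis
  have ins: "insert (i,j) (dom Q') = dom Q" using c dom by auto
  have g: "growth {} (cs @ [(i,j)]) (insert (i,j) (dom Q'))"
    using cs(1) yd unfolding ins[symmetric] by (intro growth.snoc) (simp_all add: dom)
  have e: "Q = Map.empty(cs @ [(i,j)] [\<mapsto>] ss @ [s])"
    unfolding map_upds_snoc[OF cs(2)] cs(3)[symmetric] by (rule Q)
  show ?case
    by (intro exI[of _ "cs @ [(i,j)]"] conjI g[unfolded ins] e) (simp add: cs(2))
qed

lemma growth_RS: "growth {} (newboxes u []) (shape (filling_of_rows (P_rows u)))"
  using growth_newboxes[of "[]" u] by simp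

lemma RS_tableaux:
  assumes "finite S" "inj_on w S"
  shows "young_tableau (RS\<^sub>1 S w)" "ran (RS\<^sub>1 S w) = w ` S"
    "young_tableau (RS\<^sub>2 S w)" "ran (RS\<^sub>2 S w) = S" "shape (RS\<^sub>2 S w) = shape (RS\<^sub>1 S w)"
proof -
  let ?u = "map w (sorted_list_of_set S)"
  have "distinct ?u" using assms by (simp add: distinct_map)
  then show "young_tableau (RS\<^sub>1 S w)" "ran (RS\<^sub>1 S w) = w ` S"
    using young_tableau_insert_word[of "[]" ?u] assms by (simp_all add: RS\<^sub>1_eq)
  show "young_tableau (RS\<^sub>2 S w)" "ran (RS\<^sub>2 S w) = S" "shape (RS\<^sub>2 S w) = shape (RS\<^sub>1 S w)"
    using growth_young_tableau[OF growth_RS, of ?u "sorted_list_of_set S"] assms(1)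
    by (simp_all add: RS\<^sub>1_eq RS\<^sub>2_eq)
qed

text \<open>The recording tableau tells in which box each entry stands, hence the sequence of new
  boxes, and \<open>insert_word_unique\<close> then recovers the inserted word.\<close>

lemma RS_unique:
  assumes "finite S" "RS\<^sub>1 S w = RS\<^sub>1 S w'" "RS\<^sub>2 S w = RS\<^sub>2 S w'" "s \<in> S"
  shows "w s = w' s"
proof -
  let ?l = "sorted_list_of_set S"
  let ?u = "map w ?l" and ?u' = "map w' ?l"
  have P: "P_rows ?u = P_rows ?u'"
    using assms(2) unfolding RS\<^sub>1_eq by (intro filling_of_rows_inj) (simp_all add: tab_insert_word)
  define Q where "Q = Map.empty(newboxes ?u [] [\<mapsto>] ?l)"
  have Q': "Q = Map.empty(newboxes ?u' [] [\<mapsto>] ?l)" using assms(3) by (simp add: RS\<^sub>2_eq Q_def)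
  have "inj_on Q (dom Q)"
  proof -
    have "young_tableau Q" using growth_young_tableau[OF growth_RS, of ?u ?l] unfolding Q_def by simp
    then show ?thesis unfolding young_tableau_def by blast
  qed
  moreover have "Q (newboxes ?u [] ! k) = Some (?l ! k)" "Q (newboxes ?u' [] ! k) = Some (?l ! k)"
    if "k < length ?l" for k
    using growth_props[OF growth_RS, of ?u] growth_props[OF growth_RS, of ?u'] that
    by (simp add: Q_def map_upds_nth, simp add: Q' map_upds_nth)
  ultimately have "newboxes ?u [] ! k = newboxes ?u' [] ! k" if "k < length ?l" for k
    using inj_onD[of Q "dom Q" "newboxes ?u [] ! k" "newboxes ?u' [] ! k"] that by (simp add: domIff)
  then have "newboxes ?u [] = newboxes ?u' []"
    by (intro nth_equalityI) simp_all
  then have "?u = ?u'" using insert_word_unique[of "[]" "[]" ?u ?u'] P by simp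
  then show ?thesis using assms(1,4) by simp
qed

lemma map_distinct_exists:
  "length xs = length ys \<Longrightarrow> distinct xs \<Longrightarrow> \<exists>f. map f xs = ys"
proof (induction xs ys rule: list_induct2)
  case (Cons x xs y ys)
  then obtain f where "map f xs = ys" by auto
  then have "map (f(x := y)) (x # xs) = y # ys" using Cons.prems by auto
  then show ?case by (rule exI[of _ "f(x := y)"])
qed simp

text \<open>Reverse insertion from \<open>P\<close> along the chain read off from \<open>Q\<close>
  ends in the empty tableau and spells out the values of \<open>w\<close>.\<close>

lemma RS_exists:
  assumes P: "young_tableau P" and Q: "young_tableau Q" "finite S" "ran Q = S" and sh: "shape P = shape Q"
  obtains w where "inj_on w S" "RS\<^sub>1 S w = P" "RS\<^sub>2 S w = Q"
proof -
  let ?l = "sorted_list_of_set S"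
  have "ran Q = set ?l" using Q(2,3) by simp
  from young_tableau_growth[OF Q(1) this strict_sorted_list_of_set]
  obtain cs where cs: "growth {} cs (dom Q)" "length cs = length ?l" "Q = Map.empty(cs [\<mapsto>] ?l)"
    by metis
  obtain Y where Y: "tab_rows Y" "distinct (concat Y)" "P = filling_of_rows Y"
    using P by (rule young_tableau_obtain_rows)
  obtain X u where X: "tab_rows X" "shape (filling_of_rows X) = {}" "insert_word u X = Y" "newboxes u X = cs"
    using insert_word_exists[OF cs(1) Y(1)] sh Y(3) by metis
  have "X = []"
    using map_length_eq_of_shape[of X "[]"] X(1,2) tab_rows_not_Nil by auto
  have "length u = length ?l" using X(4) cs(2) by (metis length_newboxes)
  then obtain w where w: "map w ?l = u" using map_distinct_exists[of ?l u] by auto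
  have "distinct u" using Y(2) X(3) \<open>X = []\<close> distinct_insert_word[of u "[]"] by simp
  then have "inj_on w S" using w Q(2) by (metis distinct_map set_sorted_list_of_set)
  moreover have "RS\<^sub>1 S w = P" "RS\<^sub>2 S w = Q"
    using X(3,4) Y(3) cs(3) \<open>X = []\<close> by (simp_all add: RS\<^sub>1_eq RS\<^sub>2_eq w)
  ultimately show thesis using that by blast
qed

subsection \<open>The correspondence on combinatorial data\<close>

text \<open>\<open>I\<close> appears as the image of \<open>J\<close> under \<open>\<sigma>\<close>,
  and \<open>L'\<close>, \<open>M'\<close> are left to be complements. The last equation counts
  columns and becomes the condition on sizes in the target set.\<close>

definition link_data :: "nat \<Rightarrow> nat \<Rightarrow> nat \<Rightarrow> nat set \<Rightarrow> (nat \<Rightarrow> nat) \<Rightarrow> nat set \<Rightarrow> nat set \<Rightarrow> bool" where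
  "link_data p q r J \<sigma> L M \<longleftrightarrow>
     J \<subseteq> {1..q} \<and> L \<subseteq> {1..p} \<and> M \<subseteq> {1..q} \<and> inj_on \<sigma> J \<and> \<sigma> ` J \<subseteq> {1..p} \<and>
     \<sigma> ` J \<inter> L = {} \<and> J \<inter> M = {} \<and> card J + card L + card M = r"

definition data_tuple :: "nat \<Rightarrow> nat \<Rightarrow> nat set \<Rightarrow> (nat \<Rightarrow> nat) \<Rightarrow> nat set \<Rightarrow> nat set \<Rightarrow> gRS_tuple" where
  "data_tuple p q J \<sigma> L M =
     (column_tableau L \<star> RS\<^sub>1 J \<sigma> \<star> column_tableau ({1..p} - (\<sigma> ` J \<union> L)),
      column_tableau M \<star> RS\<^sub>2 J \<sigma> \<star> column_tableau ({1..q} - (J \<union> M)),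
      shape (column_tableau L \<star> RS\<^sub>1 J \<sigma>),
      shape (column_tableau M \<star> RS\<^sub>2 J \<sigma>),
      shape (RS\<^sub>1 J \<sigma>))"

lemma card_shape: "young_tableau T \<Longrightarrow> card (shape T) = card (ran T)"
proof -
  assume T: "young_tableau T"
  have "ran T = (the \<circ> T) ` shape T" by (force simp: ran_def image_iff)
  moreover have "inj_on (the \<circ> T) (shape T)"
  proof (rule inj_onI)
    fix a b assume ab: "a \<in> shape T" "b \<in> shape T" "(the \<circ> T) a = (the \<circ> T) b"
    then have "T a = T b" by auto
    then show "a = b" using T ab(1,2) unfolding young_tableau_def by (meson inj_onD)
  qed
  ultimately show ?thesis by (metis card_image)
qed

lemma columns_both_sides:
  assumes P: "young_tableau P" and fin: "finite A" "finite B"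
    and disj: "ran P \<inter> A = {}" "(ran P \<union> A) \<inter> B = {}"
  defines "U \<equiv> column_tableau A \<star> P" and "T \<equiv> column_tableau A \<star> P \<star> column_tableau B"
  shows "young_tableau U" "ran U = ran P \<union> A" "young_tableau T" "ran T = ran P \<union> A \<union> B"
    "shape P \<subseteq> shape U" "shape U \<subseteq> shape T"
    "column_strip (shape U - shape P)" "column_strip (shape T - shape U)"
proof -
  note l = column_left[OF P fin(1) disj(1), folded U_def]
  have "ran U \<inter> B = {}" using l(2) disj(2) by simp
  note r = column_right[OF l(1) fin(2) this]
  have T: "T = U \<star> column_tableau B" by (simp add: T_def U_def)
  show "young_tableau U" "ran U = ran P \<union> A" "young_tableau T" "ran T = ran P \<union> A \<union> B"
    "shape P \<subseteq> shape U" "shape U \<subseteq> shape T"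
    "column_strip (shape U - shape P)" "column_strip (shape T - shape U)"
    using l r unfolding T by auto
qed

text \<open>The right column is removed first, the shape of the remaining product being given; then
  the left column, the shape of \<open>P\<close> being given.\<close>

lemma columns_both_sides_unique:
  assumes P: "young_tableau P" "finite A" "finite B" "ran P \<inter> A = {}" "(ran P \<union> A) \<inter> B = {}"
    and P': "young_tableau P'" "finite A'" "finite B'" "ran P' \<inter> A' = {}" "(ran P' \<union> A') \<inter> B' = {}"
    and eq: "column_tableau A \<star> P \<star> column_tableau B = column_tableau A' \<star> P' \<star> column_tableau B'"
      "shape (column_tableau A \<star> P) = shape (column_tableau A' \<star> P')" "shape P = shape P'"
  shows "P = P' \<and> A = A'"
proof -
  note b = columns_both_sides[OF P] and b' = columns_both_sides[OF P']
  have "column_tableau A \<star> P = column_tableau A' \<star> P'"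
    using column_right_unique[OF b(1) P(3) _ b'(1) P'(3) _ eq(1,2)] b(2) b'(2) P(5) P'(5) by simp
  then show ?thesis using column_left_unique P P' eq(3) by blast
qed

lemma columns_both_sides_exists:
  assumes T: "young_tableau T" and D: "young_diagram D" "young_diagram D'" "D \<subseteq> D'" "D' \<subseteq> shape T"
    "column_strip (shape T - D')" "column_strip (D' - D)"
  obtains P A B where "young_tableau P" "finite A" "finite B" "ran P \<inter> A = {}" "(ran P \<union> A) \<inter> B = {}"
    "shape P = D" "shape (column_tableau A \<star> P) = D'" "column_tableau A \<star> P \<star> column_tableau B = T"
proof -
  obtain U B where U: "young_tableau U" "shape U = D'" "finite B" "ran U \<inter> B = {}" "U \<star> column_tableau B = T"
    using column_right_exists[OF T D(2,4,5)] by metis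
  obtain P A where P: "young_tableau P" "shape P = D" "finite A" "ran P \<inter> A = {}" "column_tableau A \<star> P = U"
    using column_left_exists[OF U(1) D(1)] D(3,6) U(2) by metis
  have "ran U = ran P \<union> A" using column_left(2)[OF P(1,3,4)] P(5) by simp
  then show thesis using that[of P A B] P U by simp
qed

lemma link_data_finite:
  "link_data p q r J \<sigma> L M \<Longrightarrow> finite J \<and> finite L \<and> finite M"
  unfolding link_data_def by (meson finite_atLeastAtMost finite_subset)

lemma link_data_sides:
  assumes d: "link_data p q r J \<sigma> L M"
  shows "young_tableau (RS\<^sub>1 J \<sigma>)" "finite L" "finite ({1..p} - (\<sigma> ` J \<union> L))"
      "ran (RS\<^sub>1 J \<sigma>) \<inter> L = {}" "(ran (RS\<^sub>1 J \<sigma>) \<union> L) \<inter> ({1..p} - (\<sigma> ` J \<union> L)) = {}"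
    and "young_tableau (RS\<^sub>2 J \<sigma>)" "finite M" "finite ({1..q} - (J \<union> M))"
      "ran (RS\<^sub>2 J \<sigma>) \<inter> M = {}" "(ran (RS\<^sub>2 J \<sigma>) \<union> M) \<inter> ({1..q} - (J \<union> M)) = {}"
  using link_data_finite[OF d] d RS_tableaux[of J \<sigma>] unfolding link_data_def by auto

lemma data_tuple_in_calT:
  assumes d: "link_data p q r J \<sigma> L M"
  shows "data_tuple p q J \<sigma> L M \<in> calT p q r"
proof -
  note fin = link_data_finite[OF d]
  have d': "inj_on \<sigma> J" "L \<subseteq> {1..p}" "\<sigma> ` J \<subseteq> {1..p}" "J \<subseteq> {1..q}" "M \<subseteq> {1..q}"
    "\<sigma> ` J \<inter> L = {}" "J \<inter> M = {}" "card J + card L + card M = r"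
    using d by (auto simp: link_data_def)
  note RS = RS_tableaux[OF conjunct1[OF fin] d'(1)]
  note s = link_data_sides[OF d]
  note b = columns_both_sides[OF s(1-5)] and c = columns_both_sides[OF s(6-10)]
  let ?T1 = "column_tableau L \<star> RS\<^sub>1 J \<sigma> \<star> column_tableau ({1..p} - (\<sigma> ` J \<union> L))"
  let ?T2 = "column_tableau M \<star> RS\<^sub>2 J \<sigma> \<star> column_tableau ({1..q} - (J \<union> M))"
  have r1: "ran ?T1 = {1..p}" and r2: "ran ?T2 = {1..q}"
    using d'(2-5) unfolding b(4) c(4) RS(2,4) by auto
  have c1: "card (shape ?T1) = p" and c2: "card (shape ?T2) = q"
    using card_shape[OF b(3)] card_shape[OF c(3)] r1 r2 by simp_all
  have yd: "young_diagram (shape T)" if "young_tableau T" for T :: "nat filling"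
    using that by (simp add: young_tableau_def)
  have "card (shape (column_tableau L \<star> RS\<^sub>1 J \<sigma>)) = card J + card L"
    using card_shape[OF b(1)] fin d'(1,6) unfolding b(2) RS(2)
    by (simp add: card_Un_disjoint card_image)
  moreover have "card (shape (column_tableau M \<star> RS\<^sub>2 J \<sigma>)) = card J + card M"
    using card_shape[OF c(1)] fin d'(7) unfolding c(2) RS(4)
    by (simp add: card_Un_disjoint)
  moreover have "card (shape (RS\<^sub>1 J \<sigma>)) = card J"
    using card_shape[OF RS(1)] d'(1) unfolding RS(2) by (simp add: card_image)
  ultimately have "data_tuple p q J \<sigma> L M \<in> calT_part r (shape ?T1) (shape ?T2)"
    using b c r1 r2 c1 c2 RS(1,5) d'(8) yd unfolding calT_part_def data_tuple_def standard_tableau_def by simp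
  moreover have "shape ?T1 \<in> young_diagrams p" "shape ?T2 \<in> young_diagrams q"
    using c1 c2 yd[OF b(3)] yd[OF c(3)] by (simp_all add: young_diagrams_iff)
  ultimately show ?thesis unfolding calT_def by blast
qed

lemma data_tuple_inj:
  assumes d: "link_data p q r J \<sigma> L M" and d': "link_data p q r J' \<sigma>' L' M'"
    and eq: "data_tuple p q J \<sigma> L M = data_tuple p q J' \<sigma>' L' M'"
  shows "J = J' \<and> L = L' \<and> M = M' \<and> (\<forall>j\<in>J. \<sigma> j = \<sigma>' j)"
proof -
  note s = link_data_sides[OF d] and s' = link_data_sides[OF d']
  have fin: "finite J" "finite J'" and inj: "inj_on \<sigma> J" "inj_on \<sigma>' J'"
    using link_data_finite d d' by (auto simp: link_data_def)
  note RS = RS_tableaux[OF fin(1) inj(1)] and RS' = RS_tableaux[OF fin(2) inj(2)]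
  have 1: "RS\<^sub>1 J \<sigma> = RS\<^sub>1 J' \<sigma>' \<and> L = L'"
    using eq unfolding data_tuple_def by (intro columns_both_sides_unique[OF s(1-5) s'(1-5)]) simp_all
  have 2: "RS\<^sub>2 J \<sigma> = RS\<^sub>2 J' \<sigma>' \<and> M = M'"
    using eq RS(5) RS'(5) unfolding data_tuple_def by (intro columns_both_sides_unique[OF s(6-10) s'(6-10)]) simp_all
  have "J = J'" using 2 RS(4) RS'(4) by metis
  then show ?thesis using 1 2 RS_unique[OF fin(1)] by blast
qed

lemma data_tuple_surj:
  assumes "t \<in> calT p q r"
  obtains J \<sigma> L M where "link_data p q r J \<sigma> L M" "data_tuple p q J \<sigma> L M = t"
proof -
  obtain T1 T2 D1 D2 N where t: "t = (T1, T2, D1, D2, N)" by (cases t)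
  have *: "standard_tableau T1" "card (shape T1) = p" "standard_tableau T2" "card (shape T2) = q"
    "young_diagram D1" "young_diagram D2" "young_diagram N" "N \<subseteq> D1" "D1 \<subseteq> shape T1" "N \<subseteq> D2" "D2 \<subseteq> shape T2"
    "column_strip (shape T1 - D1)" "column_strip (D1 - N)" "column_strip (shape T2 - D2)" "column_strip (D2 - N)"
    "card D1 + card D2 = card N + r"
    using assms unfolding t calT_def calT_part_def by (auto simp: young_diagrams_iff)
  have T: "young_tableau T1" "ran T1 = {1..p}" "young_tableau T2" "ran T2 = {1..q}"
    using *(1-4) by (auto simp: standard_tableau_def)
  obtain P L B where P: "young_tableau P" "finite L" "finite B" "ran P \<inter> L = {}" "(ran P \<union> L) \<inter> B = {}"
    "shape P = N" "shape (column_tableau L \<star> P) = D1" "column_tableau L \<star> P \<star> column_tableau B = T1"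
    using columns_both_sides_exists[OF T(1) *(7,5,8,9,12,13)] by metis
  obtain Q M C where Q: "young_tableau Q" "finite M" "finite C" "ran Q \<inter> M = {}" "(ran Q \<union> M) \<inter> C = {}"
    "shape Q = N" "shape (column_tableau M \<star> Q) = D2" "column_tableau M \<star> Q \<star> column_tableau C = T2"
    using columns_both_sides_exists[OF T(3) *(7,6,10,11,14,15)] by metis
  note b = columns_both_sides[OF P(1-5)] and c = columns_both_sides[OF Q(1-5)]
  have r1: "ran P \<union> L \<union> B = {1..p}" and r2: "ran Q \<union> M \<union> C = {1..q}"
    using b(4) c(4) T(2,4) unfolding P(8) Q(8) by simp_all
  have sub: "ran P \<subseteq> {1..p}" "L \<subseteq> {1..p}" "ran Q \<subseteq> {1..q}" "M \<subseteq> {1..q}" using r1 r2 by auto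
  have fin: "finite (ran P)" "finite (ran Q)" using sub by (meson finite_atLeastAtMost finite_subset)+
  define J where "J = ran Q"
  obtain \<sigma> where \<sigma>: "inj_on \<sigma> J" "RS\<^sub>1 J \<sigma> = P" "RS\<^sub>2 J \<sigma> = Q"
    using RS_exists[OF P(1) Q(1) fin(2) refl] P(6) Q(6) J_def by metis
  have I: "\<sigma> ` J = ran P" using RS_tableaux(2)[of J \<sigma>] \<sigma> fin(2) J_def by simp
  have "card D1 = card (ran P) + card L"
    using card_shape[OF b(1)] unfolding P(7) b(2) using P(2,4) fin by (simp add: card_Un_disjoint)
  moreover have "card D2 = card J + card M"
    using card_shape[OF c(1)] unfolding Q(7) c(2) J_def using Q(2,4) fin by (simp add: card_Un_disjoint)
  moreover have "card N = card (ran P)" using card_shape[OF P(1)] P(6) by simp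
  moreover have "card N = card J" using card_shape[OF Q(1)] Q(6) J_def by simp
  \<comment> \<open>\<open>P\<close> and \<open>Q\<close> have the common shape \<open>N\<close>, so
    both have |J| entries.\<close>
  ultimately have "card J + card L + card M = r" using *(16) by simp
  then have "link_data p q r J \<sigma> L M"
    unfolding link_data_def using \<sigma>(1) sub I P(4) Q(4) J_def by simp
  \<comment> \<open>The right columns \<open>B\<close> and \<open>C\<close> are forced to be the
    complements, because the tableaux are standard.\<close>
  moreover have "{1..p} - (\<sigma> ` J \<union> L) = B" "{1..q} - (J \<union> M) = C"
    using P(5) Q(5) unfolding I unfolding J_def r1[symmetric] r2[symmetric] by auto
  then have "data_tuple p q J \<sigma> L M = t"
    unfolding data_tuple_def t \<sigma> using P(6-8) Q(6-8) by simp
  ultimately show thesis using that by blast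
qed

subsection \<open>Matrices with disjoint column supports\<close>

text \<open>A maximal independent set of columns avoids the zero vector, so its members are found
  among the other columns.\<close>

lemma (in vec_space) rank_less_of_zero_col:
  assumes A: "A \<in> carrier_mat n nc" and k: "k < nc" "col A k = 0\<^sub>v n"
  shows "rank A < nc"
proof -
  let ?C = "set (cols A)"
  obtain S where S: "maximal S (\<lambda>T. T \<subseteq> ?C \<and> lin_indpt T)"
    using maximal_exists[of "(\<lambda>T. T \<subseteq> ?C \<and> lin_indpt T)" "card ?C" "{}"]
    by (meson List.finite_set card_mono empty_iff empty_subsetI finite_lin_indpt2 rev_finite_subset)
  then have S': "S \<subseteq> ?C" "lin_indpt S" by (auto simp: maximal_def)
  have "?C \<subseteq> carrier_vec n" using A cols_dim by blast
  then have zero: "0\<^sub>v n \<notin> S" using vs_zero_lin_dep[of S] S' by auto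
  have C: "?C = col A ` {..<nc}" using A by (auto simp: cols_def atLeast0LessThan)
  have "S \<subseteq> col A ` ({..<nc} - {k})"
  proof
    fix x assume x: "x \<in> S"
    then obtain l where l: "x = col A l" "l < nc" using S'(1) C by auto
    then have "l \<noteq> k" using x zero k(2) by metis
    then show "x \<in> col A ` ({..<nc} - {k})" using l by blast
  qed
  then have "card S \<le> card ({..<nc} - {k})"
    by (meson card_image_le card_mono finite_Diff finite_imageI finite_lessThan le_trans)
  also have "\<dots> < nc" using k(1) by simp
  finally show ?thesis using rank_card_indpt[OF A S] by simp
qed

text \<open>In a linear relation among the columns, the private row of column \<open>k\<close>
  isolates the coefficient of that column.\<close>

lemma (in vec_space) full_rank_of_private_rows:
  assumes A: "A \<in> carrier_mat n nc"
    and rows: "\<And>k. k < nc \<Longrightarrow> \<exists>i<n. \<forall>k'<nc. A $$ (i, k') = (if k' = k then 1 else 0)"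
  shows "rank A = nc"
proof (rule lin_indpt_full_rank[OF A])
  show dist: "distinct (cols A)"
    unfolding distinct_conv_nth
  proof (intro allI impI)
    fix k k' assume k: "k < length (cols A)" "k' < length (cols A)" "k \<noteq> k'"
    then obtain i where i: "i < n" "\<forall>l<nc. A $$ (i, l) = (if l = k then 1 else 0)"
      using rows[of k] A by auto
    then have "col A k $ i \<noteq> col A k' $ i" using k A by auto
    then show "cols A ! k \<noteq> cols A ! k'" using k by auto
  qed
  show "lin_indpt (set (cols A))"
  proof
    assume "lin_dep (set (cols A))"
    then obtain v where v: "v \<in> carrier_vec nc" "v \<noteq> 0\<^sub>v nc" "A *\<^sub>v v = 0\<^sub>v n"
      using lin_depE[OF A _ dist] by blast
    have "v $ k = 0" if k: "k < nc" for k
    proof -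
      obtain i where i: "i < n" "\<forall>l<nc. A $$ (i, l) = (if l = k then 1 else 0)"
        using rows[OF k] by blast
      have "(A *\<^sub>v v) $ i = (\<Sum>l<nc. A $$ (i, l) * v $ l)"
        using A v(1) i(1) by (simp add: scalar_prod_def atLeast0LessThan)
      also have "\<dots> = (\<Sum>l<nc. if l = k then v $ l else 0)"
        using i(2) by (intro sum.cong) auto
      also have "\<dots> = v $ k" using k by simp
      finally show ?thesis using v(3) i(1) by simp
    qed
    then have "v = 0\<^sub>v nc" using v(1) by (intro eq_vecI) auto
    then show False using v(2) by simp
  qed
qed

text \<open>The matrices in terms of column supports, the rank condition being replaced by non-empty
  columns. Labels up to \<open>p\<close> belong to the upper block, so agreement on
  \<open>i \<le> p\<close> means lying in the same block.\<close>

definition link_matrix :: "nat \<Rightarrow> nat \<Rightarrow> nat \<Rightarrow> 'a::field mat \<Rightarrow> bool" where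
  "link_matrix p q r \<omega> \<longleftrightarrow> \<omega> \<in> carrier_mat (p + q) r \<and>
     (\<forall>i<p + q. \<forall>k<r. \<omega> $$ (i, k) \<in> {0, 1}) \<and>
     (\<forall>k<r. \<forall>k'<r. ones_in_col \<omega> k \<inter> ones_in_col \<omega> k' \<noteq> {} \<longrightarrow> k = k') \<and>
     (\<forall>k<r. ones_in_col \<omega> k \<noteq> {}) \<and>
     (\<forall>k<r. \<forall>i\<in>ones_in_col \<omega> k. \<forall>i'\<in>ones_in_col \<omega> k. (i \<le> p \<longleftrightarrow> i' \<le> p) \<longrightarrow> i = i')"

lemma append_rows_index:
  assumes "A \<in> carrier_mat a r" "B \<in> carrier_mat b r" "i < a + b" "k < r"
  shows "(A @\<^sub>r B) $$ (i, k) = (if i < a then A $$ (i, k) else B $$ (i - a, k))"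
  using assms by (auto simp: append_rows_def)

lemma ones_in_col_iff:
  "\<omega> \<in> carrier_mat n r \<Longrightarrow> i \<in> ones_in_col \<omega> k \<longleftrightarrow> 1 \<le> i \<and> i \<le> n \<and> \<omega> $$ (i - 1, k) = 1"
  by (auto simp: ones_in_col_def)

text \<open>As supports are disjoint, the row of any 1 is private to its column.\<close>

lemma rank_eq_iff:
  fixes \<omega> :: "'a::field mat"
  assumes \<omega>: "\<omega> \<in> carrier_mat n r" and e: "\<forall>i<n. \<forall>k<r. \<omega> $$ (i, k) \<in> {0, 1}"
    and disj: "\<forall>k<r. \<forall>k'<r. ones_in_col \<omega> k \<inter> ones_in_col \<omega> k' \<noteq> {} \<longrightarrow> k = k'"
  shows "vec_space.rank n \<omega> = r \<longleftrightarrow> (\<forall>k<r. ones_in_col \<omega> k \<noteq> {})"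
proof
  assume rank: "vec_space.rank n \<omega> = r"
  show "\<forall>k<r. ones_in_col \<omega> k \<noteq> {}"
  proof (intro allI impI notI)
    fix k assume k: "k < r" "ones_in_col \<omega> k = {}"
    have "\<omega> $$ (i, k) = 0" if "i < n" for i
    proof -
      have "\<omega> $$ (i, k) \<in> {0, 1}" using e that k(1) by blast
      moreover have "Suc i \<notin> ones_in_col \<omega> k" using k(2) by simp
      then have "\<omega> $$ (i, k) \<noteq> 1" using that unfolding ones_in_col_iff[OF \<omega>] by simp
      ultimately show ?thesis by simp
    qed
    then have "col \<omega> k = 0\<^sub>v n" using \<omega> k(1) by (intro eq_vecI) auto
    then show False using vec_space.rank_less_of_zero_col[OF \<omega> k(1)] rank by simp
  qed
next
  assume ne: "\<forall>k<r. ones_in_col \<omega> k \<noteq> {}"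
  show "vec_space.rank n \<omega> = r"
  proof (rule vec_space.full_rank_of_private_rows[OF \<omega>])
    fix k assume k: "k < r"
    then obtain i where i: "i \<in> ones_in_col \<omega> k" using ne by blast
    then have i': "i - 1 < n" "Suc (i - 1) = i" unfolding ones_in_col_iff[OF \<omega>] by auto
    have "\<omega> $$ (i - 1, k') = (if k' = k then 1 else 0)" if k': "k' < r" for k'
    proof (cases "k' = k")
      case False
      then have "i \<notin> ones_in_col \<omega> k'" using disj k k' i by blast
      then have "\<omega> $$ (i - 1, k') \<noteq> 1" using i unfolding ones_in_col_iff[OF \<omega>] by simp
      moreover have "\<omega> $$ (i - 1, k') \<in> {0, 1}" using e i'(1) k' by blast
      ultimately show ?thesis using False by simp
    qed (use i in \<open>simp add: ones_in_col_iff[OF \<omega>]\<close>)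
    then show "\<exists>i<n. \<forall>k'<r. \<omega> $$ (i, k') = (if k' = k then 1 else 0)" using i'(1) by blast
  qed
qed

lemma frakT_iff: "\<omega> \<in> frakT p q r \<longleftrightarrow> link_matrix p q r (\<omega> :: 'a::field mat)"
proof
  assume "\<omega> \<in> frakT p q r"
  then obtain A B where \<omega>: "\<omega> = A @\<^sub>r B" and A: "A \<in> partial_perm_mats p r" and B: "B \<in> partial_perm_mats q r"
    and rank: "vec_space.rank (p + q) \<omega> = r"
    unfolding frakT_def by blast
  have c: "A \<in> carrier_mat p r" "B \<in> carrier_mat q r" using A B by (auto simp: partial_perm_mats_def)
  then have cw: "\<omega> \<in> carrier_mat (p + q) r" unfolding \<omega> by simp
  have idx: "\<omega> $$ (i, k) = (if i < p then A $$ (i, k) else B $$ (i - p, k))" if "i < p + q" "k < r" for i k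
    unfolding \<omega> using append_rows_index[OF c that] .
  have "\<omega> $$ (i, k) \<in> {0, 1}" if "i < p + q" "k < r" for i k
    using A B that unfolding idx[OF that] partial_perm_mats_def by (cases "i < p") auto
  moreover have disj: "k = k'" if "k < r" "k' < r" "i \<in> ones_in_col \<omega> k" "i \<in> ones_in_col \<omega> k'" for i k k'
  proof -
    have i: "i - 1 < p + q" "\<omega> $$ (i - 1, k) = 1" "\<omega> $$ (i - 1, k') = 1"
      using that unfolding ones_in_col_iff[OF cw] by auto
    show ?thesis
    proof (cases "i - 1 < p")
      case True
      then show ?thesis using i A that(1,2) unfolding partial_perm_mats_def by (simp add: idx)
    next
      case False
      then have "i - 1 - p < q" using i(1) by simp
      then show ?thesis using False i B that(1,2) unfolding partial_perm_mats_def by (simp add: idx)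
    qed
  qed
  moreover have "i = i'"
    if "k < r" "i \<in> ones_in_col \<omega> k" "i' \<in> ones_in_col \<omega> k" "i \<le> p \<longleftrightarrow> i' \<le> p" for i i' k
  proof -
    have i: "1 \<le> i" "1 \<le> i'" "i - 1 < p + q" "i' - 1 < p + q" "\<omega> $$ (i - 1, k) = 1" "\<omega> $$ (i' - 1, k) = 1"
      using that unfolding ones_in_col_iff[OF cw] by auto
    show ?thesis
    proof (cases "i \<le> p")
      case True
      then have "i - 1 < p" "i' - 1 < p" using i(1,2) that(4) by auto
      then have "i - 1 = i' - 1" using i A that(1) unfolding partial_perm_mats_def by (simp add: idx)
      then show ?thesis using i(1,2) by simp
    next
      case False
      then have lt: "\<not> i - 1 < p" "\<not> i' - 1 < p" "i - 1 - p < q" "i' - 1 - p < q" using i that(4) by auto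
      then have "i - 1 - p = i' - 1 - p" using i B that(1) unfolding partial_perm_mats_def by (simp add: idx)
      then show ?thesis using i(1,2) lt(1,2) False that(4) by simp
    qed
  qed
  moreover have "\<forall>k<r. ones_in_col \<omega> k \<noteq> {}"
    using rank_eq_iff[OF cw] calculation(1) disj rank by blast
  ultimately show "link_matrix p q r \<omega>" using cw unfolding link_matrix_def by blast
next
  assume l: "link_matrix p q r \<omega>"
  have cw: "\<omega> \<in> carrier_mat (p + q) r" and e: "\<forall>i<p + q. \<forall>k<r. \<omega> $$ (i, k) \<in> {0, 1}"
    and disj: "\<forall>k<r. \<forall>k'<r. ones_in_col \<omega> k \<inter> ones_in_col \<omega> k' \<noteq> {} \<longrightarrow> k = k'"
    and ne: "\<forall>k<r. ones_in_col \<omega> k \<noteq> {}"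
    and one: "\<forall>k<r. \<forall>i\<in>ones_in_col \<omega> k. \<forall>i'\<in>ones_in_col \<omega> k. (i \<le> p \<longleftrightarrow> i' \<le> p) \<longrightarrow> i = i'"
    using l unfolding link_matrix_def by simp_all
  define A where "A = mat p r (\<lambda>(i, k). \<omega> $$ (i, k))"
  define B where "B = mat q r (\<lambda>(i, k). \<omega> $$ (p + i, k))"
  have c: "A \<in> carrier_mat p r" "B \<in> carrier_mat q r" by (auto simp: A_def B_def)
  have \<omega>: "\<omega> = A @\<^sub>r B"
  proof (rule eq_matI)
    fix i k assume "i < dim_row (A @\<^sub>r B)" "k < dim_col (A @\<^sub>r B)"
    then have "i < p + q" "k < r" using carrier_append_rows[OF c] by auto
    then show "\<omega> $$ (i, k) = (A @\<^sub>r B) $$ (i, k)"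
      unfolding append_rows_index[OF c \<open>i < p + q\<close> \<open>k < r\<close>] by (simp add: A_def B_def)
  qed (use cw carrier_append_rows[OF c] in auto)
  have mem: "Suc i \<in> ones_in_col \<omega> k" if "i < p + q" "\<omega> $$ (i, k) = 1" for i k
    using that unfolding ones_in_col_iff[OF cw] by simp
  have row: "k = k'" if "i < p + q" "k < r" "k' < r" "\<omega> $$ (i, k) = 1" "\<omega> $$ (i, k') = 1" for i k k'
    using disj that(2,3) mem[OF that(1,4)] mem[OF that(1,5)] by blast
  have col: "i = i'" if "i < p + q" "i' < p + q" "k < r" "\<omega> $$ (i, k) = 1" "\<omega> $$ (i', k) = 1" "i < p \<longleftrightarrow> i' < p" for i i' k
  proof -
    have "Suc i \<le> p \<longleftrightarrow> Suc i' \<le> p" using that(6) by (simp add: Suc_le_eq)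
    then show ?thesis using one that(3) mem[OF that(1,4)] mem[OF that(2,5)] by blast
  qed
  have "A \<in> partial_perm_mats p r"
  proof -
    have "i = i'" if "i < p" "i' < p" "k < r" "\<omega> $$ (i, k) = 1" "\<omega> $$ (i', k) = 1" for i i' k
      using that by (intro col[of _ _ k]) auto
    moreover have "k = k'" if "i < p" "k < r" "k' < r" "\<omega> $$ (i, k) = 1" "\<omega> $$ (i, k') = 1" for i k k'
      using that by (intro row[of i]) auto
    ultimately show ?thesis using c e unfolding partial_perm_mats_def by (auto simp: A_def)
  qed
  moreover have "B \<in> partial_perm_mats q r"
  proof -
    have "p + i = p + i'" if "i < q" "i' < q" "k < r" "\<omega> $$ (p + i, k) = 1" "\<omega> $$ (p + i', k) = 1" for i i' k
      using that by (intro col[of _ _ k]) auto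
    moreover have "k = k'" if "i < q" "k < r" "k' < r" "\<omega> $$ (p + i, k) = 1" "\<omega> $$ (p + i, k') = 1" for i k k'
      using that by (intro row[of "p + i"]) auto
    ultimately show ?thesis using c e unfolding partial_perm_mats_def by (auto simp: B_def)
  qed
  moreover have "vec_space.rank (p + q) \<omega> = r" using rank_eq_iff[OF cw e disj] ne by simp
  ultimately show "\<omega> \<in> frakT p q r" unfolding frakT_def using \<omega> by blast
qed

section \<open>Classes of matrices as sets of supports\<close>

text \<open>A set rather than a multiset suffices: supports of different columns are disjoint and
  non-empty, hence different.\<close>

definition supports :: "'a::field mat \<Rightarrow> nat set set" where
  "supports \<omega> = ones_in_col \<omega> ` {..<dim_col \<omega>}"

lemma link_matrix_entry: "link_matrix p q r \<omega> \<Longrightarrow> i < p + q \<Longrightarrow> k < r \<Longrightarrow> \<omega> $$ (i, k) \<in> {0, 1}"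
  unfolding link_matrix_def by simp

lemma inj_on_ones: "link_matrix p q r \<omega> \<Longrightarrow> inj_on (ones_in_col \<omega>) {..<r}"
  unfolding link_matrix_def by (auto intro!: inj_onI)

lemma col_perm_rel_iff:
  fixes A B :: "'a::field mat"
  shows "(A, B) \<in> col_perm_rel p q r \<longleftrightarrow> A \<in> frakT p q r \<and> B \<in> frakT p q r \<and> supports A = supports B"
proof
  assume "(A, B) \<in> col_perm_rel p q r"
  then obtain \<pi> where AB: "A \<in> frakT p q r" "B \<in> frakT p q r" and \<pi>: "\<pi> permutes {..<r}"
    and B: "B = mat (p + q) r (\<lambda>(i,k). A $$ (i, \<pi> k))"
    unfolding col_perm_rel_def by blast
  have A: "A \<in> carrier_mat (p + q) r" and B': "B \<in> carrier_mat (p + q) r" using AB frakT_carrier by auto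
  have "ones_in_col B k = ones_in_col A (\<pi> k)" if "k < r" for k
  proof (rule Set.set_eqI)
    fix i
    show "i \<in> ones_in_col B k \<longleftrightarrow> i \<in> ones_in_col A (\<pi> k)"
      unfolding ones_in_col_iff[OF A] ones_in_col_iff[OF B'] using that by (auto simp: B)
  qed
  then have "ones_in_col B ` {..<r} = ones_in_col A ` (\<pi> ` {..<r})" by (auto simp: image_image)
  then show "A \<in> frakT p q r \<and> B \<in> frakT p q r \<and> supports A = supports B"
    using AB A B' permutes_image[OF \<pi>] by (simp add: supports_def)
next
  assume *: "A \<in> frakT p q r \<and> B \<in> frakT p q r \<and> supports A = supports B"
  then have lA: "link_matrix p q r A" and lB: "link_matrix p q r B" by (simp_all add: frakT_iff)
  then have A: "A \<in> carrier_mat (p + q) r" and B: "B \<in> carrier_mat (p + q) r" by (auto simp: link_matrix_def)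
  have eq: "ones_in_col A ` {..<r} = ones_in_col B ` {..<r}" using * A B by (simp add: supports_def)
  have bA: "bij_betw (ones_in_col A) {..<r} (ones_in_col A ` {..<r})"
    and bB: "bij_betw (ones_in_col B) {..<r} (ones_in_col A ` {..<r})"
    using inj_on_ones[OF lA] inj_on_ones[OF lB] eq by (auto simp: bij_betw_def)
  \<comment> \<open>Each column of \<open>B\<close> is matched with the column of \<open>A\<close>
    that has the same support.\<close>
  define f where "f = inv_into {..<r} (ones_in_col A) \<circ> ones_in_col B"
  have f: "bij_betw f {..<r} {..<r}"
    unfolding f_def using bB bij_betw_inv_into[OF bA] by (rule bij_betw_trans)
  \<comment> \<open>The identity outside the range of columns, as \<open>permutes\<close>
    demands.\<close>
  define \<pi> where "\<pi> k = (if k < r then f k else k)" for k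
  have "bij_betw \<pi> {..<r} {..<r}" using f by (subst bij_betw_cong[of _ _ f]) (auto simp: \<pi>_def)
  then have \<pi>: "\<pi> permutes {..<r}" by (rule bij_imp_permutes) (simp add: \<pi>_def)
  have ones: "ones_in_col A (\<pi> k) = ones_in_col B k" if "k < r" for k
  proof -
    have "ones_in_col B k \<in> ones_in_col A ` {..<r}" using that eq by blast
    then show ?thesis using that by (simp add: \<pi>_def f_def f_inv_into_f)
  qed
  have "B = mat (p + q) r (\<lambda>(i,k). A $$ (i, \<pi> k))"
  proof (rule eq_matI)
    fix i k assume "i < dim_row (mat (p + q) r (\<lambda>(i,k). A $$ (i, \<pi> k)))" "k < dim_col (mat (p + q) r (\<lambda>(i,k). A $$ (i, \<pi> k)))"
    then have ik: "i < p + q" "k < r" by auto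
    have "\<pi> k < r" using permutes_in_image[OF \<pi>, of k] ik(2) by simp
    then have "A $$ (i, \<pi> k) \<in> {0, 1}" "B $$ (i, k) \<in> {0, 1}"
      using link_matrix_entry[OF lA ik(1)] link_matrix_entry[OF lB ik] by simp_all
    moreover have "A $$ (i, \<pi> k) = 1 \<longleftrightarrow> B $$ (i, k) = 1"
    proof -
      have "Suc i \<in> ones_in_col A (\<pi> k) \<longleftrightarrow> Suc i \<in> ones_in_col B k" using ones[OF ik(2)] by simp
      then show ?thesis unfolding ones_in_col_iff[OF A] ones_in_col_iff[OF B] using ik(1) by simp
    qed
    ultimately have "B $$ (i, k) = A $$ (i, \<pi> k)" by auto
    then show "B $$ (i, k) = mat (p + q) r (\<lambda>(i,k). A $$ (i, \<pi> k)) $$ (i, k)" using ik by simp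
  qed (use B in auto)
  then show "(A, B) \<in> col_perm_rel p q r" using * \<pi> unfolding col_perm_rel_def by blast
qed

subsection \<open>Combinatorial data of a matrix\<close>

definition data_supports :: "nat \<Rightarrow> nat set \<Rightarrow> (nat \<Rightarrow> nat) \<Rightarrow> nat set \<Rightarrow> nat set \<Rightarrow> nat set set" where
  "data_supports p J \<sigma> L M = (\<lambda>j. {\<sigma> j, p + j}) ` J \<union> (\<lambda>i. {i}) ` L \<union> (\<lambda>j. {p + j}) ` M"

lemma linked_iff:
  "linked p q \<omega> i j \<longleftrightarrow> i \<in> {1..p} \<and> j \<in> {1..q} \<and> {i, p + j} \<in> supports \<omega>"
  by (auto simp: linked_def supports_def image_iff)

lemma data_L_iff: "data_L p q \<omega> = {i \<in> {1..p}. {i} \<in> supports \<omega>}"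
  and data_M_iff: "data_M p q \<omega> = {j \<in> {1..q}. {p + j} \<in> supports \<omega>}"
  by (auto simp: data_L_def data_M_def supports_def image_iff)

text \<open>In a support with two elements one label is at most \<open>p\<close> and the other
  beyond it, so it is determined which is \<open>i\<close> and which is
  \<open>p + j\<close>.\<close>

lemma data_of_supports:
  assumes d: "link_data p q r J \<sigma> L M" and s: "supports \<omega> = data_supports p J \<sigma> L M"
  shows "linked p q \<omega> i j \<longleftrightarrow> j \<in> J \<and> i = \<sigma> j" "data_J p q \<omega> = J" "data_I p q \<omega> = \<sigma> ` J"
    "data_L p q \<omega> = L" "data_M p q \<omega> = M" "\<And>j. j \<in> J \<Longrightarrow> data_sigma p q \<omega> j = \<sigma> j"
proof -
  have b: "\<And>j. j \<in> J \<Longrightarrow> 1 \<le> j \<and> j \<le> q \<and> 1 \<le> \<sigma> j \<and> \<sigma> j \<le> p" "\<And>i. i \<in> L \<Longrightarrow> 1 \<le> i \<and> i \<le> p"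
    "\<And>j. j \<in> M \<Longrightarrow> 1 \<le> j \<and> j \<le> q"
    using d unfolding link_data_def by (fastforce, fastforce, fastforce)
  have link: "linked p q \<omega> i j \<longleftrightarrow> j \<in> J \<and> i = \<sigma> j" for i j
  proof
    assume "linked p q \<omega> i j"
    then have i: "1 \<le> i" "i \<le> p" "1 \<le> j" and "{i, p + j} \<in> data_supports p J \<sigma> L M"
      unfolding linked_iff s by auto
    then consider j' where "j' \<in> J" "{i, p + j} = {\<sigma> j', p + j'}" | i' where "{i, p + j} = {i'}"
      unfolding data_supports_def by auto
    then show "j \<in> J \<and> i = \<sigma> j"
    proof cases
      case (1 j')
      then show ?thesis using i b(1)[of j'] by (auto simp: doubleton_eq_iff)
    next
      case (2 i')
      then have "i = p + j" by auto
      then show ?thesis using i by simp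
    qed
  next
    assume "j \<in> J \<and> i = \<sigma> j"
    then show "linked p q \<omega> i j" using b(1)[of j] unfolding linked_iff s data_supports_def by auto
  qed
  show "linked p q \<omega> i j \<longleftrightarrow> j \<in> J \<and> i = \<sigma> j" by (rule link)
  show "data_J p q \<omega> = J" "data_I p q \<omega> = \<sigma> ` J"
    unfolding data_J_def data_I_def link by auto
  show "data_sigma p q \<omega> j = \<sigma> j" if "j \<in> J" for j
    using that unfolding data_sigma_def link by simp
  have two: "{\<sigma> j, p + j} \<noteq> {x}" if "j \<in> J" for j x
    using b(1)[OF that] by auto
  have "{i} \<in> data_supports p J \<sigma> L M \<longleftrightarrow> i \<in> L" if "i \<in> {1..p}" for i
  proof -
    have "i \<noteq> p + j" if "j \<in> M" for j using b(3)[OF that] \<open>i \<in> {1..p}\<close> by auto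
    then show ?thesis using two unfolding data_supports_def by blast
  qed
  then show "data_L p q \<omega> = L" using b(2) unfolding data_L_iff s by auto
  have "{p + j} \<in> data_supports p J \<sigma> L M \<longleftrightarrow> j \<in> M" if "j \<in> {1..q}" for j
  proof -
    have "p + j \<noteq> i" if "i \<in> L" for i using b(2)[OF that] \<open>j \<in> {1..q}\<close> by auto
    moreover have "{p + j} = {p + j'} \<Longrightarrow> j = j'" for j' by simp
    ultimately show ?thesis using two unfolding data_supports_def by blast
  qed
  then show "data_M p q \<omega> = M" using b(3) unfolding data_M_iff s by auto
qed

lemma card_data_supports:
  assumes fin: "finite J" "finite L" "finite M"
    and b: "\<And>j. j \<in> J \<Longrightarrow> 1 \<le> j \<and> 1 \<le> \<sigma> j \<and> \<sigma> j \<le> p" "\<And>i. i \<in> L \<Longrightarrow> 1 \<le> i \<and> i \<le> p" "\<And>j. j \<in> M \<Longrightarrow> 1 \<le> j"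
  shows "card (data_supports p J \<sigma> L M) = card J + card L + card M"
proof -
  have "inj_on (\<lambda>j. {\<sigma> j, p + j}) J"
  proof (rule inj_onI)
    fix j j' assume "j \<in> J" "j' \<in> J" "{\<sigma> j, p + j} = {\<sigma> j', p + j'}"
    then show "j = j'" using b(1)[of j] b(1)[of j'] by (auto simp: doubleton_eq_iff)
  qed
  then have c: "card ((\<lambda>j. {\<sigma> j, p + j}) ` J) = card J" "card ((\<lambda>i. {i}) ` L) = card L" "card ((\<lambda>j. {p + j}) ` M) = card M"
    by (auto intro!: card_image inj_onI)
  have "(\<lambda>j. {\<sigma> j, p + j}) ` J \<inter> (\<lambda>i. {i}) ` L = {}"
    "((\<lambda>j. {\<sigma> j, p + j}) ` J \<union> (\<lambda>i. {i}) ` L) \<inter> (\<lambda>j. {p + j}) ` M = {}"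
    using b by fastforce+
  then show ?thesis
    unfolding data_supports_def using fin c by (simp add: card_Un_disjoint)
qed

lemma link_matrix_data:
  assumes l: "link_matrix p q r \<omega>"
  defines "J \<equiv> data_J p q \<omega>" and "\<sigma> \<equiv> data_sigma p q \<omega>" and "L \<equiv> data_L p q \<omega>" and "M \<equiv> data_M p q \<omega>"
  shows "link_data p q r J \<sigma> L M" "supports \<omega> = data_supports p J \<sigma> L M"
proof -
  have c: "\<omega> \<in> carrier_mat (p + q) r" and ne: "\<And>k. k < r \<Longrightarrow> ones_in_col \<omega> k \<noteq> {}"
    and one: "\<And>k i i'. k < r \<Longrightarrow> i \<in> ones_in_col \<omega> k \<Longrightarrow> i' \<in> ones_in_col \<omega> k \<Longrightarrow> (i \<le> p \<longleftrightarrow> i' \<le> p) \<Longrightarrow> i = i'"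
    using l unfolding link_matrix_def by blast+
  have supp: "supports \<omega> = ones_in_col \<omega> ` {..<r}" using c by (simp add: supports_def)
  have meet: "S = S'" if "S \<in> supports \<omega>" "S' \<in> supports \<omega>" "i \<in> S" "i \<in> S'" for S S' i
    using l that unfolding supp link_matrix_def by blast
  have bound: "1 \<le> i \<and> i \<le> p + q" if "S \<in> supports \<omega>" "i \<in> S" for S i
    using that c unfolding supp by (auto simp: ones_in_col_def)
  have linked: "linked p q \<omega> i j \<longleftrightarrow> j \<in> J \<and> i = \<sigma> j" for i j
  proof -
    have uniq: "i' = i" if "linked p q \<omega> i j" "linked p q \<omega> i' j" for i i'
    proof -
      have "{i, p + j} = {i', p + j}" "i \<le> p" "i' \<le> p" "1 \<le> j"
        using that meet[of "{i, p + j}" "{i', p + j}" "p + j"] by (auto simp: linked_iff)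
      then show ?thesis by (auto simp: doubleton_eq_iff)
    qed
    then have "\<sigma> j = i" if "linked p q \<omega> i j" for i
      using that unfolding \<sigma>_def data_sigma_def by blast
    then show ?thesis unfolding J_def data_J_def by blast
  qed
  have lJ: "\<sigma> j \<in> {1..p} \<and> j \<in> {1..q} \<and> {\<sigma> j, p + j} \<in> supports \<omega>" if "j \<in> J" for j
    using that linked[of "\<sigma> j" j] unfolding linked_iff by blast
  have lL: "i \<in> L \<longleftrightarrow> i \<in> {1..p} \<and> {i} \<in> supports \<omega>" and lM: "i \<in> M \<longleftrightarrow> i \<in> {1..q} \<and> {p + i} \<in> supports \<omega>" for i
    by (simp_all add: L_def M_def data_L_iff data_M_iff)
  have "S \<in> data_supports p J \<sigma> L M" if S: "S \<in> supports \<omega>" for S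
  proof -
    obtain k where k: "k < r" "S = ones_in_col \<omega> k" using S unfolding supp by blast
    have one: "i = i'" if "i \<in> S" "i' \<in> S" "i \<le> p \<longleftrightarrow> i' \<le> p" for i i' using one k that by blast
    have "S \<noteq> {}" using ne k by blast
    \<comment> \<open>A support has at most one label in each block: it is a singleton in the upper
      block, a singleton in the lower block, or a pair with one label in each.\<close>
    consider i where "i \<in> S" "i \<le> p" "\<forall>j\<in>S. j \<le> p" | j where "j \<in> S" "p < j" "\<forall>i\<in>S. p < i"
      | i j where "i \<in> S" "i \<le> p" "j \<in> S" "p < j"
      using \<open>S \<noteq> {}\<close> by (meson ex_in_conv not_less)
    then show ?thesis
    proof cases
      case 1
      then have "S = {i}" using one by blast
      then have "i \<in> L" using S bound 1 unfolding lL by auto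
      then show ?thesis using \<open>S = {i}\<close> unfolding data_supports_def by blast
    next
      case 2
      have "S \<subseteq> {j}"
      proof
        fix x assume "x \<in> S"
        then have "p < x" using 2(3) by blast
        then show "x \<in> {j}" using one[OF \<open>x \<in> S\<close> 2(1)] 2(2) by simp
      qed
      then have "S = {j}" using 2(1) by (metis empty_iff subset_singletonD)
      moreover obtain j' where j': "j = p + j'" using 2(2) by (metis less_imp_add_positive)
      ultimately have "j' \<in> M"
        using S bound[OF S 2(1)] 2(2) by (simp add: lM)
      then show ?thesis using \<open>S = {j}\<close> j' unfolding data_supports_def by blast
    next
      case 3
      have "S = {i, j}"
      proof
        show "S \<subseteq> {i, j}"
        proof
          fix x assume "x \<in> S"
          then show "x \<in> {i, j}"
            using one[of x i] one[of x j] 3 by (cases "x \<le> p") (simp_all add: not_le)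
        qed
      qed (use 3 in blast)
      moreover obtain j' where j': "j = p + j'" using 3(4) by (metis less_imp_add_positive)
      ultimately have "linked p q \<omega> i j'"
        using S bound[OF S 3(1)] bound[OF S 3(3)] 3(2,4) by (simp add: linked_iff)
      then have "j' \<in> J" "i = \<sigma> j'" unfolding linked by auto
      then show ?thesis using \<open>S = {i, j}\<close> j' unfolding data_supports_def by blast
    qed
  qed
  moreover have "data_supports p J \<sigma> L M \<subseteq> supports \<omega>"
    using lJ lL lM unfolding data_supports_def by blast
  ultimately show s: "supports \<omega> = data_supports p J \<sigma> L M" by blast
  have sub: "J \<subseteq> {1..q}" "\<sigma> ` J \<subseteq> {1..p}" "L \<subseteq> {1..p}" "M \<subseteq> {1..q}" using lJ lL lM by blast+
  have "inj_on \<sigma> J"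
  proof (rule inj_onI)
    fix j j' assume j: "j \<in> J" "j' \<in> J" "\<sigma> j = \<sigma> j'"
    then have "{\<sigma> j, p + j} = {\<sigma> j', p + j'}" using meet[of _ _ "\<sigma> j"] lJ by (metis insertI1)
    then show "j = j'" using lJ[OF j(1)] lJ[OF j(2)] by (auto simp: doubleton_eq_iff)
  qed
  moreover have "\<sigma> ` J \<inter> L = {}"
  proof (rule ccontr)
    assume "\<sigma> ` J \<inter> L \<noteq> {}"
    then obtain j where j: "j \<in> J" "\<sigma> j \<in> L" by blast
    then have "{\<sigma> j, p + j} = {\<sigma> j}" using meet[of _ _ "\<sigma> j"] lJ lL by (metis insertI1)
    then show False using lJ[OF j(1)] by auto
  qed
  moreover have "J \<inter> M = {}"
  proof (rule ccontr)
    assume "J \<inter> M \<noteq> {}"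
    then obtain j where j: "j \<in> J" "j \<in> M" by blast
    then have "{\<sigma> j, p + j} = {p + j}" using meet[of _ _ "p + j"] lJ lM by (metis insertI1 insertCI)
    then show False using lJ[OF j(1)] by auto
  qed
  moreover have "card J + card L + card M = r"
  proof -
    have fin: "finite J" "finite L" "finite M" using sub by (meson finite_atLeastAtMost finite_subset)+
    have "card (data_supports p J \<sigma> L M) = card J + card L + card M"
      using fin lJ lL lM by (intro card_data_supports) auto
    moreover have "card (supports \<omega>) = r" using inj_on_ones[OF l] unfolding supp by (simp add: card_image)
    ultimately show ?thesis using s by simp
  qed
  ultimately show "link_data p q r J \<sigma> L M" using sub unfolding link_data_def by blast
qed

lemma link_matrix_exists:
  assumes d: "link_data p q r J \<sigma> L M"
  obtains \<omega> :: "'a::field mat" where "link_matrix p q r \<omega>" "supports \<omega> = data_supports p J \<sigma> L M"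
proof -
  have b: "\<And>j. j \<in> J \<Longrightarrow> 1 \<le> j \<and> j \<le> q \<and> 1 \<le> \<sigma> j \<and> \<sigma> j \<le> p" "\<And>i. i \<in> L \<Longrightarrow> 1 \<le> i \<and> i \<le> p"
    "\<And>j. j \<in> M \<Longrightarrow> 1 \<le> j \<and> j \<le> q"
    using d unfolding link_data_def by (fastforce, fastforce, fastforce)
  have inj: "inj_on \<sigma> J" "\<sigma> ` J \<inter> L = {}" "J \<inter> M = {}" "card J + card L + card M = r"
    using d unfolding link_data_def by blast+
  let ?S = "data_supports p J \<sigma> L M"
  note fin = link_data_finite[OF d]
  have "card ?S = r" using card_data_supports[of J L M \<sigma> p] fin b inj(4) by simp
  moreover have "finite ?S" using fin by (simp add: data_supports_def)
  \<comment> \<open>Any enumeration of the supports will do as the sequence of columns; another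
    choice permutes the columns.\<close>
  ultimately obtain e where e: "bij_betw e {..<r} ?S"
    using ex_bij_betw_nat_finite[of ?S] by (auto simp: atLeast0LessThan)
  define \<omega> :: "'a mat" where "\<omega> = mat (p + q) r (\<lambda>(i, k). if Suc i \<in> e k then 1 else 0)"
  have c: "\<omega> \<in> carrier_mat (p + q) r" by (simp add: \<omega>_def)
  have eS: "e k \<in> ?S" if "k < r" for k using e that by (auto simp: bij_betw_def)
  have S: "i \<in> {1..p + q}" if "s \<in> ?S" "i \<in> s" for s i
    using that b unfolding data_supports_def by fastforce
  have ones: "ones_in_col \<omega> k = e k" if "k < r" for k
  proof (rule Set.set_eqI)
    fix i
    show "i \<in> ones_in_col \<omega> k \<longleftrightarrow> i \<in> e k"
      unfolding ones_in_col_iff[OF c] using that S[OF eS[OF that], of i] by (auto simp: \<omega>_def split: if_splits)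
  qed
  have "supports \<omega> = ?S" using c ones e by (auto simp: supports_def bij_betw_def)
  have meet: "s = s'" if "s \<in> ?S" "s' \<in> ?S" "i \<in> s" "i \<in> s'" for s s' i
  proof -
    \<comment> \<open>Disjointness follows from explicit formulas: a label, together with the data,
      determines the support in which it lies.\<close>
    have *: "s = (if i \<in> L then {i} else {i, p + inv_into J \<sigma> i})" if "s \<in> ?S" "i \<in> s" "i \<le> p" for s
      using that b inj(1,2) unfolding data_supports_def by (fastforce simp: inv_into_f_f)
    have **: "s = (if i - p \<in> M then {i} else {\<sigma> (i - p), i})" if "s \<in> ?S" "i \<in> s" "\<not> i \<le> p" for s
      using that b inj(3) unfolding data_supports_def by fastforce
    show ?thesis using *[of s] *[of s'] **[of s] **[of s'] that by metis
  qed
  have one: "i = i'" if "s \<in> ?S" "i \<in> s" "i' \<in> s" "i \<le> p \<longleftrightarrow> i' \<le> p" for s i i'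
    using that b unfolding data_supports_def by fastforce
  have "link_matrix p q r \<omega>"
    unfolding link_matrix_def
  proof (intro conjI allI impI ballI)
    fix k k' assume "k < r" "k' < r" "ones_in_col \<omega> k \<inter> ones_in_col \<omega> k' \<noteq> {}"
    moreover from this have "e k = e k'" using meet eS ones by (metis disjoint_iff)
    moreover have "inj_on e {..<r}" using e by (simp add: bij_betw_def)
    ultimately show "k = k'" by (auto dest: inj_onD)
  next
    fix k assume "k < r"
    then show "ones_in_col \<omega> k \<noteq> {}" using ones eS[of k] by (auto simp: data_supports_def)
  next
    fix k i i' assume "k < r" "i \<in> ones_in_col \<omega> k" "i' \<in> ones_in_col \<omega> k" "i \<le> p \<longleftrightarrow> i' \<le> p"
    then show "i = i'" using one[OF eS[of k]] ones by metis
  qed (use c in \<open>auto simp: \<omega>_def\<close>)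
  then show thesis using that \<open>supports \<omega> = ?S\<close> by blast
qed

section \<open>The induced map on classes\<close>

text \<open>Needed because \<open>data_sigma\<close> and a given \<open>\<sigma>\<close> agree only
  on \<open>J\<close>.\<close>

lemma RS_cong: "finite S \<Longrightarrow> (\<And>s. s \<in> S \<Longrightarrow> w s = w' s) \<Longrightarrow> RS\<^sub>1 S w = RS\<^sub>1 S w' \<and> RS\<^sub>2 S w = RS\<^sub>2 S w'"
proof -
  assume "finite S" "\<And>s. s \<in> S \<Longrightarrow> w s = w' s"
  then have "map w (sorted_list_of_set S) = map w' (sorted_list_of_set S)" by simp
  then show ?thesis by (simp only: RS\<^sub>1_eq RS\<^sub>2_eq)
qed

lemma gRS_eq_data_tuple:
  assumes d: "link_data p q r J \<sigma> L M" and s: "supports \<omega> = data_supports p J \<sigma> L M"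
  shows "gRS p q \<omega> = data_tuple p q J \<sigma> L M"
proof -
  note e = data_of_supports[OF d s]
  have "RS\<^sub>1 J (data_sigma p q \<omega>) = RS\<^sub>1 J \<sigma> \<and> RS\<^sub>2 J (data_sigma p q \<omega>) = RS\<^sub>2 J \<sigma>"
    using link_data_finite[OF d] e(6) by (intro RS_cong) auto
  then show ?thesis
    unfolding gRS_def data_tuple_def Let_def data_L'_def data_M'_def e(2-5) by simp
qed

theorem theorem2p9:
  fixes p q r :: nat
  assumes "p \<ge> 1" and "q \<ge> 1" and "r \<le> p + q"
  shows "(gRS p q :: 'a::field mat \<Rightarrow> gRS_tuple) respects col_perm_rel p q r \<and>
    bij_betw (gRS_quot p q :: 'a mat set \<Rightarrow> gRS_tuple)
      (frakT p q r // col_perm_rel p q r) (calT p q r)"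
proof -
  let ?R = "col_perm_rel p q r :: ('a mat \<times> 'a mat) set"
  let ?T = "frakT p q r :: 'a mat set"
  have data: "\<exists>J \<sigma> L M. link_data p q r J \<sigma> L M \<and> supports \<omega> = data_supports p J \<sigma> L M" if "\<omega> \<in> ?T" for \<omega>
    using link_matrix_data[of p q r \<omega>] that unfolding frakT_iff by blast
  \<comment> \<open>The value of \<open>gRS\<close> depends on the matrix only through its set of
    supports, which is the invariant of the class.\<close>
  have resp: "gRS p q A = gRS p q B" if AB: "(A, B) \<in> ?R" for A B
  proof -
    have *: "A \<in> ?T" "supports B = supports A" using AB unfolding col_perm_rel_iff by auto
    obtain J \<sigma> L M where d: "link_data p q r J \<sigma> L M" "supports A = data_supports p J \<sigma> L M"
      using data[OF *(1)] by blast
    then show ?thesis using gRS_eq_data_tuple[OF d] gRS_eq_data_tuple[of p q r J \<sigma> L M B] *(2) by simp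
  qed
  have equiv: "equiv ?T ?R" by (rule equiv_col_perm_rel)
  have quot: "gRS_quot p q (?R `` {\<omega>}) = gRS p q \<omega>" if "\<omega> \<in> ?T" for \<omega>
  proof -
    have "\<omega> \<in> ?R `` {\<omega>}" using equiv_class_self[OF equiv that] .
    moreover have "gRS p q A = gRS p q \<omega>" if "A \<in> ?R `` {\<omega>}" for A using that resp by auto
    ultimately have "gRS p q ` (?R `` {\<omega>}) = {gRS p q \<omega>}" by blast
    then show ?thesis by (simp add: gRS_quot_def)
  qed
  have "inj_on (gRS_quot p q) (?T // ?R)"
  proof (rule inj_onI)
    fix X Y assume "X \<in> ?T // ?R" "Y \<in> ?T // ?R" and eq: "gRS_quot p q X = gRS_quot p q Y"
    then obtain A B where A: "A \<in> ?T" "X = ?R `` {A}" and B: "B \<in> ?T" "Y = ?R `` {B}"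
      by (auto elim!: quotientE)
    obtain J \<sigma> L M where d: "link_data p q r J \<sigma> L M" "supports A = data_supports p J \<sigma> L M"
      using data[OF A(1)] by blast
    obtain J' \<sigma>' L' M' where d': "link_data p q r J' \<sigma>' L' M'" "supports B = data_supports p J' \<sigma>' L' M'"
      using data[OF B(1)] by blast
    have "data_tuple p q J \<sigma> L M = data_tuple p q J' \<sigma>' L' M'"
      using eq quot A B gRS_eq_data_tuple[OF d] gRS_eq_data_tuple[OF d'] by simp
    then have "J = J' \<and> L = L' \<and> M = M' \<and> (\<forall>j\<in>J. \<sigma> j = \<sigma>' j)"
      using data_tuple_inj[OF d(1) d'(1)] by blast
    then have "data_supports p J \<sigma> L M = data_supports p J' \<sigma>' L' M'"
      unfolding data_supports_def by (simp cong: image_cong)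
    then have "(A, B) \<in> ?R" unfolding col_perm_rel_iff using A B d(2) d'(2) by simp
    then show "X = Y" using equiv_class_eq[OF equiv] A B by simp
  qed
  moreover have "gRS_quot p q ` (?T // ?R) = calT p q r"
  proof (intro equalityI subsetI)
    fix t assume "t \<in> gRS_quot p q ` (?T // ?R)"
    then obtain A where A: "A \<in> ?T" "t = gRS p q A" using quot by (auto elim!: quotientE)
    obtain J \<sigma> L M where d: "link_data p q r J \<sigma> L M" "supports A = data_supports p J \<sigma> L M"
      using data[OF A(1)] by blast
    then show "t \<in> calT p q r" using A(2) gRS_eq_data_tuple[OF d] data_tuple_in_calT[OF d(1)] by simp
  next
    fix t :: gRS_tuple assume "t \<in> calT p q r"
    then obtain J \<sigma> L M where d: "link_data p q r J \<sigma> L M" "data_tuple p q J \<sigma> L M = t"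
      by (rule data_tuple_surj)
    obtain \<omega> :: "'a mat" where \<omega>: "link_matrix p q r \<omega>" "supports \<omega> = data_supports p J \<sigma> L M"
      using link_matrix_exists[OF d(1)] by metis
    then have "\<omega> \<in> ?T" by (simp add: frakT_iff)
    moreover have "gRS p q \<omega> = t" using gRS_eq_data_tuple[OF d(1) \<omega>(2)] d(2) by simp
    ultimately show "t \<in> gRS_quot p q ` (?T // ?R)" using quot quotientI by (metis image_eqI)
  qed
  ultimately show ?thesis
    unfolding congruent_def bij_betw_def using resp by blast
qed

end
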